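(* Let $P=\langle\mathcal S,s_0,g,\mathcal A,\mathcal T\rangle$ be a STRIPS planning problem with a single goal atom $g$. Let $T$ be the length of the optimal trajectory (the planning horizon), let $k_{\mathrm{BWD}}$ be the maximum number of atoms in a goal set occurring in the backward search algorithm BWD, and let $\beta$ be the maximum arity of atoms in the domain. Then BWD can be compiled into a relational neural network in $\mathrm{RelNN}[O(T),\ \beta\cdot k_{\mathrm{BWD}}]$.
   Context: **Planning problems (atomic STRIPS).** A domain has a finite set of predicates and a finite set of action schemas. Given a finite set $\mathcal U$ of objects, an atom is a predicate applied to a tuple of objects; $\mathcal P_0$ is the set of all atoms. A state is a set of atoms (those that are true; all others are false). An action schema has a list of variables and sets of atoms $\mathit{pre}$, $\mathit{eff}_+$, $\mathit{eff}_-$ over these variables; binding the variables to objects yields a ground action $a$ with sets of ground atoms $\mathit{pre}(a),\mathit{eff}_+(a),\mathit{eff}_-(a)$. $\mathcal A$ is the set of ground actions. If $\mathit{pre}(a)\subseteq s$ then $\mathcal T(s,a)=(s\cup\mathit{eff}_+(a))\setminus\mathit{eff}_-(a)$; otherwise $\mathcal T(s,a)$ is undefined. A problem is $P=\langle\mathcal S,s_0,g,\mathcal A,\mathcal T\rangle$ with state space $\mathcal S$, initial state $s_0$ and a single goal atom $g$; a plan is a sequence of actions executable from $s_0$ ending in a state containing $g$; an optimal plan (trajectory) is a shortest one. **Backward search (BWD).** $\mathrm{BWD}(s_0,\mathcal A,G)$, for a set of atoms $G$ (the goal set), is recursive, initially called with $G=\{g\}$. If $G\subseteq s_0$, return the empty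 plan. Otherwise, for every $a\in\mathcal A$ with $G\cap\mathit{eff}_-(a)=\emptyset$ and $G\cap\mathit{eff}_+(a)\ne\emptyset$, let $G'=(G\cup\mathit{pre}(a))\setminus\mathit{eff}_+(a)$; skip $a$ if $G'$ is already one of the goal sets on the current recursion stack; else let $\pi=\mathrm{BWD}(s_0,\mathcal A,G')$, and if $\pi\neq\perp$, record the candidate plan $\pi$ followed by $a$. Return a shortest recorded plan ($\perp$ if there is none). **Relational neural networks.** $\mathrm{RelNN}[D,B]$ is the family of relational (hypergraph) neural networks of depth $D$ (number of layers) and breadth $B$ (maximum arity of the relations/hyperedges represented). At each layer such a network stores, for every $r\le B$ and every $r$-tuple of objects, a feature vector; the vector of an $r$-tuple at the next layer is obtained by applying a function (an MLP shared by all tuples of arity $r$) to the previous-layer features of the tuple and its argument permutations, of its sub-tuples of size $r-1$, and of aggregations (e.g. max/exists, min/forall, sum) over one extra object of the features of $(r+1)$-tuples extending it. The feature dimension is bounded (e.g. by a function of $B$ and the number of predicates of the domain), independently of the number of objects, and the network parameters are shared across all tuples of objects. The input encodes the current state and the goal as tensors: for each predicate of arity $r$, a Boolean feature on $r$-tuples, and the goal is encoded likewise by special goal predicates. The output is a ground action (for an action schema of arity $r$, a feature on $r$-tuples). **Compilation.** That a search algorithm is compiled into a network means that there is a network in the class, constructed from the operator descriptions (action schemas) of the domain, representing a goal-conditioned policy: given the current state and the goal as input, it outputs the next (first) ground action of a plan found by the algorithm for achieving the goal from that state.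
   Formalization: The network also receives equality of objects as a built-in input predicate, and for action schemas with more arguments than the breadth the output is read from argument equalities and features of sub-tuples of breadth size; without these the claim fails or the output is undefined. *)

theory Defs
  imports Complex_Main "HOL-Library.Landau_Symbols"
begin

section \<open>STRIPS planning\<close>

type_synonym ('p, 'o) atom = "'p \<times> 'o list"

type_synonym ('a, 'o) gaction = "'a \<times> 'o list"

text \<open>The finite sets of predicates and of action schemas are kept as distinct lists: the order fixes
  the layout of the input vectors of a network. The variables of a schema \<open>a\<close> are the numbers
  below \<open>act_arity D a\<close>.\<close>

record ('p, 'a) domain =
  preds :: "'p list"
  pred_arity :: "'p \<Rightarrow> nat"
  acts :: "'a list"
  act_arity :: "'a \<Rightarrow> nat"
  pre :: "'a \<Rightarrow> ('p, nat) atom set"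
  add_eff :: "'a \<Rightarrow> ('p, nat) atom set"
  del_eff :: "'a \<Rightarrow> ('p, nat) atom set"

definition atoms :: "('p, 'a) domain \<Rightarrow> 'o set \<Rightarrow> ('p, 'o) atom set" where
  "atoms D U = {(p, xs). p \<in> set (preds D) \<and> length xs = pred_arity D p \<and> set xs \<subseteq> U}"

definition wf_domain :: "('p, 'a) domain \<Rightarrow> bool" where
  "wf_domain D \<longleftrightarrow> distinct (preds D) \<and> distinct (acts D) \<and>
     (\<forall>a \<in> set (acts D). pre D a \<union> add_eff D a \<union> del_eff D a \<subseteq> atoms D {..<act_arity D a})"

definition max_arity :: "('p, 'a) domain \<Rightarrow> nat" where
  "max_arity D = Max (pred_arity D ` set (preds D))"

definition ground_actions :: "('p, 'a) domain \<Rightarrow> 'o set \<Rightarrow> ('a, 'o) gaction set" where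
  "ground_actions D U = {(a, xs). a \<in> set (acts D) \<and> length xs = act_arity D a \<and> set xs \<subseteq> U}"

definition inst :: "'o list \<Rightarrow> ('p, nat) atom \<Rightarrow> ('p, 'o) atom" where
  "inst xs = (\<lambda>(p, vs). (p, map ((!) xs) vs))"

definition gpre :: "('p, 'a) domain \<Rightarrow> ('a, 'o) gaction \<Rightarrow> ('p, 'o) atom set" where
  "gpre D = (\<lambda>(a, xs). inst xs ` pre D a)"

definition gadd :: "('p, 'a) domain \<Rightarrow> ('a, 'o) gaction \<Rightarrow> ('p, 'o) atom set" where
  "gadd D = (\<lambda>(a, xs). inst xs ` add_eff D a)"

definition gdel :: "('p, 'a) domain \<Rightarrow> ('a, 'o) gaction \<Rightarrow> ('p, 'o) atom set" where
  "gdel D = (\<lambda>(a, xs). inst xs ` del_eff D a)"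

definition transition ::
  "('p, 'a) domain \<Rightarrow> ('p, 'o) atom set \<Rightarrow> ('a, 'o) gaction \<Rightarrow> ('p, 'o) atom set option" where
  "transition D s a = (if gpre D a \<subseteq> s then Some ((s \<union> gadd D a) - gdel D a) else None)"

fun execute ::
  "('p, 'a) domain \<Rightarrow> ('p, 'o) atom set \<Rightarrow> ('a, 'o) gaction list \<Rightarrow> ('p, 'o) atom set option" where
  "execute D s [] = Some s"
| "execute D s (a # \<pi>) = Option.bind (transition D s a) (\<lambda>s'. execute D s' \<pi>)"

text \<open>A problem over \<open>D\<close> is given by its objects, its initial state and its goal atom; the state space is
  \<open>Pow (atoms D U)\<close>.\<close>

definition planning_problem ::
  "('p, 'a) domain \<Rightarrow> 'o set \<Rightarrow> ('p, 'o) atom set \<Rightarrow> ('p, 'o) atom \<Rightarrow> bool" where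
  "planning_problem D U s\<^sub>0 g \<longleftrightarrow> finite U \<and> U \<noteq> {} \<and> s\<^sub>0 \<subseteq> atoms D U \<and> g \<in> atoms D U"

definition is_plan ::
  "('p, 'a) domain \<Rightarrow> 'o set \<Rightarrow> ('p, 'o) atom set \<Rightarrow> ('p, 'o) atom \<Rightarrow> ('a, 'o) gaction list \<Rightarrow> bool" where
  "is_plan D U s\<^sub>0 g \<pi> \<longleftrightarrow>
     set \<pi> \<subseteq> ground_actions D U \<and> (\<exists>s. execute D s\<^sub>0 \<pi> = Some s \<and> g \<in> s)"

definition optimal_plan ::
  "('p, 'a) domain \<Rightarrow> 'o set \<Rightarrow> ('p, 'o) atom set \<Rightarrow> ('p, 'o) atom \<Rightarrow> ('a, 'o) gaction list \<Rightarrow> bool" where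
  "optimal_plan D U s\<^sub>0 g \<pi> \<longleftrightarrow> is_arg_min length (is_plan D U s\<^sub>0 g) \<pi>"


section \<open>Backward search\<close>

definition regress ::
  "('p, 'a) domain \<Rightarrow> ('p, 'o) atom set \<Rightarrow> ('a, 'o) gaction \<Rightarrow> ('p, 'o) atom set" where
  "regress D G a = (G \<union> gpre D a) - gadd D a"

text \<open>The actions not skipped by a call on \<open>G\<close>; \<open>stk\<close> holds the goal sets of the enclosing calls and
  excludes \<open>G\<close> itself, which is on the stack as well while the call on \<open>G\<close> is running.\<close>

definition bwd_acts ::
  "('p, 'a) domain \<Rightarrow> 'o set \<Rightarrow> ('p, 'o) atom set set \<Rightarrow> ('p, 'o) atom set \<Rightarrow> ('a, 'o) gaction set" where
  "bwd_acts D U stk G = {a \<in> ground_actions D U.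
     G \<inter> gdel D a = {} \<and> G \<inter> gadd D a \<noteq> {} \<and> regress D G a \<notin> insert G stk}"

text \<open>Big-step semantics: \<open>bwd_result D U s\<^sub>0 stk G r\<close> says that the call on \<open>G\<close> with stack \<open>stk\<close> may
  return \<open>r\<close>, where \<open>None\<close> stands for \<open>\<bottom>\<close>. It is a relation since the choice among several shortest
  recorded plans is left open; \<open>res a\<close> is what the recursive call made for \<open>a\<close> has returned.\<close>

inductive bwd_result ::
  "('p, 'a) domain \<Rightarrow> 'o set \<Rightarrow> ('p, 'o) atom set \<Rightarrow> ('p, 'o) atom set set \<Rightarrow> ('p, 'o) atom set \<Rightarrow>
   ('a, 'o) gaction list option \<Rightarrow> bool"
  for D :: "('p, 'a) domain" and U :: "'o set" and s\<^sub>0 :: "('p, 'o) atom set" where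
  sat: "G \<subseteq> s\<^sub>0 \<Longrightarrow> bwd_result D U s\<^sub>0 stk G (Some [])"
| plan: "\<lbrakk> \<not> G \<subseteq> s\<^sub>0;
     \<And>a. a \<in> bwd_acts D U stk G \<Longrightarrow> bwd_result D U s\<^sub>0 (insert G stk) (regress D G a) (res a);
     recorded = {\<pi> @ [a] | \<pi> a. a \<in> bwd_acts D U stk G \<and> res a = Some \<pi>};
     is_arg_min length (\<lambda>\<pi>. \<pi> \<in> recorded) \<pi> \<rbrakk>
   \<Longrightarrow> bwd_result D U s\<^sub>0 stk G (Some \<pi>)"
| fail: "\<lbrakk> \<not> G \<subseteq> s\<^sub>0;
     \<And>a. a \<in> bwd_acts D U stk G \<Longrightarrow> bwd_result D U s\<^sub>0 (insert G stk) (regress D G a) None \<rbrakk>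
   \<Longrightarrow> bwd_result D U s\<^sub>0 stk G None"

text \<open>The recursive calls made in the course of the search for \<open>g\<close>.\<close>

inductive bwd_call ::
  "('p, 'a) domain \<Rightarrow> 'o set \<Rightarrow> ('p, 'o) atom set \<Rightarrow> ('p, 'o) atom \<Rightarrow> ('p, 'o) atom set set \<Rightarrow>
   ('p, 'o) atom set \<Rightarrow> bool"
  for D :: "('p, 'a) domain" and U :: "'o set" and s\<^sub>0 :: "('p, 'o) atom set" and g :: "('p, 'o) atom" where
  init: "bwd_call D U s\<^sub>0 g {} {g}"
| rec: "\<lbrakk> bwd_call D U s\<^sub>0 g stk G; \<not> G \<subseteq> s\<^sub>0; a \<in> bwd_acts D U stk G \<rbrakk>
   \<Longrightarrow> bwd_call D U s\<^sub>0 g (insert G stk) (regress D G a)"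

definition k_BWD ::
  "('p, 'a) domain \<Rightarrow> 'o set \<Rightarrow> ('p, 'o) atom set \<Rightarrow> ('p, 'o) atom \<Rightarrow> nat" where
  "k_BWD D U s\<^sub>0 g = Max {card G | stk G. bwd_call D U s\<^sub>0 g stk G}"


section \<open>Relational neural networks\<close>

text \<open>An affine layer is a list of rows, each consisting of weights and a bias; an MLP applies ReLU
  between its affine layers.\<close>

type_synonym affine = "(real list \<times> real) list"
type_synonym mlp = "affine list"

definition affine_apply :: "affine \<Rightarrow> real list \<Rightarrow> real list" where
  "affine_apply A x = map (\<lambda>(w, b). (\<Sum>(u, v) \<leftarrow> zip w x. u * v) + b) A"

definition relu :: "real \<Rightarrow> real" where
  "relu x = max 0 x"

fun mlp_apply :: "mlp \<Rightarrow> real list \<Rightarrow> real list" where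
  "mlp_apply [] x = x"
| "mlp_apply [A] x = affine_apply A x"
| "mlp_apply (A # As) x = mlp_apply As (map relu (affine_apply A x))"

definition is_mlp :: "mlp \<Rightarrow> nat \<Rightarrow> bool" where
  "is_mlp M n \<longleftrightarrow> M \<noteq> [] \<and> length (last M) = n"

text \<open>A layer holds one MLP for each arity. The readout holds one MLP for each action schema and
  produces a score for every ground action.\<close>

record 'a relnn =
  breadth :: nat
  layers :: "(nat \<Rightarrow> mlp) list"
  readout :: "'a \<Rightarrow> mlp"

text \<open>\<open>RelNN d B w\<close>: depth \<open>d\<close>, breadth \<open>B\<close>, feature vectors of dimension at most \<open>w\<close>.\<close>

definition RelNN :: "nat \<Rightarrow> nat \<Rightarrow> nat \<Rightarrow> 'a relnn set" where
  "RelNN d B w = {N. length (layers N) = d \<and> breadth N = B \<and>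
     (\<forall>L \<in> set (layers N). \<forall>r \<le> B. \<exists>n \<le> w. is_mlp (L r) n) \<and>
     (\<forall>a. is_mlp (readout N a) 1)}"

text \<open>The built-in equality predicate: which positions of a tuple hold the same object.\<close>

definition eq_features :: "'o list \<Rightarrow> real list" where
  "eq_features xs = [of_bool (xs ! i = xs ! j). i \<leftarrow> [0..<length xs], j \<leftarrow> [0..<i]]"

definition input_features ::
  "('p, 'a) domain \<Rightarrow> ('p, 'o) atom set \<Rightarrow> ('p, 'o) atom \<Rightarrow> 'o list \<Rightarrow> real list" where
  "input_features D s g xs =
     [of_bool ((p, xs) \<in> s). p \<leftarrow> preds D, pred_arity D p = length xs] @
     [of_bool ((p, xs) = g). p \<leftarrow> preds D, pred_arity D p = length xs] @
     eq_features xs"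

definition arg_perms :: "'o list \<Rightarrow> 'o list list" where
  "arg_perms xs = [map ((!) xs) \<sigma>. \<sigma> \<leftarrow> List.n_lists (length xs) [0..<length xs], distinct \<sigma>]"

text \<open>\<open>subseqs\<close> works on positions: a tuple of length \<open>r\<close> has \<open>r choose n\<close> sub-tuples of size \<open>n\<close>, in an
  order that depends on \<open>r\<close> and \<open>n\<close> only, whether or not objects are repeated in it.\<close>

definition subtuples :: "nat \<Rightarrow> 'o list \<Rightarrow> 'o list list" where
  "subtuples n xs = [ys. ys \<leftarrow> subseqs xs, length ys = n]"

text \<open>Componentwise maximum, minimum and sum over one additional object (for a finite nonempty
  \<open>U\<close>; all the vectors \<open>h (xs @ [x])\<close> have the same dimension).\<close>

definition aggregate :: "'o set \<Rightarrow> ('o list \<Rightarrow> real list) \<Rightarrow> 'o list \<Rightarrow> real list" where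
  "aggregate U h xs =
     (let n = Max ((\<lambda>x. length (h (xs @ [x]))) ` U)
      in [Max ((\<lambda>x. h (xs @ [x]) ! i) ` U). i \<leftarrow> [0..<n]] @
         [Min ((\<lambda>x. h (xs @ [x]) ! i) ` U). i \<leftarrow> [0..<n]] @
         [(\<Sum>x\<in>U. h (xs @ [x]) ! i). i \<leftarrow> [0..<n]])"

definition layer_apply ::
  "nat \<Rightarrow> 'o set \<Rightarrow> (nat \<Rightarrow> mlp) \<Rightarrow> ('o list \<Rightarrow> real list) \<Rightarrow> 'o list \<Rightarrow> real list" where
  "layer_apply B U L h xs = mlp_apply (L (length xs))
     (concat (map h (arg_perms xs)) @
      (if length xs = 0 then [] else concat (map h (subtuples (length xs - 1) xs))) @
      (if length xs < B then aggregate U h xs else []))"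

text \<open>The features of the last layer; meaningful for tuples of length at most the breadth.\<close>

definition features ::
  "('p, 'a) domain \<Rightarrow> 'a relnn \<Rightarrow> 'o set \<Rightarrow> ('p, 'o) atom set \<Rightarrow> ('p, 'o) atom \<Rightarrow> 'o list \<Rightarrow> real list" where
  "features D N U s g = fold (layer_apply (breadth N) U) (layers N) (input_features D s g)"

text \<open>The score of a ground action is read off from the features of its argument tuple or, for a schema
  with more arguments than the breadth, from those of the largest sub-tuples the network represents.\<close>

definition score ::
  "('p, 'a) domain \<Rightarrow> 'a relnn \<Rightarrow> 'o set \<Rightarrow> ('p, 'o) atom set \<Rightarrow> ('p, 'o) atom \<Rightarrow> ('a, 'o) gaction \<Rightarrow> real" where
  "score D N U s g = (\<lambda>(a, xs). hd (mlp_apply (readout N a)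
     (eq_features xs @
      concat (map (features D N U s g) (subtuples (min (length xs) (breadth N)) xs)))))"

text \<open>The ground actions the network may output: those of maximal score. As a network treats
  indistinguishable objects alike, ties cannot be excluded.\<close>

definition policy ::
  "('p, 'a) domain \<Rightarrow> 'a relnn \<Rightarrow> 'o set \<Rightarrow> ('p, 'o) atom set \<Rightarrow> ('p, 'o) atom \<Rightarrow> ('a, 'o) gaction set" where
  "policy D N U s g = {a. is_arg_max (score D N U s g) (\<lambda>a. a \<in> ground_actions D U) a}"

text \<open>The network represents BWD on the problem with state \<open>s\<close> and goal \<open>g\<close>: unless the goal is already
  achieved (and the plan found is empty), every output is the first action of a plan BWD may return.\<close>

definition represents_bwd ::
  "('p, 'a) domain \<Rightarrow> 'a relnn \<Rightarrow> 'o set \<Rightarrow> ('p, 'o) atom set \<Rightarrow> ('p, 'o) atom \<Rightarrow> bool" where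
  "represents_bwd D N U s g \<longleftrightarrow> g \<notin> s \<longrightarrow>
     policy D N U s g \<noteq> {} \<and>
     (\<forall>a \<in> policy D N U s g. \<exists>\<pi>. bwd_result D U s {} {g} (Some (a # \<pi>)))"

end

theory Submission
  imports Defs "HOL-Library.Sublist"
begin

text \<open>
  A goal set all of whose atoms together mention \<open>r \<le> B\<close> objects is the instance of a finite pattern
  (a set of atoms over the positions \<open>0, \<dots>, r - 1\<close>) at a tuple of \<open>r\<close> distinct objects, and the number of
  patterns depends on \<open>B\<close> only. So a network of breadth \<open>B\<close> can hold, for every goal set of at most \<open>k\<close>
  atoms, the round in which breadth-first regression from \<open>{g}\<close> first reaches it. One regression step
  introduces and removes boundedly many objects, hence costs a number of layers that depends on the
  domain only. A step may involve more than \<open>B\<close> objects at once: the objects that disappear have to be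
  summed out while they are kept distinct from those that are about to appear. Inclusion-exclusion on
  the sums reduces this to tuples within the breadth; objects that occur in the action only are
  dealt with by comparing the number of all objects with a constant.

  After \<open>T\<close> rounds the least round in which a goal set holding in the state was reached is spread to
  all tuples, the goal sets one round earlier are marked, and their remaining objects are summed out, so
  that the readout sees whether an action regresses a marked goal set into the state. Relevant
  tuples have length \<open>O(T)\<close>, whence the total depth. On the other side, a shortest regression path
  repeats no goal set, so the stack does not prune it and BWD may return it.
\<close>

section \<open>Rectifier networks on tuples of inputs\<close>

text \<open>The depth has to be fixed before \<open>k\<close>, hence before the breadth
  \<open>B\<close>, and the width before \<open>T\<close>. The first demand rules out any stage that
  walks through all tuple lengths up to \<open>B\<close>: facts about the state are handed to longer
  tuples one length per block, and only up to length \<open>\<beta> + \<alpha> * T\<close>, the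
  number of objects a goal set can have after \<open>T\<close> regressions. The second demand is met
  by letting all rounds share their weights: a round is a map on an abstract search state, which one
  block of layers simulates and which is then iterated. Such a block does not know the index of its
  round. Therefore it stores ages, which grow by one, and the depth of a solution is recovered from
  the largest age among the goal sets that hold in the state. Ages are unbounded, so fixed weights
  cannot multiply them by truth values, and the conditional ages needed later are carried as
  features of their own. The bound \<open>k_BWD\<close> applies to breadth-first levels because a
  goal set first reached in some round, with no set of an earlier round holding in the state, is the
  argument of an actual call of BWD.\<close>

text \<open>The closure of \<open>S\<close> under the operations of an MLP. Only the values at inputs that satisfy \<open>V\<close>
  matter.\<close>

inductive_set plc :: "('e \<Rightarrow> 'x \<Rightarrow> bool) \<Rightarrow> ('e \<Rightarrow> 'x \<Rightarrow> real) set \<Rightarrow> ('e \<Rightarrow> 'x \<Rightarrow> real) set"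
  for V S where
  base: "f \<in> S \<Longrightarrow> f \<in> plc V S"
| const: "(\<lambda>e x. c) \<in> plc V S"
| add: "f \<in> plc V S \<Longrightarrow> g \<in> plc V S \<Longrightarrow> (\<lambda>e x. f e x + g e x) \<in> plc V S"
| scale: "f \<in> plc V S \<Longrightarrow> (\<lambda>e x. c * f e x) \<in> plc V S"
| relu: "f \<in> plc V S \<Longrightarrow> (\<lambda>e x. relu (f e x)) \<in> plc V S"
| cong: "f \<in> plc V S \<Longrightarrow> (\<And>e x. V e x \<Longrightarrow> g e x = f e x) \<Longrightarrow> g \<in> plc V S"

lemma plc_mono:
  assumes "f \<in> plc V S" "S \<subseteq> plc V S'"
  shows "f \<in> plc V S'"
  using assms(1)
proof induction
  case (base f) then show ?case using assms(2) by blast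
next
  case (cong f g) then show ?case using plc.cong by blast
qed (auto intro: plc.const plc.add plc.scale plc.relu)

lemma plc_subset: "f \<in> plc V S \<Longrightarrow> S \<subseteq> S' \<Longrightarrow> f \<in> plc V S'"
  by (erule plc_mono) (auto intro: plc.base)

text \<open>The generating sets are infinite in general, whereas a layer stores finitely many
  features. A derivation uses only finitely many generators, and these are the features that the
  layer below has to provide.\<close>

lemma plc_finite_support:
  assumes "f \<in> plc V S"
  shows "\<exists>S0. finite S0 \<and> S0 \<subseteq> S \<and> f \<in> plc V S0"
  using assms
proof induction
  case (base f)
  then show ?case by (intro exI[of _ "{f}"]) (auto intro: plc.base)
next
  case (const c)
  then show ?case by (intro exI[of _ "{}"]) (auto intro: plc.const)
next
  case (add f g)
  then obtain A A' where "finite A" "A \<subseteq> S" "f \<in> plc V A" "finite A'" "A' \<subseteq> S" "g \<in> plc V A'"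
    by blast
  note A = this
  have "f \<in> plc V (A \<union> A')" using A(3) by (rule plc_mono) (auto intro: plc.base)
  moreover have "g \<in> plc V (A \<union> A')" using A(6) by (rule plc_mono) (auto intro: plc.base)
  ultimately have "(\<lambda>e x. f e x + g e x) \<in> plc V (A \<union> A')" by (rule plc.add)
  then show ?case using A by (intro exI[of _ "A \<union> A'"]) simp
next
  case (scale f c)
  then show ?case by (auto intro: plc.scale)
next
  case (relu f)
  then show ?case by (auto intro: plc.relu)
next
  case (cong f g)
  then obtain S0 where "finite S0" "S0 \<subseteq> S" "f \<in> plc V S0" by blast
  then show ?case using plc.cong[of f V S0 g] cong.hyps(2) by blast
qed

lemma plc_diff: "f \<in> plc V S \<Longrightarrow> g \<in> plc V S \<Longrightarrow> (\<lambda>e x. f e x - g e x) \<in> plc V S"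
  using plc.add[OF _ plc.scale[of g V S "-1"], of f] by simp

lemma plc_sum:
  assumes "finite I" "\<And>i. i \<in> I \<Longrightarrow> f i \<in> plc V S"
  shows "(\<lambda>e x. \<Sum>i\<in>I. f i e x) \<in> plc V S"
  using assms by (induction I) (auto intro: plc.const plc.add)

lemma plc_max: "f \<in> plc V S \<Longrightarrow> g \<in> plc V S \<Longrightarrow> (\<lambda>e x. max (f e x) (g e x)) \<in> plc V S"
proof -
  assume "f \<in> plc V S" "g \<in> plc V S"
  then have "(\<lambda>e x. f e x + relu (g e x - f e x)) \<in> plc V S"
    by (intro plc.add plc.relu plc_diff)
  then show ?thesis by (rule plc.cong) (auto simp: relu_def)
qed

lemma plc_min: "f \<in> plc V S \<Longrightarrow> g \<in> plc V S \<Longrightarrow> (\<lambda>e x. min (f e x) (g e x)) \<in> plc V S"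
proof -
  assume "f \<in> plc V S" "g \<in> plc V S"
  then have "(\<lambda>e x. f e x - relu (f e x - g e x)) \<in> plc V S"
    by (intro plc.relu plc_diff)
  then show ?thesis by (rule plc.cong) (auto simp: relu_def)
qed

lemma plc_conj:
  assumes "(\<lambda>e x. of_bool (P e x)) \<in> plc V S" "(\<lambda>e x. of_bool (Q e x)) \<in> plc V S"
  shows "(\<lambda>e x. of_bool (P e x \<and> Q e x)) \<in> plc V S"
  using plc_min[OF assms] by (rule plc.cong) auto

lemma plc_not:
  assumes "(\<lambda>e x. of_bool (P e x)) \<in> plc V S"
  shows "(\<lambda>e x. of_bool (\<not> P e x)) \<in> plc V S"
  using plc_diff[OF plc.const[of 1] assms] by (rule plc.cong) auto

lemma plc_ball:
  assumes "finite I" "\<And>i. i \<in> I \<Longrightarrow> (\<lambda>e x. of_bool (P i e x)) \<in> plc V S"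
  shows "(\<lambda>e x. of_bool (\<forall>i\<in>I. P i e x)) \<in> plc V S"
  using assms
proof (induction I)
  case empty
  show ?case using plc.const[of 1] by simp
next
  case (insert i I)
  then have "(\<lambda>e x. of_bool (P i e x \<and> (\<forall>i\<in>I. P i e x))) \<in> plc V S" by (intro plc_conj) auto
  then show ?case by simp
qed

lemma plc_bex:
  assumes "finite I" "\<And>i. i \<in> I \<Longrightarrow> (\<lambda>e x. of_bool (P i e x)) \<in> plc V S"
  shows "(\<lambda>e x. of_bool (\<exists>i\<in>I. P i e x)) \<in> plc V S"
proof -
  have "(\<lambda>e x. of_bool (\<not> (\<forall>i\<in>I. \<not> P i e x))) \<in> plc V S"
    by (intro plc_not plc_ball assms)
  then show ?thesis by simp
qed

text \<open>Equality is discontinuous on the reals and thus no ReLU function; but between integers,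
  1 minus the distance, cut off at 0, is its indicator.\<close>

lemma plc_eq_nat:
  assumes "(\<lambda>e x. real (f e x)) \<in> plc V S" "(\<lambda>e x. real (g e x)) \<in> plc V S"
  shows "(\<lambda>e x. of_bool (f e x = g e x)) \<in> plc V S"
proof -
  have "(\<lambda>e x. relu (1 - (relu (real (f e x) - real (g e x)) + relu (real (g e x) - real (f e x))))) \<in> plc V S"
    by (intro plc.relu plc.add plc_diff plc.const assms)
  then show ?thesis by (rule plc.cong) (auto simp: relu_def)
qed

lemma plc_le_nat:
  assumes "(\<lambda>e x. real (f e x)) \<in> plc V S" "(\<lambda>e x. real (g e x)) \<in> plc V S"
  shows "(\<lambda>e x. of_bool (f e x \<le> g e x)) \<in> plc V S"
proof -
  have "(\<lambda>e x. relu (1 - relu (real (f e x) - real (g e x)))) \<in> plc V S"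
    by (intro plc.relu plc.add plc_diff plc.const assms)
  then show ?thesis by (rule plc.cong) (auto simp: relu_def)
qed

section \<open>From closure under rectifier operations to actual MLPs\<close>

definition hidden :: "affine list \<Rightarrow> real list \<Rightarrow> real list" where
  "hidden Ms x = fold (\<lambda>A x. map relu (affine_apply A x)) Ms x"

lemma mlp_apply_snoc: "mlp_apply (Ms @ [A]) x = affine_apply A (hidden Ms x)"
proof (induction Ms arbitrary: x)
  case Nil then show ?case by (simp add: hidden_def)
next
  case (Cons M Ms) then show ?case by (cases "Ms @ [A]") (auto simp: hidden_def)
qed

lemma affine_row:
  assumes "length y = n"
  shows "(\<Sum>(u, v) \<leftarrow> zip (map c [0..<n]) y. u * v) = (\<Sum>i<n. c i * y ! i)"
  using assms by (simp add: sum_list_sum_nth atLeast0LessThan)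

definition affine_over :: "('e \<Rightarrow> 'x \<Rightarrow> bool) \<Rightarrow> nat \<Rightarrow> ('e \<Rightarrow> 'x \<Rightarrow> real list) \<Rightarrow> ('e \<Rightarrow> 'x \<Rightarrow> real) \<Rightarrow> bool" where
  "affine_over V n y f \<longleftrightarrow> (\<exists>c b. \<forall>e x. V e x \<longrightarrow> f e x = (\<Sum>i<n. c i * y e x ! i) + b)"

lemma affine_over_nth:
  assumes "i < n" "\<And>e x. V e x \<Longrightarrow> f e x = y e x ! i"
  shows "affine_over V n y f"
  unfolding affine_over_def
proof (intro exI allI impI)
  fix e x assume "V e x"
  have "(\<Sum>j<n. of_bool (j = i) * y e x ! j) = (\<Sum>j<n. if j = i then y e x ! j else 0)"
    by (intro sum.cong) auto
  then show "f e x = (\<Sum>j<n. of_bool (j = i) * y e x ! j) + 0"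
    using assms \<open>V e x\<close> by (simp add: sum.delta)
qed

lemma affine_over_const: "affine_over V n y (\<lambda>e x. c)"
  unfolding affine_over_def by (intro exI[of _ "\<lambda>_. 0"] exI[of _ c]) auto

lemma affine_over_add:
  assumes "affine_over V n y f" "affine_over V n y g"
  shows "affine_over V n y (\<lambda>e x. f e x + g e x)"
proof -
  obtain c b c' b' where "\<forall>e x. V e x \<longrightarrow> f e x = (\<Sum>i<n. c i * y e x ! i) + b"
    "\<forall>e x. V e x \<longrightarrow> g e x = (\<Sum>i<n. c' i * y e x ! i) + b'"
    using assms unfolding affine_over_def by blast
  then show ?thesis unfolding affine_over_def
    by (intro exI[of _ "\<lambda>i. c i + c' i"] exI[of _ "b + b'"]) (auto simp: algebra_simps sum.distrib)
qed

lemma affine_over_scale: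
  assumes "affine_over V n y f"
  shows "affine_over V n y (\<lambda>e x. a * f e x)"
proof -
  obtain c b where "\<forall>e x. V e x \<longrightarrow> f e x = (\<Sum>i<n. c i * y e x ! i) + b"
    using assms unfolding affine_over_def by blast
  then show ?thesis unfolding affine_over_def
    by (intro exI[of _ "\<lambda>i. a * c i"] exI[of _ "a * b"]) (auto simp: algebra_simps sum_distrib_left)
qed

lemma affine_over_cong:
  "affine_over V n y f \<Longrightarrow> (\<And>e x. V e x \<Longrightarrow> g e x = f e x) \<Longrightarrow> affine_over V n y g"
  unfolding affine_over_def by simp

lemma affine_over_rows:
  assumes "\<And>e x. V e x \<Longrightarrow> length (y e x) = n" "\<forall>f \<in> set fs. affine_over V n y f"
  shows "\<exists>A. length A = length fs \<and> (\<forall>e x. V e x \<longrightarrow> affine_apply A (y e x) = map (\<lambda>f. f e x) fs)"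
  using assms(2)
proof (induction fs)
  case Nil then show ?case by (auto simp: affine_apply_def)
next
  case (Cons f fs)
  then obtain A where A: "length A = length fs" "\<forall>e x. V e x \<longrightarrow> affine_apply A (y e x) = map (\<lambda>f. f e x) fs"
    by auto
  obtain c b where cb: "\<forall>e x. V e x \<longrightarrow> f e x = (\<Sum>i<n. c i * y e x ! i) + b"
    using Cons.prems unfolding affine_over_def by auto
  show ?case
    using A cb affine_row[OF assms(1)]
    by (intro exI[of _ "(map c [0..<n], b) # A"]) (auto simp: affine_apply_def)
qed

text \<open>A whole set of values is kept readable at once: a new ReLU layer destroys what it does
  not carry along, and sums need both operands at the same layer.\<close>

definition expressible ::
  "('e \<Rightarrow> 'x \<Rightarrow> bool) \<Rightarrow> ('e \<Rightarrow> 'x \<Rightarrow> real list) \<Rightarrow> affine list \<Rightarrow> ('e \<Rightarrow> 'x \<Rightarrow> real) set \<Rightarrow> bool" where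
  "expressible V inp Ms F \<longleftrightarrow> (\<exists>n. (\<forall>e x. V e x \<longrightarrow> length (hidden Ms (inp e x)) = n) \<and>
     (\<forall>f \<in> F. affine_over V n (\<lambda>e x. hidden Ms (inp e x)) f))"

lemma expressible_mono: "expressible V inp Ms F \<Longrightarrow> G \<subseteq> F \<Longrightarrow> expressible V inp Ms G"
  unfolding expressible_def by blast

lemma expressible_insert_const: "expressible V inp Ms F \<Longrightarrow> expressible V inp Ms (insert (\<lambda>e x. c) F)"
  unfolding expressible_def using affine_over_const by blast

lemma expressible_insert_add:
  "expressible V inp Ms F \<Longrightarrow> f \<in> F \<Longrightarrow> g \<in> F \<Longrightarrow> expressible V inp Ms (insert (\<lambda>e x. f e x + g e x) F)"
  unfolding expressible_def using affine_over_add by blast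

lemma expressible_insert_scale:
  "expressible V inp Ms F \<Longrightarrow> f \<in> F \<Longrightarrow> expressible V inp Ms (insert (\<lambda>e x. c * f e x) F)"
  unfolding expressible_def using affine_over_scale by blast

lemma expressible_insert_cong:
  "expressible V inp Ms F \<Longrightarrow> f \<in> F \<Longrightarrow> (\<And>e x. V e x \<Longrightarrow> g e x = f e x) \<Longrightarrow>
   expressible V inp Ms (insert g F)"
  unfolding expressible_def using affine_over_cong[of V _ _ f g] by blast

text \<open>Every value \<open>f\<close> survives a further ReLU layer as \<open>relu f - relu (- f)\<close>.\<close>

lemma expressible_insert_relu:
  assumes "finite F" "expressible V inp Ms F" "f \<in> F"
  shows "\<exists>Ms'. expressible V inp Ms' (insert (\<lambda>e x. relu (f e x)) F)"
proof -
  obtain fs where fs: "set fs = F" using assms(1) finite_list by blast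
  obtain n where n: "\<And>e x. V e x \<Longrightarrow> length (hidden Ms (inp e x)) = n"
    and aff: "\<And>f. f \<in> F \<Longrightarrow> affine_over V n (\<lambda>e x. hidden Ms (inp e x)) f"
    using assms(2) unfolding expressible_def by metis
  define gs where "gs = fs @ map (\<lambda>f e x. -1 * f e x) fs"
  have "\<forall>g \<in> set gs. affine_over V n (\<lambda>e x. hidden Ms (inp e x)) g"
    using fs aff affine_over_scale[of V n "\<lambda>e x. hidden Ms (inp e x)" _ "-1"]
    unfolding gs_def by auto
  with n have "\<exists>A. length A = length gs \<and>
      (\<forall>e x. V e x \<longrightarrow> affine_apply A (hidden Ms (inp e x)) = map (\<lambda>f. f e x) gs)"
    by (intro affine_over_rows)
  then obtain A where A: "\<And>e x. V e x \<Longrightarrow> affine_apply A (hidden Ms (inp e x)) = map (\<lambda>f. f e x) gs"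
    by metis
  define y where "y = (\<lambda>e x. hidden (Ms @ [A]) (inp e x))"
  have h: "y e x = map (\<lambda>f. relu (f e x)) gs" if "V e x" for e x
    using A[OF that] by (simp add: hidden_def y_def)
  have coord: "affine_over V (length gs) y (\<lambda>e x. relu (g e x))" if g: "g \<in> set gs" for g
  proof -
    obtain i where i: "i < length gs" "gs ! i = g" using g by (auto simp: in_set_conv_nth)
    show ?thesis by (rule affine_over_nth[OF i(1)]) (simp add: h i)
  qed
  have "affine_over V (length gs) y g" if "g \<in> F" for g
  proof -
    have "g \<in> set gs" "(\<lambda>e x. -1 * g e x) \<in> set gs" using that fs by (auto simp: gs_def)
    then have "affine_over V (length gs) y (\<lambda>e x. relu (g e x) + -1 * relu (-1 * g e x))"
      by (intro affine_over_add affine_over_scale coord[of "\<lambda>e x. -1 * g e x"] coord)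
    then show ?thesis by (rule affine_over_cong) (auto simp: relu_def)
  qed
  moreover have "affine_over V (length gs) y (\<lambda>e x. relu (f e x))"
    using assms(3) fs by (intro coord) (simp add: gs_def)
  ultimately have "expressible V inp (Ms @ [A]) (insert (\<lambda>e x. relu (f e x)) F)"
    unfolding expressible_def y_def[symmetric] using h
    by (intro exI[of _ "length gs"]) (auto simp: y_def)
  then show ?thesis by blast
qed

lemma plc_expressible:
  assumes "f \<in> plc V S" "S \<subseteq> F" "finite F" "expressible V inp Ms F"
  shows "\<exists>Ms'. expressible V inp Ms' (insert f F)"
  using assms
proof (induction arbitrary: F Ms)
  case (base f)
  then show ?case by (metis insert_absorb subsetD)
next
  case (const c)
  show ?case using expressible_insert_const[OF const.prems(3)] by blast
next
  case (add f g)
  obtain Ms1 where "expressible V inp Ms1 (insert f F)" using add.IH(1)[OF add.prems] by blast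
  then obtain Ms2 where "expressible V inp Ms2 (insert g (insert f F))"
    using add.IH(2)[of "insert f F" Ms1] add.prems by blast
  from expressible_insert_add[OF this, of f g] show ?case by (blast intro: expressible_mono)
next
  case (scale f c)
  obtain Ms1 where "expressible V inp Ms1 (insert f F)" using scale.IH[OF scale.prems] by blast
  from expressible_insert_scale[OF this, of f c] show ?case by (blast intro: expressible_mono)
next
  case (relu f)
  obtain Ms1 where "expressible V inp Ms1 (insert f F)" using relu.IH[OF relu.prems] by blast
  with relu.prems obtain Ms2 where "expressible V inp Ms2 (insert (\<lambda>e x. relu (f e x)) (insert f F))"
    using expressible_insert_relu[of "insert f F" V inp Ms1 f] by blast
  then show ?case by (blast intro: expressible_mono)
next
  case (cong f g)
  obtain Ms1 where "expressible V inp Ms1 (insert f F)" using cong.IH[OF cong.prems] by blast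
  from expressible_insert_cong[OF this, of f g] cong.hyps(2) have
    "expressible V inp Ms1 (insert g (insert f F))" by blast
  then show ?case by (blast intro: expressible_mono)
qed

lemma mlp_exists:
  assumes S: "finite S" "\<And>s. s \<in> S \<Longrightarrow> \<exists>i<n. \<forall>e x. V e x \<longrightarrow> s e x = inp e x ! i"
    and n: "\<And>e x. V e x \<Longrightarrow> length (inp e x) = n"
    and fs: "set fs \<subseteq> plc V S"
  shows "\<exists>M. is_mlp M (length fs) \<and> (\<forall>e x. V e x \<longrightarrow> mlp_apply M (inp e x) = map (\<lambda>f. f e x) fs)"
proof -
  have "\<exists>Ms. expressible V inp Ms (set fs \<union> S)"
    using fs
  proof (induction fs)
    case Nil
    have "affine_over V n inp s" if "s \<in> S" for s
      using S(2)[OF that] by (auto intro: affine_over_nth)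
    then have "expressible V inp [] S"
      unfolding expressible_def using n by (intro exI[of _ n]) (simp add: hidden_def)
    then show ?case by auto
  next
    case (Cons f fs)
    then obtain Ms where "expressible V inp Ms (set fs \<union> S)" by auto
    then show ?case using plc_expressible[of f V S "set fs \<union> S" inp Ms] Cons.prems S(1) by simp
  qed
  then obtain Ms n' where
    n': "\<And>e x. V e x \<Longrightarrow> length (hidden Ms (inp e x)) = n'" and
    "\<forall>f \<in> set fs. affine_over V n' (\<lambda>e x. hidden Ms (inp e x)) f"
    unfolding expressible_def by (metis UnI1)
  then obtain A where
    "length A = length fs" "\<forall>e x. V e x \<longrightarrow> affine_apply A (hidden Ms (inp e x)) = map (\<lambda>f. f e x) fs"
    using affine_over_rows[of V "\<lambda>e x. hidden Ms (inp e x)" n' fs] by metis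
  then show ?thesis by (intro exI[of _ "Ms @ [A]"]) (auto simp: is_mlp_def mlp_apply_snoc)
qed

section \<open>Functions computed by layers\<close>

text \<open>Permutations, like sub-tuples in \<open>subtuples_map\<close>, act on positions. So the
  meaning of each entry of a layer's input vector depends on the length of the tuple only, and
  weights shared by all tuples can refer to it.\<close>

lemma arg_perms_map: "arg_perms xs = map (map ((!) xs)) (arg_perms [0..<length xs])"
proof -
  have "map ((!) [0..<length xs]) \<sigma> = \<sigma>" if "\<sigma> \<in> set (List.n_lists (length xs) [0..<length xs])" for \<sigma>
    using that by (auto simp: set_n_lists subset_iff intro: map_idI)
  then show ?thesis
    by (auto simp: arg_perms_def map_concat comp_def intro!: arg_cong[of _ _ concat] map_cong)
qed

lemma set_arg_perms_upt: "set (arg_perms [0..<r]) = {vs. length vs = r \<and> distinct vs \<and> set vs \<subseteq> {..<r}}"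
proof -
  have "map ((!) [0..<r]) \<sigma> = \<sigma>" if "set \<sigma> \<subseteq> {..<r}" for \<sigma>
    using that by (auto simp: subset_iff intro: map_idI)
  then show ?thesis
    by (force simp: arg_perms_def set_n_lists image_iff atLeast0LessThan)
qed

lemma subseqs_map: "subseqs (map f xs) = map (map f) (subseqs xs)"
  by (induction xs) (auto simp: Let_def)

lemma subtuples_map: "subtuples n xs = map (map ((!) xs)) (subtuples n [0..<length xs])"
proof -
  have "subtuples n (map f ys) = map (map f) (subtuples n ys)" for f :: "nat \<Rightarrow> 'a" and ys
    by (auto simp: subtuples_def subseqs_map comp_def map_concat intro!: arg_cong[of _ _ concat] map_cong)
  from this[of "(!) xs" "[0..<length xs]"] show ?thesis by (simp add: map_nth)
qed

lemma set_subtuples: "set (subtuples n xs) = {ys \<in> set (subseqs xs). length ys = n}"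
  by (auto simp: subtuples_def)

lemma subtuple_exists:
  assumes "I \<subseteq> {..<r}" "card I = n"
  shows "\<exists>vs \<in> set (subtuples n [0..<r]). distinct vs \<and> length vs = n \<and> set vs = I"
proof -
  have "I \<in> Pow (set [0..<r])" using assms by (auto simp: atLeast0LessThan)
  then have "I \<in> set ` set (subseqs [0..<r])" by (simp only: subseqs_powset)
  then obtain vs where vs: "vs \<in> set (subseqs [0..<r])" "set vs = I" by auto
  moreover have "distinct vs" using vs(1) subseqs_distinctD by force
  ultimately show ?thesis
    using assms(2) distinct_card[of vs] by (intro bexI[of _ vs]) (auto simp: set_subtuples)
qed

lemma subtuples_subset:
  assumes "vs \<in> set (subtuples n xs)"
  shows "length vs = n" "set vs \<subseteq> set xs"
proof -
  show "length vs = n" using assms by (simp add: set_subtuples)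
  have "set vs \<in> set ` set (subseqs xs)" using assms by (simp add: set_subtuples)
  then show "set vs \<subseteq> set xs" by (simp only: subseqs_powset Pow_iff)
qed

definition mlps :: "nat \<Rightarrow> nat \<Rightarrow> (nat \<Rightarrow> mlp) list \<Rightarrow> bool" where
  "mlps B w Ls \<longleftrightarrow> (\<forall>L \<in> set Ls. \<forall>r\<le>B. \<exists>n\<le>w. is_mlp (L r) n)"

lemma mlps_mono: "mlps B w Ls \<Longrightarrow> w \<le> w' \<Longrightarrow> mlps B w' Ls"
  unfolding mlps_def by (meson order_trans)

lemma mlps_append: "mlps B w (Ls @ Ls') \<longleftrightarrow> mlps B w Ls \<and> mlps B w Ls'"
  by (auto simp: mlps_def)

lemma mlps_replicate: "mlps B w Ls \<Longrightarrow> mlps B w (concat (replicate n Ls))"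
  by (auto simp: mlps_def)

text \<open>Stated for arbitrary sets of functions instead of the finite feature lists of a layer,
  so that depth can be counted before it is settled which features the layers store.\<close>

definition access ::
  "('e \<Rightarrow> 'o set) \<Rightarrow> nat \<Rightarrow> (nat \<Rightarrow> ('e \<Rightarrow> 'o list \<Rightarrow> real) set) \<Rightarrow> nat \<Rightarrow> ('e \<Rightarrow> 'o list \<Rightarrow> real) set" where
  "access uni B C r =
     {\<lambda>e xs. f e (map ((!) xs) vs) | f vs. f \<in> C r \<and> vs \<in> set (arg_perms [0..<r])} \<union>
     {\<lambda>e xs. f e (map ((!) xs) vs) | f vs. 0 < r \<and> f \<in> C (r - 1) \<and> vs \<in> set (subtuples (r - 1) [0..<r])} \<union>
     {\<lambda>e xs. \<Sum>x\<in>uni e. f e (xs @ [x]) | f. r < B \<and> f \<in> C (Suc r)} \<union>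
     {\<lambda>e xs. Max ((\<lambda>x. f e (xs @ [x])) ` uni e) | f. r < B \<and> f \<in> C (Suc r)}"

lemma access_mono: "(\<And>r. C r \<subseteq> C' r) \<Longrightarrow> access uni B C r \<subseteq> access uni B C' r"
  unfolding access_def by blast

lemma access_id:
  "g \<in> C r \<Longrightarrow> (\<lambda>e xs. g e (map ((!) xs) [0..<r])) \<in> access uni B C r"
proof -
  assume "g \<in> C r"
  moreover have "[0..<r] \<in> set (arg_perms [0..<r])" by (auto simp: set_arg_perms_upt)
  ultimately show ?thesis unfolding access_def by blast
qed

lemma access_single:
  assumes "s \<in> access uni B C r"
  shows "\<exists>r' f. f \<in> C r' \<and> s \<in> access uni B (\<lambda>q. if q = r' then {f} else {}) r"
proof -
  consider
    (p) f vs where "s = (\<lambda>e xs. f e (map ((!) xs) vs))" "f \<in> C r" "vs \<in> set (arg_perms [0..<r])"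
  | (t) f vs where "s = (\<lambda>e xs. f e (map ((!) xs) vs))" "0 < r" "f \<in> C (r - 1)" "vs \<in> set (subtuples (r - 1) [0..<r])"
  | (s) f where "s = (\<lambda>e xs. \<Sum>x\<in>uni e. f e (xs @ [x]))" "r < B" "f \<in> C (Suc r)"
  | (m) f where "s = (\<lambda>e xs. Max ((\<lambda>x. f e (xs @ [x])) ` uni e))" "r < B" "f \<in> C (Suc r)"
    using assms unfolding access_def by blast
  then show ?thesis
  proof cases
    case p then show ?thesis by (intro exI[of _ r] exI[of _ f]) (auto simp: access_def)
  next
    case t then show ?thesis
      by (intro exI[of _ "r - 1"] exI[of _ f] conjI) (auto simp: access_def)
  next
    case s then show ?thesis by (intro exI[of _ "Suc r"] exI[of _ f]) (auto simp: access_def)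
  next
    case m then show ?thesis by (intro exI[of _ "Suc r"] exI[of _ f]) (auto simp: access_def)
  qed
qed

lemma access_finite_support:
  assumes "finite S" "S \<subseteq> access uni B C r"
  shows "\<exists>G. (\<forall>r. finite (G r) \<and> G r \<subseteq> C r) \<and> S \<subseteq> access uni B G r"
  using assms
proof (induction S)
  case empty
  then show ?case by (intro exI[of _ "\<lambda>_. {}"]) auto
next
  case (insert s S)
  then obtain G where G: "\<forall>r. finite (G r) \<and> G r \<subseteq> C r" "S \<subseteq> access uni B G r" by auto
  obtain r' f where f: "f \<in> C r'" "s \<in> access uni B (\<lambda>q. if q = r' then {f} else {}) r"
    using access_single insert.prems by blast
  let ?G = "\<lambda>q. G q \<union> (if q = r' then {f} else {})"
  have "S \<subseteq> access uni B ?G r" using G(2) access_mono[of G ?G] by blast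
  moreover have "s \<in> access uni B ?G r"
    using f(2) access_mono[of "\<lambda>q. if q = r' then {f} else {}" ?G] by blast
  ultimately show ?case using G f by (intro exI[of _ ?G]) auto
qed

section \<open>Counting layers over an abstract environment: the raw input or a state of the
  search\<close>

locale relnet =
  fixes uni :: "'e \<Rightarrow> 'o set" and valid :: "'e \<Rightarrow> bool" and B :: nat
  assumes uni_finite: "valid e \<Longrightarrow> finite (uni e)"
    and uni_nonempty: "valid e \<Longrightarrow> uni e \<noteq> {}"
begin

definition tup :: "nat \<Rightarrow> 'e \<Rightarrow> 'o list \<Rightarrow> bool" where
  "tup r e xs \<longleftrightarrow> valid e \<and> length xs = r \<and> set xs \<subseteq> uni e"

text \<open>\<open>cmp inp d r\<close> consists of the functions of \<open>r\<close>-tuples that an MLP can compute from the features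
  that \<open>d\<close> layers have made available; so it takes \<open>Suc d\<close> layers to make one of them a feature.\<close>

primrec basis ::
  "(nat \<Rightarrow> ('e \<Rightarrow> 'o list \<Rightarrow> real) list) \<Rightarrow> nat \<Rightarrow> nat \<Rightarrow> ('e \<Rightarrow> 'o list \<Rightarrow> real) set" where
  "basis inp 0 = (\<lambda>r. set (inp r))"
| "basis inp (Suc d) = access uni B (\<lambda>r. plc (tup r) (basis inp d r))"

abbreviation "cmp inp d r \<equiv> plc (tup r) (basis inp d r)"

lemma cmp_perm:
  assumes "f \<in> cmp inp d r" "distinct vs" "length vs = r" "set vs \<subseteq> {..<r}"
  shows "(\<lambda>e xs. f e (map ((!) xs) vs)) \<in> cmp inp (Suc d) r"
  using assms by (intro plc.base) (auto simp: access_def set_arg_perms_upt)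

lemma cmp_sub:
  assumes "f \<in> cmp inp d r" "vs \<in> set (subtuples r [0..<Suc r])"
  shows "(\<lambda>e xs. f e (map ((!) xs) vs)) \<in> cmp inp (Suc d) (Suc r)"
  using assms by (intro plc.base) (auto simp: access_def simp del: upt_Suc)

lemma cmp_sum:
  assumes "f \<in> cmp inp d (Suc r)" "r < B"
  shows "(\<lambda>e xs. \<Sum>x\<in>uni e. f e (xs @ [x])) \<in> cmp inp (Suc d) r"
  using assms by (intro plc.base) (auto simp: access_def)

lemma cmp_Max:
  assumes "f \<in> cmp inp d (Suc r)" "r < B"
  shows "(\<lambda>e xs. Max ((\<lambda>x. f e (xs @ [x])) ` uni e)) \<in> cmp inp (Suc d) r"
  using assms by (intro plc.base) (auto simp: access_def)

text \<open>The identity is among the argument permutations, so a layer can pass on whatever it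
  sees.\<close>

lemma cmp_Suc:
  assumes "f \<in> cmp inp d r"
  shows "f \<in> cmp inp (Suc d) r"
  using cmp_perm[OF assms, of "[0..<r]"]
  by (rule plc.cong) (auto simp: tup_def map_nth)

lemma cmp_mono: "d \<le> d' \<Longrightarrow> f \<in> cmp inp d r \<Longrightarrow> f \<in> cmp inp d' r"
  by (induction rule: dec_induct) (auto intro: cmp_Suc simp del: basis.simps)

text \<open>Nothing is claimed about tuples longer than the breadth, for which \<open>RelNN\<close>
  does not even ask for an MLP.\<close>

definition represents :: "(nat \<Rightarrow> ('e \<Rightarrow> 'o list \<Rightarrow> real) list) \<Rightarrow> 'e \<Rightarrow> ('o list \<Rightarrow> real list) \<Rightarrow> bool" where
  "represents gs e h \<longleftrightarrow>
     (\<forall>xs. length xs \<le> B \<longrightarrow> set xs \<subseteq> uni e \<longrightarrow> h xs = map (\<lambda>g. g e xs) (gs (length xs)))"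

lemma map_nth_uni: "set xs \<subseteq> U \<Longrightarrow> set vs \<subseteq> {..<length xs} \<Longrightarrow> set (map ((!) xs) vs) \<subseteq> U"
  by (auto simp: subset_iff)

text \<open>\<open>accl\<close> lists what the input vector of a layer means, in the order of
  \<open>layer_apply\<close>. It is determined by \<open>r\<close> and the previous features alone,
  so one MLP serves all tuples of length \<open>r\<close>.\<close>

lemma layer_input:
  fixes gs :: "nat \<Rightarrow> ('e \<Rightarrow> 'o list \<Rightarrow> real) list"
  assumes r: "r \<le> B"
  defines "accl \<equiv>
     concat (map (\<lambda>vs. map (\<lambda>g e xs. g e (map ((!) xs) vs)) (gs r)) (arg_perms [0..<r])) @
     (if r = 0 then [] else
        concat (map (\<lambda>vs. map (\<lambda>g e xs. g e (map ((!) xs) vs)) (gs (r - 1))) (subtuples (r - 1) [0..<r]))) @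
     (if r < B then
        map (\<lambda>g e xs. Max ((\<lambda>x. g e (xs @ [x])) ` uni e)) (gs (Suc r)) @
        map (\<lambda>g e xs. Min ((\<lambda>x. g e (xs @ [x])) ` uni e)) (gs (Suc r)) @
        map (\<lambda>g e xs. \<Sum>x\<in>uni e. g e (xs @ [x])) (gs (Suc r))
      else [])"
  shows "access uni B (\<lambda>r. set (gs r)) r \<subseteq> set accl"
    and "tup r e xs \<Longrightarrow> represents gs e h \<Longrightarrow>
      layer_apply B (uni e) L h xs = mlp_apply (L r) (map (\<lambda>s. s e xs) accl)"
proof -
  show "access uni B (\<lambda>r. set (gs r)) r \<subseteq> set accl"
    unfolding access_def accl_def by auto
next
  assume tup: "tup r e xs" and rep: "represents gs e h"
  then have len: "length xs = r" and U: "set xs \<subseteq> uni e" and fin: "finite (uni e)" "uni e \<noteq> {}"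
    using uni_finite uni_nonempty by (auto simp: tup_def)
  have h: "h (map ((!) xs) vs) = map (\<lambda>g. g e (map ((!) xs) vs)) (gs (length vs))"
    if "length vs \<le> B" "set vs \<subseteq> {..<r}" for vs
    using rep that map_nth_uni[OF U, of vs] unfolding represents_def len by simp
  have 1: "concat (map h (arg_perms xs)) = map (\<lambda>s. s e xs)
     (concat (map (\<lambda>vs. map (\<lambda>g e xs. g e (map ((!) xs) vs)) (gs r)) (arg_perms [0..<r])))"
    unfolding arg_perms_map[of xs] len map_concat map_map
    by (intro arg_cong[of _ _ concat] map_cong refl)
       (use h r in \<open>auto simp: set_arg_perms_upt\<close>)
  have 2: "concat (map h (subtuples (r - 1) xs)) = map (\<lambda>s. s e xs)
     (concat (map (\<lambda>vs. map (\<lambda>g e xs. g e (map ((!) xs) vs)) (gs (r - 1))) (subtuples (r - 1) [0..<r])))"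
    unfolding subtuples_map[of "r - 1" xs] len map_concat map_map
  proof (intro arg_cong[of _ _ concat] map_cong refl)
    fix vs assume "vs \<in> set (subtuples (r - 1) [0..<r])"
    from subtuples_subset[OF this] h[of vs] r
    show "(h \<circ> map ((!) xs)) vs = ((map (\<lambda>s. s e xs)) \<circ> (\<lambda>vs. map (\<lambda>g e xs. g e (map ((!) xs) vs)) (gs (r - 1)))) vs"
      by (auto simp: atLeast0LessThan)
  qed
  have 3: "aggregate (uni e) h xs = map (\<lambda>s. s e xs)
     (map (\<lambda>g e xs. Max ((\<lambda>x. g e (xs @ [x])) ` uni e)) (gs (Suc r)) @
      map (\<lambda>g e xs. Min ((\<lambda>x. g e (xs @ [x])) ` uni e)) (gs (Suc r)) @
      map (\<lambda>g e xs. \<Sum>x\<in>uni e. g e (xs @ [x])) (gs (Suc r)))" if "r < B"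
  proof -
    have hx: "h (xs @ [x]) = map (\<lambda>g. g e (xs @ [x])) (gs (Suc r))" if "x \<in> uni e" for x
      using rep \<open>r < B\<close> that U len unfolding represents_def by simp
    have "Max ((\<lambda>x. length (h (xs @ [x]))) ` uni e) = length (gs (Suc r))"
      using fin by (simp add: hx)
    moreover have "[Q ((\<lambda>x. h (xs @ [x]) ! i) ` uni e). i \<leftarrow> [0..<length (gs (Suc r))]]
        = map (\<lambda>g. Q ((\<lambda>x. g e (xs @ [x])) ` uni e)) (gs (Suc r))" for Q :: "real set \<Rightarrow> real"
      by (intro nth_equalityI) (auto simp: hx intro!: arg_cong[of _ _ Q] image_cong)
    moreover have "[(\<Sum>x\<in>uni e. h (xs @ [x]) ! i). i \<leftarrow> [0..<length (gs (Suc r))]]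
        = map (\<lambda>g. \<Sum>x\<in>uni e. g e (xs @ [x])) (gs (Suc r))"
      by (intro nth_equalityI) (auto simp: hx intro!: sum.cong)
    ultimately show ?thesis by (simp add: aggregate_def comp_def)
  qed
  show "layer_apply B (uni e) L h xs = mlp_apply (L r) (map (\<lambda>s. s e xs) accl)"
    unfolding layer_apply_def accl_def len using 1 2 3 by simp
qed

lemma layer_exists:
  assumes "\<And>r. r \<le> B \<Longrightarrow> set (fs r) \<subseteq> plc (tup r) (access uni B (\<lambda>r. set (gs r)) r)"
  shows "\<exists>L. (\<forall>r\<le>B. is_mlp (L r) (length (fs r))) \<and>
    (\<forall>e h. valid e \<longrightarrow> represents gs e h \<longrightarrow> represents fs e (layer_apply B (uni e) L h))"
proof -
  have "\<exists>M. is_mlp M (length (fs r)) \<and> (\<forall>L e h xs. L r = M \<longrightarrow> tup r e xs \<longrightarrow> represents gs e h \<longrightarrow>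
      layer_apply B (uni e) L h xs = map (\<lambda>f. f e xs) (fs r))" if r: "r \<le> B" for r
  proof -
    obtain accl where accl: "access uni B (\<lambda>r. set (gs r)) r \<subseteq> set accl"
      "\<And>e xs h L. tup r e xs \<Longrightarrow> represents gs e h \<Longrightarrow>
        layer_apply B (uni e) L h xs = mlp_apply (L r) (map (\<lambda>s. s e xs) accl)"
      by (rule that, rule layer_input(1)[OF r], rule layer_input(2)[OF r])
    have "\<exists>M. is_mlp M (length (fs r)) \<and>
        (\<forall>e xs. tup r e xs \<longrightarrow> mlp_apply M (map (\<lambda>s. s e xs) accl) = map (\<lambda>f. f e xs) (fs r))"
    proof (rule mlp_exists[where S = "set accl" and n = "length accl"])
      show "\<exists>i<length accl. \<forall>e x. tup r e x \<longrightarrow> s e x = map (\<lambda>s. s e x) accl ! i" if "s \<in> set accl" for s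
        using that by (metis in_set_conv_nth nth_map)
      show "set (fs r) \<subseteq> plc (tup r) (set accl)"
        using plc_subset[OF subsetD[OF assms[OF r]] accl(1)] by blast
    qed auto
    then show ?thesis using accl(2) by auto
  qed
  then obtain L where "\<forall>r\<le>B. is_mlp (L r) (length (fs r)) \<and> (\<forall>L' e h xs. L' r = L r \<longrightarrow> tup r e xs \<longrightarrow> represents gs e h \<longrightarrow>
      layer_apply B (uni e) L' h xs = map (\<lambda>f. f e xs) (fs r))" by metis
  then show ?thesis
    by (intro exI[of _ L]) (auto simp: represents_def[of fs] tup_def)
qed

lemma plc_access_support:
  assumes "F \<subseteq> plc V (access uni B C r)" "finite F"
  shows "\<exists>G. (\<forall>r. finite (G r) \<and> G r \<subseteq> C r) \<and> F \<subseteq> plc V (access uni B G r)"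
  using assms(2,1)
proof (induction F)
  case empty
  then show ?case by (intro exI[of _ "\<lambda>_. {}"]) auto
next
  case (insert f F)
  then obtain G where G: "\<forall>r. finite (G r) \<and> G r \<subseteq> C r" "F \<subseteq> plc V (access uni B G r)" by auto
  obtain S where S: "finite S" "S \<subseteq> access uni B C r" "f \<in> plc V S"
    using plc_finite_support[of f V "access uni B C r"] insert.prems by auto
  then obtain G' where G': "\<forall>r. finite (G' r) \<and> G' r \<subseteq> C r" "S \<subseteq> access uni B G' r"
    using access_finite_support[OF S(1,2)] by auto
  let ?G = "\<lambda>r. G r \<union> G' r"
  have acc: "access uni B G r \<subseteq> access uni B ?G r" "access uni B G' r \<subseteq> access uni B ?G r"
    using access_mono[of G ?G] access_mono[of G' ?G] by blast+
  have "f \<in> plc V (access uni B ?G r)"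
    using S(3) G'(2) acc(2) by (blast intro: plc_subset)
  moreover have "g \<in> plc V (access uni B ?G r)" if "g \<in> F" for g
    using plc_subset[OF subsetD[OF G(2) that] acc(1)] .
  ultimately show ?case using G(1) G'(1) by (intro exI[of _ ?G]) auto
qed

text \<open>The features are chosen from the top down: the outputs rest on finitely many functions
  of the depth below, and these, collected over all lengths up to \<open>B\<close>, are the feature
  lists the layer before has to produce. The width comes out finite without being computed.\<close>

lemma block_exists:
  assumes "\<And>r. r \<le> B \<Longrightarrow> set (fs r) \<subseteq> cmp inp d r"
  shows "\<exists>Ls w. length Ls = Suc d \<and> mlps B w Ls \<and>
    (\<forall>e h. valid e \<longrightarrow> represents inp e h \<longrightarrow> represents fs e (fold (layer_apply B (uni e)) Ls h))"
  using assms
proof (induction d arbitrary: fs)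
  case 0
  have "set (fs r) \<subseteq> plc (tup r) (access uni B (\<lambda>r. set (inp r)) r)" if "r \<le> B" for r
  proof
    fix f assume "f \<in> set (fs r)"
    then have "f \<in> cmp inp 0 r" using 0 that by blast
    then show "f \<in> plc (tup r) (access uni B (\<lambda>r. set (inp r)) r)"
    proof (rule plc_mono, intro subsetI)
      fix g assume "g \<in> basis inp 0 r"
      then have "(\<lambda>e xs. g e (map ((!) xs) [0..<r])) \<in> plc (tup r) (access uni B (\<lambda>r. set (inp r)) r)"
        by (intro plc.base access_id) simp
      then show "g \<in> plc (tup r) (access uni B (\<lambda>r. set (inp r)) r)"
        by (rule plc.cong) (auto simp: tup_def map_nth)
    qed
  qed
  from layer_exists[OF this] obtain L where L: "\<forall>r\<le>B. is_mlp (L r) (length (fs r))"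
    "\<forall>e h. valid e \<longrightarrow> represents inp e h \<longrightarrow> represents fs e (layer_apply B (uni e) L h)" by blast
  have "mlps B (Max ((\<lambda>r. length (fs r)) ` {..B})) [L]"
    using L(1) unfolding mlps_def by (auto intro!: exI[of _ "length (fs _)"] Max_ge)
  with L(2) show ?case by (intro exI[of _ "[L]"]) auto
next
  case (Suc d)
  have "\<forall>r. \<exists>G. r \<le> B \<longrightarrow> (\<forall>q. finite (G q) \<and> G q \<subseteq> cmp inp d q) \<and> set (fs r) \<subseteq> plc (tup r) (access uni B G r)"
    using plc_access_support[OF Suc.prems[unfolded basis.simps]] by (meson List.finite_set)
  then obtain G where G: "\<And>r q. r \<le> B \<Longrightarrow> finite (G r q) \<and> G r q \<subseteq> cmp inp d q"
    "\<And>r. r \<le> B \<Longrightarrow> set (fs r) \<subseteq> plc (tup r) (access uni B (G r) r)" by metis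
  define H where "H q = (\<Union>r\<le>B. G r q)" for q
  have "\<forall>q. \<exists>l. set l = H q" using G(1) unfolding H_def by (intro allI finite_list) auto
  then obtain gs where gs: "\<And>q. set (gs q) = H q" by metis
  have "set (gs q) \<subseteq> cmp inp d q" for q using G(1) by (auto simp: gs H_def)
  from Suc.IH[OF this] obtain Ls w where Ls: "length Ls = Suc d" "mlps B w Ls"
    "\<And>e h. valid e \<Longrightarrow> represents inp e h \<Longrightarrow> represents gs e (fold (layer_apply B (uni e)) Ls h)" by blast
  have "set (fs r) \<subseteq> plc (tup r) (access uni B (\<lambda>r. set (gs r)) r)" if r: "r \<le> B" for r
  proof
    fix f assume "f \<in> set (fs r)"
    with G(2)[OF r] have "f \<in> plc (tup r) (access uni B (G r) r)" by blast
    then show "f \<in> plc (tup r) (access uni B (\<lambda>r. set (gs r)) r)"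
      by (rule plc_subset) (use r in \<open>auto simp: gs H_def intro!: access_mono\<close>)
  qed
  from layer_exists[OF this] obtain L where L: "\<forall>r\<le>B. is_mlp (L r) (length (fs r))"
    "\<forall>e h. valid e \<longrightarrow> represents gs e h \<longrightarrow> represents fs e (layer_apply B (uni e) L h)" by blast
  let ?w = "Max ((\<lambda>r. length (fs r)) ` {..B})"
  have "mlps B ?w [L]"
    using L(1) unfolding mlps_def by (auto intro!: exI[of _ "length (fs _)"] Max_ge)
  then have "mlps B (max w ?w) (Ls @ [L])"
    using Ls(2) unfolding mlps_append by (meson mlps_mono max.cobounded1 max.cobounded2)
  then show ?case using Ls L(2)
    by (intro exI[of _ "Ls @ [L]"] exI[of _ "max w ?w"]) auto
qed

text \<open>If the features of \<open>R e\<close> are computable from those of \<open>e\<close>, the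
  block that does so can be followed by itself. The layers of one round and their width are
  therefore chosen before the number \<open>n\<close> of rounds.\<close>

lemma round_exists:
  fixes inp :: "nat \<Rightarrow> ('e \<Rightarrow> 'o list \<Rightarrow> real) list"
  assumes step: "\<And>r f. r \<le> B \<Longrightarrow> f \<in> set (inp r) \<Longrightarrow> (\<lambda>e. f (R e)) \<in> cmp inp d r"
    and R: "\<And>e. valid e \<Longrightarrow> valid (R e)" "\<And>e. valid e \<Longrightarrow> uni (R e) = uni e"
  shows "\<exists>Ls w. length Ls = Suc d \<and> mlps B w Ls \<and>
    (\<forall>e h n. valid e \<longrightarrow> represents inp e h \<longrightarrow>
       represents inp ((R ^^ n) e) (fold (layer_apply B (uni e)) (concat (replicate n Ls)) h))"
proof -
  let ?fs = "\<lambda>r. map (\<lambda>f e. f (R e)) (inp r)"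
  have "set (?fs r) \<subseteq> cmp inp d r" if "r \<le> B" for r using step[OF that] by auto
  from block_exists[OF this] obtain Ls w where Ls: "length Ls = Suc d" "mlps B w Ls"
    "\<And>e h. valid e \<Longrightarrow> represents inp e h \<Longrightarrow> represents ?fs e (fold (layer_apply B (uni e)) Ls h)" by blast
  have one: "represents inp (R e) (fold (layer_apply B (uni e)) Ls h)"
    if "valid e" "represents inp e h" for e h
    using Ls(3)[OF that] R(2)[OF that(1)] by (auto simp: represents_def)
  have "represents inp ((R ^^ n) e) (fold (layer_apply B (uni e)) (concat (replicate n Ls)) h)"
    if "valid e" "represents inp e h" for e h n
    using that
  proof (induction n arbitrary: e h)
    case 0 then show ?case by simp
  next
    case (Suc n)
    from Suc.IH[OF R(1)[OF Suc.prems(1)] one[OF Suc.prems]] show ?case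
      using R(2)[OF Suc.prems(1)] by (simp add: funpow_swap1)
  qed
  with Ls(1,2) show ?thesis by blast
qed

definition readout_access :: "(nat \<Rightarrow> ('e \<Rightarrow> 'o list \<Rightarrow> real) set) \<Rightarrow> nat \<Rightarrow> ('e \<Rightarrow> 'o list \<Rightarrow> real) set" where
  "readout_access C l =
     {\<lambda>e xs. of_bool (xs ! i = xs ! j) | i j. i < l \<and> j < i} \<union>
     {\<lambda>e xs. f e (map ((!) xs) vs) | f vs. f \<in> C (min l B) \<and> vs \<in> set (subtuples (min l B) [0..<l])}"

lemma readout_exists:
  fixes gs :: "nat \<Rightarrow> ('e \<Rightarrow> 'o list \<Rightarrow> real) list"
  assumes "f \<in> plc (tup l) (readout_access (\<lambda>r. set (gs r)) l)"
  shows "\<exists>M. is_mlp M 1 \<and> (\<forall>e h xs. tup l e xs \<longrightarrow> represents gs e h \<longrightarrow>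
    hd (mlp_apply M (eq_features xs @ concat (map h (subtuples (min l B) xs)))) = f e xs)"
proof -
  define accl where "accl = [(\<lambda>(e::'e) xs::'o list. of_bool (xs ! i = xs ! j) :: real). i \<leftarrow> [0..<l], j \<leftarrow> [0..<i]] @
    concat (map (\<lambda>vs. map (\<lambda>g e xs. g e (map ((!) xs) vs)) (gs (min l B))) (subtuples (min l B) [0..<l]))"
  have acc: "readout_access (\<lambda>r. set (gs r)) l \<subseteq> set accl"
    unfolding readout_access_def accl_def by force
  have inp: "eq_features xs @ concat (map h (subtuples (min l B) xs)) = map (\<lambda>s. s e xs) accl"
    if tup: "tup l e xs" and rep: "represents gs e h" for e h xs
  proof -
    have len: "length xs = l" and U: "set xs \<subseteq> uni e" using tup by (auto simp: tup_def)
    have "concat (map h (subtuples (min l B) xs)) = map (\<lambda>s. s e xs)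
       (concat (map (\<lambda>vs. map (\<lambda>g e xs. g e (map ((!) xs) vs)) (gs (min l B))) (subtuples (min l B) [0..<l])))"
      unfolding subtuples_map[of "min l B" xs] len map_concat map_map
    proof (intro arg_cong[of _ _ concat] map_cong refl)
      fix vs assume "vs \<in> set (subtuples (min l B) [0..<l])"
      from subtuples_subset[OF this] map_nth_uni[OF U, of vs] rep
      show "(h \<circ> map ((!) xs)) vs = ((map (\<lambda>s. s e xs)) \<circ> (\<lambda>vs. map (\<lambda>g e xs. g e (map ((!) xs) vs)) (gs (min l B)))) vs"
        unfolding represents_def by (auto simp: atLeast0LessThan len)
    qed
    moreover have "eq_features xs = map (\<lambda>s. s e xs) [(\<lambda>(e::'e) xs::'o list. of_bool (xs ! i = xs ! j) :: real). i \<leftarrow> [0..<l], j \<leftarrow> [0..<i]]"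
      by (simp add: eq_features_def len map_concat comp_def)
    ultimately show ?thesis by (simp add: accl_def)
  qed
  have "\<exists>M. is_mlp M (length [f]) \<and>
      (\<forall>e xs. tup l e xs \<longrightarrow> mlp_apply M (map (\<lambda>s. s e xs) accl) = map (\<lambda>f. f e xs) [f])"
  proof (rule mlp_exists[where S = "set accl" and n = "length accl"])
    show "\<exists>i<length accl. \<forall>e x. tup l e x \<longrightarrow> s e x = map (\<lambda>s. s e x) accl ! i" if "s \<in> set accl" for s
      using that by (metis in_set_conv_nth nth_map)
    show "set [f] \<subseteq> plc (tup l) (set accl)"
      using plc_subset[OF assms acc] by simp
  qed auto
  then show ?thesis using inp by auto
qed

lemma readout_access_mono: "(\<And>r. C r \<subseteq> C' r) \<Longrightarrow> readout_access C l \<subseteq> readout_access C' l"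
  unfolding readout_access_def by blast

lemma plc_readout_access_support:
  assumes "f \<in> plc V (readout_access C l)"
  shows "\<exists>G. (\<forall>r. finite (G r) \<and> G r \<subseteq> C r) \<and> f \<in> plc V (readout_access G l)"
proof -
  obtain S where S: "finite S" "S \<subseteq> readout_access C l" "f \<in> plc V S"
    using plc_finite_support[OF assms] by blast
  from S(1,2) have "\<exists>G. (\<forall>r. finite (G r) \<and> G r \<subseteq> C r) \<and> S \<subseteq> readout_access G l"
  proof (induction S)
    case empty
    then show ?case by (intro exI[of _ "\<lambda>_. {}"]) auto
  next
    case (insert s S)
    then obtain G where G: "\<forall>r. finite (G r) \<and> G r \<subseteq> C r" "S \<subseteq> readout_access G l" by auto
    have "\<exists>g. (\<forall>r. finite (g r) \<and> g r \<subseteq> C r) \<and> s \<in> readout_access g l"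
    proof -
      consider i j where "s = (\<lambda>e xs. of_bool (xs ! i = xs ! j))" "i < l" "j < i"
        | f vs where "s = (\<lambda>e xs. f e (map ((!) xs) vs))" "f \<in> C (min l B)" "vs \<in> set (subtuples (min l B) [0..<l])"
        using insert.prems unfolding readout_access_def by blast
      then show ?thesis
      proof cases
        case 1 then show ?thesis by (intro exI[of _ "\<lambda>_. {}"]) (auto simp: readout_access_def)
      next
        case 2 then show ?thesis
          by (intro exI[of _ "\<lambda>q. if q = min l B then {f} else {}"]) (auto simp: readout_access_def)
      qed
    qed
    then obtain g where g: "\<forall>r. finite (g r) \<and> g r \<subseteq> C r" "s \<in> readout_access g l" by blast
    let ?G = "\<lambda>q. G q \<union> g q"
    have "readout_access G l \<subseteq> readout_access ?G l" "readout_access g l \<subseteq> readout_access ?G l"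
      by (intro readout_access_mono; blast)+
    then show ?case using G g by (intro exI[of _ ?G]) auto
  qed
  then obtain G where G: "\<forall>r. finite (G r) \<and> G r \<subseteq> C r" "S \<subseteq> readout_access G l" by blast
  have "f \<in> plc V (readout_access G l)" using S(3) by (rule plc_subset) (use G in blast)
  with G show ?thesis by blast
qed

lemma policy_block_exists:
  fixes as :: "'a list" and ar :: "'a \<Rightarrow> nat"
  assumes "\<And>a. a \<in> set as \<Longrightarrow> sc a \<in> plc (tup (ar a)) (readout_access (cmp inp d) (ar a))"
  shows "\<exists>Ls w M. length Ls = Suc d \<and> mlps B w Ls \<and> (\<forall>a. is_mlp (M a) 1) \<and>
    (\<forall>a \<in> set as. \<forall>e h xs. tup (ar a) e xs \<longrightarrow> represents inp e h \<longrightarrow>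
      hd (mlp_apply (M a) (eq_features xs @
        concat (map (fold (layer_apply B (uni e)) Ls h) (subtuples (min (ar a) B) xs)))) = sc a e xs)"
proof -
  have "\<forall>a. \<exists>G. a \<in> set as \<longrightarrow> (\<forall>q. finite (G q) \<and> G q \<subseteq> cmp inp d q) \<and> sc a \<in> plc (tup (ar a)) (readout_access G (ar a))"
    using plc_readout_access_support[OF assms] by blast
  then obtain G where G: "\<And>a q. a \<in> set as \<Longrightarrow> finite (G a q) \<and> G a q \<subseteq> cmp inp d q"
    "\<And>a. a \<in> set as \<Longrightarrow> sc a \<in> plc (tup (ar a)) (readout_access (G a) (ar a))" by metis
  define H where "H q = (\<Union>a\<in>set as. G a q)" for q
  have "\<forall>q. \<exists>l. set l = H q" using G(1) unfolding H_def by (intro allI finite_list) auto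
  then obtain gs where gs: "\<And>q. set (gs q) = H q" by metis
  have "set (gs q) \<subseteq> cmp inp d q" for q using G(1) by (auto simp: gs H_def)
  from block_exists[OF this] obtain Ls w where Ls: "length Ls = Suc d" "mlps B w Ls"
    "\<And>e h. valid e \<Longrightarrow> represents inp e h \<Longrightarrow> represents gs e (fold (layer_apply B (uni e)) Ls h)" by blast
  have "\<exists>M. is_mlp M 1 \<and> (a \<in> set as \<longrightarrow> (\<forall>e h xs. tup (ar a) e xs \<longrightarrow> represents gs e h \<longrightarrow>
    hd (mlp_apply M (eq_features xs @ concat (map h (subtuples (min (ar a) B) xs)))) = sc a e xs))" for a
  proof (cases "a \<in> set as")
    case True
    have "sc a \<in> plc (tup (ar a)) (readout_access (\<lambda>r. set (gs r)) (ar a))"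
      using G(2)[OF True] by (rule plc_subset) (use True in \<open>auto simp: gs H_def intro!: readout_access_mono\<close>)
    from readout_exists[OF this] show ?thesis by blast
  next
    case False
    \<comment> \<open>Outside the schemas any MLP with one output row will do; \<open>RelNN\<close>
      asks for one at every element of the type.\<close>
    then show ?thesis by (intro exI[of _ "[[([], 0)]]"]) (auto simp: is_mlp_def)
  qed
  then obtain M where M: "\<And>a. is_mlp (M a) 1" "\<And>a e h xs. a \<in> set as \<Longrightarrow> tup (ar a) e xs \<Longrightarrow> represents gs e h \<Longrightarrow>
    hd (mlp_apply (M a) (eq_features xs @ concat (map h (subtuples (min (ar a) B) xs)))) = sc a e xs" by metis
  have "hd (mlp_apply (M a) (eq_features xs @
        concat (map (fold (layer_apply B (uni e)) Ls h) (subtuples (min (ar a) B) xs)))) = sc a e xs"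
    if "a \<in> set as" "tup (ar a) e xs" "represents inp e h" for a e h xs
    using M(2)[OF that(1,2) Ls(3)[OF _ that(3)]] that(2) by (simp add: tup_def)
  with Ls(1,2) M(1) show ?thesis by blast
qed

end

section \<open>Sums over tuples avoiding given objects\<close>

lemma factor_through_nth:
  assumes "set cs \<subseteq> set vs"
  shows "\<exists>ps. map ((!) vs) ps = cs \<and> set ps \<subseteq> {..<length vs}"
  using assms
proof (induction cs)
  case Nil then show ?case by simp
next
  case (Cons c cs)
  then obtain ps where ps: "map ((!) vs) ps = cs" "set ps \<subseteq> {..<length vs}" by auto
  from Cons.prems obtain i where "i < length vs" "vs ! i = c" by (auto simp: in_set_conv_nth)
  with ps show ?case by (intro exI[of _ "i # ps"]) auto
qed

lemma map_nth_map: "set ps \<subseteq> {..<length vs} \<Longrightarrow> map ((!) (map f vs)) ps = map f (map ((!) vs) ps)"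
  by (auto simp: subset_iff)

definition tuples :: "'o set \<Rightarrow> nat \<Rightarrow> 'o list set" where
  "tuples U m = {ys. length ys = m \<and> set ys \<subseteq> U}"

lemma finite_tuples: "finite U \<Longrightarrow> finite (tuples U m)"
  unfolding tuples_def using finite_lists_length_eq[of U m] by (simp add: conj_commute)

lemma sum_tuples_Suc:
  "(\<Sum>ys\<in>tuples U (Suc m). f ys) = (\<Sum>ys\<in>tuples U m. \<Sum>x\<in>U. f (ys @ [x]))"
proof -
  have "(\<Sum>ys\<in>tuples U m. \<Sum>x\<in>U. f (ys @ [x])) = (\<Sum>(ys, x)\<in>tuples U m \<times> U. f (ys @ [x]))"
    by (rule sum.cartesian_product)
  also have "\<dots> = (\<Sum>ys\<in>tuples U (Suc m). f ys)"
  proof (rule sum.reindex_bij_witness[of _ "\<lambda>ys. (butlast ys, last ys)" "\<lambda>(ys, x). ys @ [x]"])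
    fix ys assume "ys \<in> tuples U (Suc m)"
    then have "ys \<noteq> []" and ys: "length ys = Suc m" "set ys \<subseteq> U" by (auto simp: tuples_def)
    then show "(case (butlast ys, last ys) of (ys, x) \<Rightarrow> ys @ [x]) = ys" by simp
    show "(butlast ys, last ys) \<in> tuples U m \<times> U"
      using ys \<open>ys \<noteq> []\<close> last_in_set[of ys] by (auto simp: tuples_def dest: in_set_butlastD)
  qed (auto simp: tuples_def)
  finally show ?thesis by simp
qed

text \<open>A tuple of distinct objects either avoids \<open>z\<close> or has it at exactly one
  position \<open>i\<close>. Deleting that entry is a bijection onto the shorter tuples that avoid
  \<open>z\<close>. For \<open>m = 0\<close> the subtracted sum is empty.\<close>

lemma sum_tuples_split:
  fixes F :: "'o list \<Rightarrow> real"
  assumes U: "finite U" "z \<in> U" and X: "z \<notin> X"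
  shows "(\<Sum>ys\<in>tuples U m. of_bool (distinct ys \<and> set ys \<inter> insert z X = {}) * F ys) =
    (\<Sum>ys\<in>tuples U m. of_bool (distinct ys \<and> set ys \<inter> X = {}) * F ys) -
    (\<Sum>i<m. \<Sum>ys\<in>tuples U (m - 1).
       of_bool (distinct ys \<and> set ys \<inter> insert z X = {}) * F (take i ys @ z # drop i ys))"
proof -
  define P where "P ys \<longleftrightarrow> distinct ys \<and> set ys \<inter> X = {}" for ys
  have pos: "of_bool (P ys) = of_bool (P ys \<and> z \<notin> set ys) + (\<Sum>i<m. of_bool (P ys \<and> ys ! i = z) :: real)"
    if "ys \<in> tuples U m" for ys
  proof (cases "P ys \<and> z \<in> set ys")
    case False
    with that have "(\<Sum>i<m. of_bool (P ys \<and> ys ! i = z) :: real) = (\<Sum>i<m. 0)"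
      by (intro sum.cong refl) (auto simp: tuples_def)
    with False show ?thesis by auto
  next
    case True
    moreover have len: "length ys = m" using that by (simp add: tuples_def)
    ultimately obtain j where j: "j < m" "ys ! j = z" unfolding in_set_conv_nth by blast
    have "(\<Sum>i<m. of_bool (P ys \<and> ys ! i = z)) = (\<Sum>i<m. if i = j then 1 else 0 :: real)"
      using True j len by (intro sum.cong refl) (auto simp: P_def nth_eq_iff_index_eq)
    with True j show ?thesis by simp
  qed
  have P_insert: "P (us @ z # vs) \<longleftrightarrow> P (us @ vs) \<and> z \<notin> set (us @ vs)" for us vs
    using X by (auto simp: P_def)
  have ins: "(\<Sum>ys\<in>tuples U m. of_bool (P ys \<and> ys ! i = z) * F ys) =
      (\<Sum>ys\<in>tuples U (m - 1). of_bool (P ys \<and> z \<notin> set ys) * F (take i ys @ z # drop i ys))"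
    if i: "i < m" for i
  proof -
    have "(\<Sum>ys\<in>tuples U m. of_bool (P ys \<and> ys ! i = z) * F ys) = (\<Sum>ys\<in>{ys \<in> tuples U m. ys ! i = z}. of_bool (P ys) * F ys)"
      using finite_tuples[OF U(1)] by (intro sum.mono_neutral_cong_right) auto
    also have "\<dots> = (\<Sum>ys\<in>tuples U (m - 1). of_bool (P ys \<and> z \<notin> set ys) * F (take i ys @ z # drop i ys))"
    proof (rule sum.reindex_bij_witness[of _ "\<lambda>ys. take i ys @ z # drop i ys" "\<lambda>ys. take i ys @ drop (Suc i) ys"])
      fix ys assume "ys \<in> {ys \<in> tuples U m. ys ! i = z}"
      then have ys: "length ys = m" "set ys \<subseteq> U" "ys ! i = z" by (auto simp: tuples_def)
      then show bk: "take i (take i ys @ drop (Suc i) ys) @ z # drop i (take i ys @ drop (Suc i) ys) = ys"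
        using i id_take_nth_drop[of i ys] by simp
      show "take i ys @ drop (Suc i) ys \<in> tuples U (m - 1)"
        using ys i set_take_subset[of i ys] set_drop_subset[of "Suc i" ys] by (auto simp: tuples_def)
      define ws where "ws = take i ys @ drop (Suc i) ys"
      have "P ys \<longleftrightarrow> P (take i ws @ z # drop i ws)" using bk by (simp add: ws_def)
      also have "\<dots> \<longleftrightarrow> P ws \<and> z \<notin> set ws"
        using P_insert[of "take i ws" "drop i ws"] by simp
      finally show "of_bool (P (take i ys @ drop (Suc i) ys) \<and> z \<notin> set (take i ys @ drop (Suc i) ys)) *
          F (take i (take i ys @ drop (Suc i) ys) @ z # drop i (take i ys @ drop (Suc i) ys)) = of_bool (P ys) * F ys"
        by (simp only: ws_def bk)
    next
      fix ys assume ys: "ys \<in> tuples U (m - 1)"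
      then show "take i (take i ys @ z # drop i ys) @ drop (Suc i) (take i ys @ z # drop i ys) = ys"
        using i by (simp add: tuples_def min_def)
      show "take i ys @ z # drop i ys \<in> {ys \<in> tuples U m. ys ! i = z}"
        using ys i U set_take_subset[of i ys] set_drop_subset[of i ys]
        by (auto simp: tuples_def nth_append min_def)
    qed
    finally show ?thesis .
  qed
  have "(\<Sum>ys\<in>tuples U m. of_bool (P ys) * F ys) =
      (\<Sum>ys\<in>tuples U m. of_bool (P ys \<and> z \<notin> set ys) * F ys + (\<Sum>i<m. of_bool (P ys \<and> ys ! i = z) * F ys))"
    by (intro sum.cong refl) (simp only: pos distrib_right sum_distrib_right)
  also have "\<dots> = (\<Sum>ys\<in>tuples U m. of_bool (P ys \<and> z \<notin> set ys) * F ys) +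
      (\<Sum>i<m. \<Sum>ys\<in>tuples U m. of_bool (P ys \<and> ys ! i = z) * F ys)"
    by (simp add: sum.distrib sum.swap[of _ "tuples U m"])
  also have "(\<Sum>i<m. \<Sum>ys\<in>tuples U m. of_bool (P ys \<and> ys ! i = z) * F ys) =
      (\<Sum>i<m. \<Sum>ys\<in>tuples U (m - 1). of_bool (P ys \<and> z \<notin> set ys) * F (take i ys @ z # drop i ys))"
    by (intro sum.cong refl ins) simp
  finally have "(\<Sum>ys\<in>tuples U m. of_bool (P ys) * F ys) =
      (\<Sum>ys\<in>tuples U m. of_bool (P ys \<and> z \<notin> set ys) * F ys) +
      (\<Sum>i<m. \<Sum>ys\<in>tuples U (m - 1). of_bool (P ys \<and> z \<notin> set ys) * F (take i ys @ z # drop i ys))" .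
  moreover have "distinct ys \<and> set ys \<inter> insert z X = {} \<longleftrightarrow> P ys \<and> z \<notin> set ys" for ys
    by (auto simp: P_def)
  ultimately show ?thesis unfolding P_def[symmetric] by simp
qed

context relnet
begin

text \<open>A layer sees only the sub-tuples that are shorter by one, so each position not in
  \<open>cs\<close> costs one layer; the additional layer brings the remaining positions into the
  order of \<open>cs\<close>.\<close>

lemma cmp_reindex:
  assumes "f \<in> cmp inp d q" "distinct cs" "length cs = q" "set cs \<subseteq> {..<r}" "d + (r - q) + 1 \<le> d'"
  shows "(\<lambda>e xs. f e (map ((!) xs) cs)) \<in> cmp inp d' r"
proof -
  have "q \<le> r" using assms(2,3,4) by (metis card_lessThan card_mono distinct_card finite_lessThan)
  from this assms(2-4) have "(\<lambda>e xs. f e (map ((!) xs) cs)) \<in> cmp inp (d + (r - q) + 1) r"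
  proof (induction r arbitrary: cs rule: dec_induct)
    case base
    then show ?case using cmp_perm[OF assms(1), of cs] by simp
  next
    case (step r)
    have "card (set cs) < card {..<Suc r}" using step.prems step.hyps by (simp add: distinct_card)
    then have "\<not> {..<Suc r} \<subseteq> set cs" by (metis List.finite_set card_mono leD)
    then obtain i where i: "i < Suc r" "i \<notin> set cs" by auto
    obtain vs where vs: "vs \<in> set (subtuples r [0..<Suc r])" "length vs = r" "set vs = {..<Suc r} - {i}"
      using subtuple_exists[of "{..<Suc r} - {i}" "Suc r" r] i by auto
    obtain ps where ps: "map ((!) vs) ps = cs" "set ps \<subseteq> {..<length vs}"
      using factor_through_nth[of cs vs] vs step.prems i by auto
    have "distinct ps" using ps(1) step.prems(1) by (metis distinct_map)
    moreover have "length ps = q" using ps(1) step.prems(2) by (metis length_map)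
    ultimately have "(\<lambda>e xs. f e (map ((!) xs) ps)) \<in> cmp inp (d + (r - q) + 1) r"
      using step.IH ps(2) vs(2) by blast
    from cmp_sub[OF this vs(1)] have "(\<lambda>e xs. f e (map ((!) (map ((!) xs) vs)) ps)) \<in> cmp inp (Suc (d + (r - q) + 1)) (Suc r)" .
    moreover have "Suc (d + (r - q) + 1) = d + (Suc r - q) + 1" using step.hyps by simp
    ultimately show ?case by (simp only: map_nth_map[OF ps(2)] ps(1))
  qed
  then show ?thesis using assms(5) by (rule cmp_mono[rotated])
qed

text \<open>The readout sees sub-tuples of the one size \<open>min l B\<close> only. So
  \<open>cs\<close> is first enlarged to a set of that many positions, and the surplus ones are
  dropped inside the network.\<close>

lemma readout_access_reindex:
  assumes "f \<in> cmp inp d (length cs)" "distinct cs" "set cs \<subseteq> {..<l}" "length cs \<le> B" "d + l + 1 \<le> d'"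
  shows "(\<lambda>e xs. f e (map ((!) xs) cs)) \<in> plc (tup l) (readout_access (cmp inp d') l)"
proof -
  have "length cs \<le> l" using assms(2,3) by (metis card_lessThan card_mono distinct_card finite_lessThan)
  then obtain I where I: "set cs \<subseteq> I" "I \<subseteq> {..<l}" "card I = min l B"
    using exists_subset_between[of "set cs" "min l B" "{..<l}"] assms by (auto simp: distinct_card)
  then obtain vs where vs: "vs \<in> set (subtuples (min l B) [0..<l])" "length vs = min l B" "set vs = I"
    using subtuple_exists by metis
  obtain ps where ps: "map ((!) vs) ps = cs" "set ps \<subseteq> {..<length vs}"
    using factor_through_nth[of cs vs] vs I by auto
  have "distinct ps" using ps(1) assms(2) by (metis distinct_map)
  then have "(\<lambda>e xs. f e (map ((!) xs) ps)) \<in> cmp inp d' (min l B)"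
    using ps vs(2) assms(1,5) by (intro cmp_reindex[where q = "length cs" and d = d]) auto
  then have "(\<lambda>e xs. f e (map ((!) (map ((!) xs) vs)) ps)) \<in> readout_access (cmp inp d') l"
    unfolding readout_access_def
    by (intro UnI2 CollectI exI[of _ "\<lambda>e xs. f e (map ((!) xs) ps)"] exI[of _ vs]) (simp add: vs(1))
  then show ?thesis by (simp only: map_nth_map[OF ps(2)] ps(1) plc.base)
qed

lemma cmp_sum_tuples:
  assumes "f \<in> cmp inp d (q + m)" "q + m \<le> B"
  shows "(\<lambda>e xs. \<Sum>ys\<in>tuples (uni e) m. f e (xs @ ys)) \<in> cmp inp (d + m) q"
  using assms
proof (induction m arbitrary: f d)
  case 0
  have "tuples U 0 = {[]}" for U :: "'o set" by (auto simp: tuples_def)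
  with 0 show ?case by simp
next
  case (Suc m)
  then have "(\<lambda>e xs. \<Sum>x\<in>uni e. f e (xs @ [x])) \<in> cmp inp (Suc d) (q + m)"
    by (intro cmp_sum) auto
  from Suc.IH[OF this] Suc.prems show ?case by (simp add: sum_tuples_Suc)
qed

text \<open>The objects at \<open>cs\<close> are arguments of \<open>f\<close>, those at
  \<open>av\<close> are merely to be avoided. Hence \<open>f\<close> needs tuples of length
  \<open>length cs + m\<close> only, even though \<open>length av\<close> further objects take
  part.\<close>

definition count_avoiding ::
  "('e \<Rightarrow> 'o list \<Rightarrow> real) \<Rightarrow> nat list \<Rightarrow> nat list \<Rightarrow> nat \<Rightarrow> 'e \<Rightarrow> 'o list \<Rightarrow> real" where
  "count_avoiding f cs av m e xs = (\<Sum>ys\<in>tuples (uni e) m.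
     of_bool (distinct ys \<and> set ys \<inter> set (map ((!) xs) (cs @ av)) = {}) * f e (map ((!) xs) cs @ ys))"

text \<open>Summing over tuples that avoid the objects at \<open>av\<close> would take a tuple holding all of them together
  with the summed ones, which may exceed the breadth. Inclusion-exclusion does without: dropping \<open>z\<close>
  from the objects to be avoided, one subtracts the sums in which the \<open>i\<close>-th summed object ps \<open>z\<close>.\<close>

lemma count_avoiding_exists:
  fixes \<F> :: "nat \<Rightarrow> nat \<Rightarrow> ('e \<Rightarrow> 'o list \<Rightarrow> real) set"
  assumes "f \<in> \<F> (length cs) m" "length cs + m \<le> B"
    and "distinct (cs @ av)" "set (cs @ av) \<subseteq> {..<l}"
    and "\<And>e ws. tup (length cs + m) e ws \<Longrightarrow> \<not> distinct ws \<Longrightarrow> f e ws = 0"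
    and "\<And>g cs'. q \<le> length cs' \<Longrightarrow> length cs' \<le> B \<Longrightarrow> distinct cs' \<Longrightarrow> set cs' \<subseteq> {..<l} \<Longrightarrow>
      g \<in> cmp inp d' (length cs') \<Longrightarrow> (\<lambda>e xs. g e (map ((!) xs) cs')) \<in> plc (tup l) S"
    and "q \<le> length cs"
    and sums: "\<And>f q m. f \<in> \<F> q m \<Longrightarrow> q + m \<le> B \<Longrightarrow>
      (\<lambda>e xs. \<Sum>ys\<in>tuples (uni e) m. f e (xs @ ys)) \<in> cmp inp d' q"
    and perms: "\<And>f q m vs. f \<in> \<F> q (Suc m) \<Longrightarrow> distinct vs \<Longrightarrow> length vs = q + Suc m \<Longrightarrow>
      set vs = {..<q + Suc m} \<Longrightarrow> (\<lambda>e xs. f e (map ((!) xs) vs)) \<in> \<F> (Suc q) m"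
  shows "\<exists>h \<in> plc (tup l) S. \<forall>e xs. tup l e xs \<longrightarrow> distinct (map ((!) xs) (cs @ av)) \<longrightarrow>
    h e xs = count_avoiding f cs av m e xs"
  using assms(1-5,7)
proof (induction av arbitrary: f cs m)
  case Nil
  let ?g = "\<lambda>e xs. \<Sum>ys\<in>tuples (uni e) m. f e (xs @ ys)"
  have "?g \<in> cmp inp d' (length cs)"
    using Nil(1,2) by (rule sums)
  then have "(\<lambda>e xs. ?g e (map ((!) xs) cs)) \<in> plc (tup l) S"
    by (rule assms(6)[rotated -1]) (use Nil(2,3,4,6) in simp_all)
  \<comment> \<open>With nothing else to avoid, both conditions on \<open>ys\<close> come for free:
    \<open>f\<close> vanishes at every tuple with a repetition.\<close>
  moreover have "?g e (map ((!) xs) cs) = count_avoiding f cs [] m e xs"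
    if "tup l e xs" "distinct (map ((!) xs) (cs @ []))" for e xs
    unfolding count_avoiding_def
  proof (intro sum.cong refl)
    fix ys assume "ys \<in> tuples (uni e) m"
    then have "tup (length cs + m) e (map ((!) xs) cs @ ys)"
      using that Nil(4) map_nth_uni[of xs "uni e" cs] by (auto simp: tuples_def tup_def)
    from Nil(5)[OF this] show "f e (map ((!) xs) cs @ ys) =
        of_bool (distinct ys \<and> set ys \<inter> set (map ((!) xs) (cs @ [])) = {}) * f e (map ((!) xs) cs @ ys)"
      using that(2) by (cases "distinct (map ((!) xs) cs @ ys)") auto
  qed
  ultimately show ?case by (intro bexI[of _ "\<lambda>e xs. ?g e (map ((!) xs) cs)"]) auto
next
  case (Cons z av)
  have "\<exists>h \<in> plc (tup l) S. \<forall>e xs. tup l e xs \<longrightarrow> distinct (map ((!) xs) (cs @ av)) \<longrightarrow>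
    h e xs = count_avoiding f cs av m e xs"
    by (rule Cons.IH[OF Cons.prems(1,2) _ _ Cons.prems(5,6)])
       (use Cons.prems(3,4) in simp_all)
  then obtain h0 where h0: "h0 \<in> plc (tup l) S" "\<And>e xs. tup l e xs \<Longrightarrow> distinct (map ((!) xs) (cs @ av)) \<Longrightarrow>
    h0 e xs = count_avoiding f cs av m e xs" by blast
  \<comment> \<open>\<open>vs i\<close> moves the object right after \<open>cs\<close>, which will
    be \<open>z\<close>, to the place of the \<open>i\<close>-th summed object.\<close>
  define vs where "vs i = [0..<length cs] @ [Suc (length cs)..<Suc (length cs) + i] @
    length cs # [Suc (length cs) + i..<length cs + m]" for i
  define f' where "f' i = (\<lambda>e xs. f e (map ((!) xs) (vs i)))" for i
  have f': "f' i e (ws @ [x] @ ys) = f e (ws @ take i ys @ x # drop i ys)"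
    if "length ws = length cs" "length ys = m - 1" "i < m" for i e ws x ys
  proof -
    have "map ((!) (ws @ [x] @ ys)) [0..<length cs] = ws"
      using that by (intro nth_equalityI) (auto simp: nth_append)
    moreover have "map ((!) (ws @ [x] @ ys)) [Suc (length cs)..<Suc (length cs) + i] = take i ys"
      using that by (intro nth_equalityI) (auto simp: nth_append simp del: upt_Suc)
    moreover have "map ((!) (ws @ [x] @ ys)) [Suc (length cs) + i..<length cs + m] = drop i ys"
      using that by (intro nth_equalityI) (auto simp: nth_append simp del: upt_Suc)
    moreover have "(ws @ [x] @ ys) ! length cs = x" using that by (simp add: nth_append)
    ultimately show ?thesis unfolding f'_def vs_def by (simp del: upt_Suc)
  qed
  \<comment> \<open>\<open>z\<close> turns from an object to be avoided into an argument while one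
    summed object disappears: \<open>length cs + m\<close> stays the same and within the
    breadth.\<close>
  have "\<exists>h \<in> plc (tup l) S. \<forall>e xs. tup l e xs \<longrightarrow> distinct (map ((!) xs) ((cs @ [z]) @ av)) \<longrightarrow>
    h e xs = count_avoiding (f' i) (cs @ [z]) av (m - 1) e xs" if i: "i < m" for i
  proof (rule Cons.IH)
    have vs: "distinct (vs i)" "length (vs i) = length cs + m" "set (vs i) = {..<length cs + m}"
      using i by (auto simp: vs_def simp del: upt_Suc)
    have "f' i \<in> \<F> (Suc (length cs)) (m - 1)"
      unfolding f'_def using Cons.prems(1) vs i by (intro perms) simp_all
    then show "f' i \<in> \<F> (length (cs @ [z])) (m - 1)" by simp
    show "f' i e ws = 0" if "tup (length (cs @ [z]) + (m - 1)) e ws" "\<not> distinct ws" for e ws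
      unfolding f'_def
    proof (rule Cons.prems(5))
      have len: "length ws = length cs + m" using that i by (simp add: tup_def)
      show "tup (length cs + m) e (map ((!) ws) (vs i))"
        using that vs len map_nth_uni[of ws "uni e" "vs i"] by (auto simp: tup_def)
      have "set (map ((!) ws) (vs i)) = set ws"
        unfolding set_map vs(3) len[symmetric] by (auto simp: set_conv_nth)
      then show "\<not> distinct (map ((!) ws) (vs i))"
        using that(2) vs(2) len by (metis card_distinct distinct_card length_map)
    qed
  qed (use Cons.prems(2-4,6) i in simp_all)
  then obtain h where h: "\<And>i. i < m \<Longrightarrow> h i \<in> plc (tup l) S"
    "\<And>i e xs. i < m \<Longrightarrow> tup l e xs \<Longrightarrow> distinct (map ((!) xs) ((cs @ [z]) @ av)) \<Longrightarrow>
      h i e xs = count_avoiding (f' i) (cs @ [z]) av (m - 1) e xs" by metis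
  show ?case
  proof (intro bexI[of _ "\<lambda>e xs. h0 e xs - (\<Sum>i<m. h i e xs)"] allI impI)
    show "(\<lambda>e xs. h0 e xs - (\<Sum>i<m. h i e xs)) \<in> plc (tup l) S"
      using h0(1) h(1) by (intro plc_diff plc_sum) auto
    fix e xs assume tup: "tup l e xs" and dist: "distinct (map ((!) xs) (cs @ z # av))"
    let ?X = "set (map ((!) xs) (cs @ av))"
    have z: "xs ! z \<in> uni e" "xs ! z \<notin> ?X"
      using tup Cons.prems(4) dist by (auto simp: tup_def subset_iff)
    have "h i e xs = (\<Sum>ys\<in>tuples (uni e) (m - 1). of_bool (distinct ys \<and> set ys \<inter> insert (xs ! z) ?X = {}) *
        f e (map ((!) xs) cs @ take i ys @ xs ! z # drop i ys))" if i: "i < m" for i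
    proof -
      have "h i e xs = count_avoiding (f' i) (cs @ [z]) av (m - 1) e xs"
        using h(2)[OF i tup] dist by auto
      also have "\<dots> = (\<Sum>ys\<in>tuples (uni e) (m - 1). of_bool (distinct ys \<and> set ys \<inter> insert (xs ! z) ?X = {}) *
        f e (map ((!) xs) cs @ take i ys @ xs ! z # drop i ys))"
        unfolding count_avoiding_def
      proof (intro sum.cong refl arg_cong2[of _ _ _ _ "(*)"])
        fix ys assume "ys \<in> tuples (uni e) (m - 1)"
        then show "f' i e (map ((!) xs) (cs @ [z]) @ ys) = f e (map ((!) xs) cs @ take i ys @ xs ! z # drop i ys)"
          using f'[of "map ((!) xs) cs" ys i e "xs ! z"] i by (simp add: tuples_def)
      qed auto
      finally show ?thesis .
    qed
    moreover have "h0 e xs = count_avoiding f cs av m e xs" using h0(2)[OF tup] dist by auto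
    moreover have "count_avoiding f cs (z # av) m e xs = (\<Sum>ys\<in>tuples (uni e) m.
        of_bool (distinct ys \<and> set ys \<inter> insert (xs ! z) ?X = {}) * f e (map ((!) xs) cs @ ys))"
      by (simp add: count_avoiding_def)
    ultimately show "h0 e xs - (\<Sum>i<m. h i e xs) = count_avoiding f cs (z # av) m e xs"
      using sum_tuples_split[OF uni_finite z, where m = m and F = "\<lambda>ys. f e (map ((!) xs) cs @ ys)"] tup
      by (simp add: tup_def count_avoiding_def)
  qed
qed

end

section \<open>Patterns of goal sets and of regression steps\<close>

definition rename :: "('o \<Rightarrow> 'q) \<Rightarrow> ('p, 'o) atom \<Rightarrow> ('p, 'q) atom" where
  "rename h = (\<lambda>(p, vs). (p, map h vs))"

definition objs :: "('p, 'o) atom set \<Rightarrow> 'o set" where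
  "objs G = (\<Union>A\<in>G. set (snd A))"

text \<open>As every position occurs, \<open>r\<close> is the number of objects of an instance at
  distinct objects. So a goal set is stored exactly at the tuples that enumerate its
  objects.\<close>

definition pattern :: "('p, 'a) domain \<Rightarrow> nat \<Rightarrow> ('p, nat) atom set \<Rightarrow> bool" where
  "pattern D r \<Gamma> \<longleftrightarrow> \<Gamma> \<subseteq> atoms D {..<r} \<and> objs \<Gamma> = {..<r}"

definition applicable :: "('p, 'a) domain \<Rightarrow> ('p, 'o) atom set \<Rightarrow> ('a, 'o) gaction \<Rightarrow> bool" where
  "applicable D G a \<longleftrightarrow> G \<inter> gdel D a = {} \<and> G \<inter> gadd D a \<noteq> {}"

lemma inst_eq_rename: "inst xs = rename ((!) xs)"
  by (simp add: inst_def rename_def)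

lemma rename_rename: "rename h (rename k A) = rename (h \<circ> k) A"
  by (simp add: rename_def case_prod_unfold)

lemma rename_cong: "(\<And>x. x \<in> set (snd A) \<Longrightarrow> h x = k x) \<Longrightarrow> rename h A = rename k A"
  by (auto simp: rename_def case_prod_unfold)

lemma atoms_objs: "A \<in> atoms D U \<Longrightarrow> set (snd A) \<subseteq> U"
  by (auto simp: atoms_def)

lemma atoms_mono: "U \<subseteq> V \<Longrightarrow> atoms D U \<subseteq> atoms D V"
  by (auto simp: atoms_def)

lemma rename_in_atoms: "A \<in> atoms D U \<Longrightarrow> h ` U \<subseteq> V \<Longrightarrow> rename h A \<in> atoms D V"
  by (fastforce simp: atoms_def rename_def)

lemma objs_rename: "objs (rename h ` G) = h ` objs G"
  by (auto simp: objs_def rename_def case_prod_unfold)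

lemma objs_subset: "G \<subseteq> atoms D U \<Longrightarrow> objs G \<subseteq> U"
  using atoms_objs by (fastforce simp: objs_def)

lemma objs_Un: "objs (G \<union> H) = objs G \<union> objs H"
  by (auto simp: objs_def)

lemma objs_mono: "G \<subseteq> H \<Longrightarrow> objs G \<subseteq> objs H"
  by (auto simp: objs_def)

lemma finite_atoms: "finite U \<Longrightarrow> finite (atoms D U)"
proof -
  assume "finite U"
  have "atoms D U \<subseteq> (\<Union>p\<in>set (preds D). Pair p ` {xs. set xs \<subseteq> U \<and> length xs = pred_arity D p})"
    by (auto simp: atoms_def)
  then show ?thesis
    by (rule finite_subset) (simp add: finite_lists_length_eq \<open>finite U\<close>)
qed

lemma finite_ground_actions: "finite U \<Longrightarrow> finite (ground_actions D U)"
proof -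
  assume "finite U"
  have "ground_actions D U \<subseteq> (\<Union>a\<in>set (acts D). Pair a ` {xs. set xs \<subseteq> U \<and> length xs = act_arity D a})"
    by (auto simp: ground_actions_def)
  then show ?thesis
    by (rule finite_subset) (simp add: finite_lists_length_eq \<open>finite U\<close>)
qed

lemma inj_on_rename: "inj_on h X \<Longrightarrow> inj_on (rename h) (atoms D X)"
proof (intro inj_onI)
  fix A A'
  assume h: "inj_on h X" and A: "A \<in> atoms D X" "A' \<in> atoms D X" and eq: "rename h A = rename h A'"
  then have "inj_on h (set (snd A) \<union> set (snd A'))" using atoms_objs by (metis Un_least inj_on_subset)
  then show "A = A'" using eq inj_on_map_eq_map[of h "snd A" "snd A'"]
    by (auto simp: rename_def prod_eq_iff case_prod_unfold)
qed

lemma gatoms_in_atoms: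
  assumes "wf_domain D" "a \<in> ground_actions D U"
  shows "gpre D a \<subseteq> atoms D U" "gadd D a \<subseteq> atoms D U" "gdel D a \<subseteq> atoms D U"
    and "objs (gpre D a) \<subseteq> set (snd a)" "objs (gadd D a) \<subseteq> set (snd a)"
proof -
  obtain b xs where a: "a = (b, xs)" by (cases a)
  have b: "b \<in> set (acts D)" and xs: "length xs = act_arity D b" "set xs \<subseteq> U"
    using assms(2) a by (auto simp: ground_actions_def)
  have wf: "pre D b \<subseteq> atoms D {..<length xs}" "add_eff D b \<subseteq> atoms D {..<length xs}"
    "del_eff D b \<subseteq> atoms D {..<length xs}"
    using assms(1) b xs by (auto simp: wf_domain_def)
  have nth: "(!) xs ` {..<length xs} \<subseteq> set xs" by auto
  have sub: "inst xs ` S \<subseteq> atoms D (set xs)" if "S \<subseteq> atoms D {..<length xs}" for S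
    unfolding inst_eq_rename using that rename_in_atoms[OF _ nth] by blast
  show "gpre D a \<subseteq> atoms D U" "gadd D a \<subseteq> atoms D U" "gdel D a \<subseteq> atoms D U"
    unfolding a gpre_def gadd_def gdel_def prod.case
    using sub[OF wf(1)] sub[OF wf(2)] sub[OF wf(3)] atoms_mono[OF xs(2), of D] by blast+
  show "objs (gpre D a) \<subseteq> set (snd a)" "objs (gadd D a) \<subseteq> set (snd a)"
    unfolding a gpre_def gadd_def prod.case snd_conv
    using objs_subset[OF sub[OF wf(1)]] objs_subset[OF sub[OF wf(2)]] .
qed

lemma gatoms_rename:
  assumes "wf_domain D" "(b, \<sigma>) \<in> ground_actions D X"
  shows "gpre D (b, map h \<sigma>) = rename h ` gpre D (b, \<sigma>)"
    "gadd D (b, map h \<sigma>) = rename h ` gadd D (b, \<sigma>)"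
    "gdel D (b, map h \<sigma>) = rename h ` gdel D (b, \<sigma>)"
proof -
  have b: "b \<in> set (acts D)" and len: "length \<sigma> = act_arity D b"
    using assms(2) by (auto simp: ground_actions_def)
  have wf: "pre D b \<subseteq> atoms D {..<length \<sigma>}" "add_eff D b \<subseteq> atoms D {..<length \<sigma>}"
    "del_eff D b \<subseteq> atoms D {..<length \<sigma>}"
    using assms(1) b len by (auto simp: wf_domain_def)
  have "inst (map h \<sigma>) ` S = rename h ` inst \<sigma> ` S" if "S \<subseteq> atoms D {..<length \<sigma>}" for S
  proof -
    have "inst (map h \<sigma>) A = rename h (inst \<sigma> A)" if "A \<in> S" for A
    proof -
      have "set (snd A) \<subseteq> {..<length \<sigma>}"
        using that \<open>S \<subseteq> _\<close> atoms_objs by blast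
      then show ?thesis
        unfolding inst_eq_rename rename_rename by (intro rename_cong) (auto simp: subset_iff)
    qed
    then show ?thesis by (auto simp: image_iff)
  qed
  with wf show "gpre D (b, map h \<sigma>) = rename h ` gpre D (b, \<sigma>)"
    "gadd D (b, map h \<sigma>) = rename h ` gadd D (b, \<sigma>)"
    "gdel D (b, map h \<sigma>) = rename h ` gdel D (b, \<sigma>)"
    by (simp_all add: gpre_def gadd_def gdel_def)
qed

text \<open>Injectivity is required of the renaming of atoms rather than of \<open>h\<close>: if
  \<open>B = 0\<close>, all atoms are nullary and it holds whatever \<open>h\<close> is.\<close>

lemma applicable_rename:
  assumes "wf_domain D" "(b, \<sigma>) \<in> ground_actions D X" "inj_on (rename h) (atoms D X)" "G \<subseteq> atoms D X"
  shows "applicable D (rename h ` G) (b, map h \<sigma>) \<longleftrightarrow> applicable D G (b, \<sigma>)"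
  unfolding applicable_def gatoms_rename[OF assms(1,2)]
  using gatoms_in_atoms[OF assms(1,2)] assms(4) inj_on_image_Int[OF assms(3), of G, symmetric]
  by simp

lemma regress_rename:
  assumes "wf_domain D" "(b, \<sigma>) \<in> ground_actions D X" "inj_on (rename h) (atoms D X)" "G \<subseteq> atoms D X"
  shows "regress D (rename h ` G) (b, map h \<sigma>) = rename h ` regress D G (b, \<sigma>)"
  unfolding regress_def gatoms_rename[OF assms(1,2)] image_Un[symmetric]
  using gatoms_in_atoms[OF assms(1,2)] assms(4)
  by (intro inj_on_image_set_diff[OF assms(3), symmetric]) auto

lemma regress_in_atoms:
  assumes "wf_domain D" "a \<in> ground_actions D U" "G \<subseteq> atoms D U"
  shows "regress D G a \<subseteq> atoms D U"
  using gatoms_in_atoms[OF assms(1,2)] assms(3) by (auto simp: regress_def)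

lemma pattern_exists:
  assumes "G \<subseteq> atoms D U" "set ws = objs G"
  shows "\<exists>\<Gamma>. \<Gamma> \<subseteq> atoms D {..<length ws} \<and> inst ws ` \<Gamma> = G \<and> (distinct ws \<longrightarrow> pattern D (length ws) \<Gamma>)"
proof (intro exI[of _ "{A \<in> atoms D {..<length ws}. inst ws A \<in> G}"] conjI impI)
  let ?\<Gamma> = "{A \<in> atoms D {..<length ws}. inst ws A \<in> G}"
  show img: "inst ws ` ?\<Gamma> = G"
  proof (intro equalityI subsetI)
    fix A assume A: "A \<in> G"
    then have "set (snd A) \<subseteq> set ws" using assms(2) by (auto simp: objs_def)
    then obtain ps where ps: "map ((!) ws) ps = snd A" "set ps \<subseteq> {..<length ws}"
      using factor_through_nth by blast
    have "inst ws (fst A, ps) = A" using ps(1) by (simp add: inst_def)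
    moreover have "(fst A, ps) \<in> atoms D {..<length ws}"
      using A assms(1) ps length_map[of "(!) ws" ps] by (auto simp: atoms_def)
    ultimately show "A \<in> inst ws ` ?\<Gamma>" using A by (metis (mono_tags, lifting) image_eqI mem_Collect_eq)
  qed auto
  show "pattern D (length ws) ?\<Gamma>" if "distinct ws"
  proof -
    have sub: "objs ?\<Gamma> \<subseteq> {..<length ws}" by (rule objs_subset[of _ D]) auto
    have "(!) ws ` objs ?\<Gamma> = set ws"
      using img unfolding inst_eq_rename by (metis (lifting) assms(2) objs_rename)
    also have "set ws = (!) ws ` {..<length ws}" by (auto simp: set_conv_nth)
    finally have "objs ?\<Gamma> = {..<length ws}"
      using inj_on_image_eq_iff[OF inj_on_nth[OF that, of "{..<length ws}"], of "objs ?\<Gamma>"] sub by simp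
    then show ?thesis by (auto simp: pattern_def)
  qed
qed auto

text \<open>Objects that occur at the positions \<open>I\<close> of \<open>xs\<close> are named by these positions, the others by
  \<open>length xs, length xs + 1, \<dots>\<close>\<close>

lemma naming_exists:
  assumes "G \<subseteq> atoms D U" "finite (objs G)" "inj_on ((!) xs) I" "I \<subseteq> {..<length xs}"
  obtains cs ys \<Gamma> where "distinct cs" "set cs \<subseteq> I" "set (map ((!) xs) cs) = objs G \<inter> (!) xs ` I"
    "distinct ys" "set ys = objs G - (!) xs ` I" "length cs + length ys = card (objs G)"
    "pattern D (length cs + length ys) \<Gamma>" "inst (map ((!) xs) cs @ ys) ` \<Gamma> = G"
proof -
  have "finite I" using assms(4) finite_subset by blast
  then obtain cs where cs: "distinct cs" "set cs = {i \<in> I. xs ! i \<in> objs G}"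
    using finite_distinct_list[of "{i \<in> I. xs ! i \<in> objs G}"] by auto
  obtain ys where ys: "distinct ys" "set ys = objs G - (!) xs ` I"
    using finite_distinct_list[of "objs G - (!) xs ` I"] assms(2) by auto
  let ?ws = "map ((!) xs) cs @ ys"
  have img: "set (map ((!) xs) cs) = objs G \<inter> (!) xs ` I" using cs by auto
  have "inj_on ((!) xs) (set cs)" using cs(2) by (intro inj_on_subset[OF assms(3)]) auto
  then have dist: "distinct ?ws" using cs ys by (auto simp: distinct_map)
  have set: "set ?ws = objs G" using img ys by auto
  have "length cs + length ys = card (objs G)" using distinct_card[OF dist] set by simp
  moreover obtain \<Gamma> where "inst ?ws ` \<Gamma> = G" "pattern D (length ?ws) \<Gamma>"
    using pattern_exists[OF assms(1) set] dist by blast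
  ultimately show ?thesis
    by (intro that[of cs ys \<Gamma>, OF cs(1) _ img ys]) (use cs(2) in auto)
qed

text \<open>Reconciles two namings: \<open>\<Gamma>\<close> numbers the objects of its own goal set,
  a step numbers those of the regressed tuple \<open>xs\<close>, then the new ones
  \<open>ys\<close>, then the rest. The list \<open>cs @ [l..<l + m]\<close> translates the first
  naming into the second.\<close>

lemma inst_append_indices:
  assumes "\<Gamma> \<subseteq> atoms D {..<length cs + m}" "set cs \<subseteq> {..<l}" "length xs = l" "length ys = m"
  shows "inst (xs @ ys @ es) ` inst (cs @ [l..<l + m]) ` \<Gamma> = inst (map ((!) xs) cs @ ys) ` \<Gamma>"
proof -
  have "inst (xs @ ys @ es) (inst (cs @ [l..<l + m]) A) = inst (map ((!) xs) cs @ ys) A" if "A \<in> \<Gamma>" for A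
    unfolding inst_eq_rename rename_rename
  proof (rule rename_cong)
    fix i assume "i \<in> set (snd A)"
    then have "i < length cs + m" using assms(1) that atoms_objs by blast
    then show "((!) (xs @ ys @ es) \<circ> (!) (cs @ [l..<l + m])) i = (map ((!) xs) cs @ ys) ! i"
      using assms(2-4) nth_mem[of i cs] by (auto simp: nth_append subset_iff)
  qed
  then show ?thesis by (simp add: image_image)
qed

lemma inst_append_prefix:
  assumes "\<Gamma> \<subseteq> atoms D {..<length xs}"
  shows "inst (xs @ ys) ` \<Gamma> = inst xs ` \<Gamma>"
proof (intro image_cong refl)
  fix A assume "A \<in> \<Gamma>"
  then have "set (snd A) \<subseteq> {..<length xs}" using assms atoms_objs by blast
  then show "inst (xs @ ys) A = inst xs A"
    unfolding inst_eq_rename by (intro rename_cong) (auto simp: nth_append)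
qed

lemma indices_in_atoms:
  assumes "\<Gamma> \<subseteq> atoms D {..<length cs + m}" "set cs \<subseteq> X" "{l..<l + m} \<subseteq> X"
  shows "inst (cs @ [l..<l + m]) ` \<Gamma> \<subseteq> atoms D X"
proof -
  have "(!) (cs @ [l..<l + m]) ` {..<length cs + m} \<subseteq> X"
  proof (intro image_subsetI)
    fix i assume i: "i \<in> {..<length cs + m}"
    show "(cs @ [l..<l + m]) ! i \<in> X"
    proof (cases "i < length cs")
      case True
      then show ?thesis using assms(2) nth_mem[of i cs] by (auto simp: nth_append)
    next
      case False
      then have "(cs @ [l..<l + m]) ! i = l + (i - length cs)" "i - length cs < m"
        using i by (auto simp: nth_append)
      then show ?thesis using assms(3) by auto
    qed
  qed
  then show ?thesis unfolding inst_eq_rename using assms(1) rename_in_atoms by blast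
qed

section \<open>Finitely many types of regression steps\<close>

locale bounded_domain =
  fixes D :: "('p, 'a) domain" and \<beta> \<alpha> B :: nat
  assumes wf: "wf_domain D"
    and arity: "p \<in> set (preds D) \<Longrightarrow> pred_arity D p \<le> \<beta>"
    and act_arity: "a \<in> set (acts D) \<Longrightarrow> act_arity D a \<le> \<alpha>"
    and breadth: "\<beta> \<le> B"
begin

lemma nullary:
  assumes "B = 0" "A \<in> atoms D U"
  shows "snd A = []"
  using assms arity[of "fst A"] breadth by (auto simp: atoms_def)

lemma nullary_rename:
  assumes "B = 0" "A \<in> atoms D U"
  shows "rename h A = (fst A, [])"
  using nullary[OF assms] by (simp add: rename_def case_prod_unfold)

text \<open>For \<open>B = 0\<close> this permits replacing all arguments of an action by a single
  object, which is how \<open>step_types\<close> gets along with \<open>e \<le> 1\<close>.\<close>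

lemma nullary_args:
  assumes "B = 0" "(b, xs) \<in> ground_actions D U" "length ys = length xs" "set ys \<subseteq> U"
  shows "gpre D (b, ys) = gpre D (b, xs)" "gadd D (b, ys) = gadd D (b, xs)" "gdel D (b, ys) = gdel D (b, xs)"
proof -
  have b: "b \<in> set (acts D)" using assms(2) by (auto simp: ground_actions_def)
  have "inst ys ` S = inst xs ` S" if "S \<subseteq> atoms D X" for S X
  proof (intro image_cong refl)
    fix A assume "A \<in> S"
    then have "A \<in> atoms D X" using that by blast
    then show "inst ys A = inst xs A" unfolding inst_eq_rename by (simp add: nullary_rename[OF assms(1)])
  qed
  moreover have "pre D b \<subseteq> atoms D {..<act_arity D b}" "add_eff D b \<subseteq> atoms D {..<act_arity D b}"
    "del_eff D b \<subseteq> atoms D {..<act_arity D b}" using wf b by (auto simp: wf_domain_def)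
  ultimately show "gpre D (b, ys) = gpre D (b, xs)" "gadd D (b, ys) = gadd D (b, xs)" "gdel D (b, ys) = gdel D (b, xs)"
    by (auto simp: gpre_def gadd_def gdel_def)
qed

text \<open>A type describes, up to renaming, a step that regresses \<open>G\<close> to the goal set of pattern \<open>\<Gamma>'\<close>
  over a tuple \<open>zs\<close> of length \<open>r\<close>: \<open>cs\<close> are the positions of the objects of \<open>zs\<close> that occur in \<open>G\<close>,
  \<open>m\<close> further objects occur in \<open>G\<close> only, and \<open>e\<close> in neither goal set but among the arguments of the
  action. If \<open>B = 0\<close>, the number of objects is out of sight of the network, but then all atoms are
  nullary and one object suffices.\<close>

definition step_types :: "nat \<Rightarrow> ('p, nat) atom set \<Rightarrow> (nat list \<times> nat \<times> ('p, nat) atom set \<times> nat \<times> ('a, nat) gaction) set" where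
  "step_types r \<Gamma>' = {(cs, m, \<Gamma>, e, a). distinct cs \<and> set cs \<subseteq> {..<r} \<and> length cs + m \<le> B \<and>
     m \<le> \<alpha> \<and> r \<le> length cs + \<alpha> \<and> e \<le> \<alpha> \<and> (B = 0 \<longrightarrow> e \<le> 1) \<and>
     pattern D (length cs + m) \<Gamma> \<and> a \<in> ground_actions D {..<r + m + e} \<and>
     applicable D (inst (cs @ [r..<r + m]) ` \<Gamma>) a \<and> regress D (inst (cs @ [r..<r + m]) ` \<Gamma>) a = \<Gamma>'}"

lemma finite_step_types: "finite (step_types r \<Gamma>')"
proof -
  have "step_types r \<Gamma>' \<subseteq> {cs. set cs \<subseteq> {..<r} \<and> length cs \<le> B} \<times> {..\<alpha>} \<times> Pow (atoms D {..<B}) \<times> {..\<alpha>} \<times>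
      (\<Union>m\<le>\<alpha>. \<Union>e\<le>\<alpha>. ground_actions D {..<r + m + e})"
  proof
    fix t assume "t \<in> step_types r \<Gamma>'"
    moreover obtain cs m \<Gamma> e a where t_eq: "t = (cs, m, \<Gamma>, e, a)" by (cases t)
    ultimately have t: "(cs, m, \<Gamma>, e, a) \<in> step_types r \<Gamma>'" by simp
    then have "\<Gamma> \<subseteq> atoms D {..<length cs + m}" "length cs + m \<le> B"
      by (simp_all add: step_types_def pattern_def)
    then have "\<Gamma> \<subseteq> atoms D {..<B}" using atoms_mono[of "{..<length cs + m}" "{..<B}" D] by auto
    with t show "t \<in> {cs. set cs \<subseteq> {..<r} \<and> length cs \<le> B} \<times> {..\<alpha>} \<times> Pow (atoms D {..<B}) \<times> {..\<alpha>} \<times>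
      (\<Union>m\<le>\<alpha>. \<Union>e\<le>\<alpha>. ground_actions D {..<r + m + e})"
      by (auto simp: step_types_def t_eq)
  qed
  then show ?thesis
    by (rule finite_subset) (auto intro!: finite_cartesian_product finite_lists_length_le finite_atoms finite_ground_actions)
qed

text \<open>Objects occurring in the action only are subject to no condition other than being
  distinct from each other and from the rest. Whether they exist is a matter of counting
  \<open>U\<close>; then the action of the type is renamed to actual objects.\<close>

lemma step_type_sound:
  assumes type: "(cs, m, \<Gamma>, e, a) \<in> step_types r \<Gamma>'" and \<Gamma>': "pattern D r \<Gamma>'"
    and U: "finite U" "U \<noteq> {}" and zs: "distinct zs" "length zs = r" "set zs \<subseteq> U" "r \<le> B"
    and ys: "distinct ys" "length ys = m" "set ys \<subseteq> U" "set ys \<inter> set zs = {}"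
    and card: "B = 0 \<or> r + m + e \<le> card U"
  shows "\<exists>a \<in> ground_actions D U. applicable D (inst (map ((!) zs) cs @ ys) ` \<Gamma>) a \<and>
    regress D (inst (map ((!) zs) cs @ ys) ` \<Gamma>) a = inst zs ` \<Gamma>'"
proof -
  obtain b \<sigma> where a: "a = (b, \<sigma>)" by (cases a)
  let ?N = "r + m + e" and ?\<Gamma> = "inst (cs @ [r..<r + m]) ` \<Gamma>"
  have cs: "set cs \<subseteq> {..<r}" and \<Gamma>: "\<Gamma> \<subseteq> atoms D {..<length cs + m}"
    and ga: "(b, \<sigma>) \<in> ground_actions D {..<?N}" and app: "applicable D ?\<Gamma> (b, \<sigma>)" "regress D ?\<Gamma> (b, \<sigma>) = \<Gamma>'"
    using type by (auto simp: step_types_def a pattern_def)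
  obtain es where es: "length es = e" "set es \<subseteq> U" "B = 0 \<or> distinct (zs @ ys @ es)"
  proof (cases "B = 0")
    case True
    obtain u where "u \<in> U" using U by blast
    then show ?thesis using True by (intro that[of "replicate e u"]) auto
  next
    case False
    have "card (set zs \<union> set ys) = r + m" using zs ys by (simp add: card_Un_disjoint distinct_card Int_commute)
    then have "e \<le> card (U - (set zs \<union> set ys))"
      using card False zs ys U by (simp add: card_Diff_subset)
    then obtain E where "E \<subseteq> U - (set zs \<union> set ys)" "card E = e" "finite E"
      using obtain_subset_with_card_n by metis
    moreover then obtain es where "set es = E" "distinct es" using finite_distinct_list by blast
    ultimately show ?thesis using zs ys distinct_card[of es] by (intro that[of es]) auto
  qed
  let ?h = "(!) (zs @ ys @ es)"
  have len: "length (zs @ ys @ es) = ?N" using zs ys es by simp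
  have inj: "inj_on (rename ?h) (atoms D {..<?N})"
  proof (cases "B = 0")
    case True
    then show ?thesis
      by (intro inj_onI) (metis nullary nullary_rename prod.collapse prod.inject)
  next
    case False
    then have "inj_on ?h {..<?N}" using es(3) by (intro inj_on_nth ballI) (simp_all only: len lessThan_iff, simp)
    then show ?thesis by (rule inj_on_rename)
  qed
  have sub: "?\<Gamma> \<subseteq> atoms D {..<?N}" using cs by (intro indices_in_atoms[OF \<Gamma>]) auto
  have imgs: "rename ?h ` ?\<Gamma> = inst (map ((!) zs) cs @ ys) ` \<Gamma>"
    using inst_append_indices[OF \<Gamma> cs zs(2) ys(2)] by (simp add: inst_eq_rename)
  have img': "rename ?h ` \<Gamma>' = inst zs ` \<Gamma>'"
    using inst_append_prefix[of \<Gamma>' D zs] \<Gamma>' zs(2) by (simp add: pattern_def inst_eq_rename)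
  have "set (map ?h \<sigma>) \<subseteq> U"
  proof -
    have "set (map ?h \<sigma>) \<subseteq> set (zs @ ys @ es)"
      using ga len nth_mem[of _ "zs @ ys @ es"] by (auto simp: ground_actions_def subset_iff simp del: set_append)
    then show ?thesis using zs ys es by auto
  qed
  then have "(b, map ?h \<sigma>) \<in> ground_actions D U" using ga by (auto simp: ground_actions_def)
  with applicable_rename[OF wf ga inj sub] regress_rename[OF wf ga inj sub] app show ?thesis
    unfolding imgs img' by (intro bexI[of _ "(b, map ?h \<sigma>)"]) (auto simp: img')
qed

lemma step_type_complete:
  assumes a: "a \<in> ground_actions D U" "applicable D G a" "regress D G a = inst zs ` \<Gamma>'"
    and G: "G \<subseteq> atoms D U" "card (objs G) \<le> B" and \<Gamma>': "pattern D r \<Gamma>'"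
    and U: "finite U" "U \<noteq> {}" and zs: "distinct zs" "length zs = r" "set zs \<subseteq> U" "r \<le> B"
  obtains cs m \<Gamma> e a' ys where "(cs, m, \<Gamma>, e, a') \<in> step_types r \<Gamma>'"
    "distinct ys" "length ys = m" "set ys \<subseteq> U" "set ys \<inter> set zs = {}"
    "inst (map ((!) zs) cs @ ys) ` \<Gamma> = G" "B = 0 \<or> r + m + e \<le> card U"
proof -
  have nth_zs: "(!) zs ` {..<r} = set zs" using zs(2) by (auto simp: set_conv_nth)
  have objs_img: "objs (inst zs ` \<Gamma>') = set zs"
    using \<Gamma>' nth_zs by (simp add: inst_eq_rename objs_rename pattern_def)
  obtain b as where ab: "a = (b, as)" by (cases a)
  obtain u where u: "u \<in> U" using U by blast
  \<comment> \<open>Without objects in the atoms the arguments may be collapsed to one object, so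
    that at most one name is needed for them.\<close>
  define as' where "as' = (if B = 0 then replicate (length as) u else as)"
  have as': "(b, as') \<in> ground_actions D U" "length as' = length as"
    using a(1) u by (auto simp: as'_def ab ground_actions_def)
  have eqs: "gpre D (b, as') = gpre D a" "gadd D (b, as') = gadd D a" "gdel D (b, as') = gdel D a"
  proof -
    have "gpre D (b, as') = gpre D a \<and> gadd D (b, as') = gadd D a \<and> gdel D (b, as') = gdel D a"
    proof (cases "B = 0")
      case True
      moreover have "set as' \<subseteq> U" using as'(1) by (simp add: ground_actions_def)
      ultimately show ?thesis using nullary_args[OF True a(1)[unfolded ab] as'(2)] by (simp add: ab)
    next
      case False
      then show ?thesis by (simp add: as'_def ab)
    qed
    then show "gpre D (b, as') = gpre D a" "gadd D (b, as') = gadd D a" "gdel D (b, as') = gdel D a"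
      by auto
  qed
  have app': "applicable D G (b, as')" "regress D G (b, as') = inst zs ` \<Gamma>'"
    using a(2,3) eqs by (simp_all add: applicable_def regress_def)
  have fin: "finite (objs G)" using objs_subset[OF G(1)] U(1) finite_subset by blast
  have inj_zs: "inj_on ((!) zs) {..<r}" using zs by (intro inj_on_nth) auto
  have r_zs: "{..<r} \<subseteq> {..<length zs}" using zs(2) by simp
  obtain cs ys \<Gamma> where N: "distinct cs" "set cs \<subseteq> {..<r}" "set (map ((!) zs) cs) = objs G \<inter> set zs"
    "distinct ys" "set ys = objs G - set zs" "length cs + length ys = card (objs G)"
    "pattern D (length cs + length ys) \<Gamma>" "inst (map ((!) zs) cs @ ys) ` \<Gamma> = G"
    by (rule naming_exists[OF G(1) fin inj_zs r_zs, unfolded nth_zs])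
  let ?m = "length ys"
  have args: "objs (gpre D (b, as')) \<subseteq> set as'" "objs (gadd D (b, as')) \<subseteq> set as'"
    using gatoms_in_atoms(4,5)[OF wf as'(1)] by auto
  \<comment> \<open>Regression removes add effects and inserts preconditions, so every object in
    exactly one of the two goal sets is an argument of the action. This bounds both the new and the
    disappearing objects by \<alpha>, and thereby the number of layers a step costs.\<close>
  have "G \<subseteq> inst zs ` \<Gamma>' \<union> gadd D (b, as')" using app'(2) by (auto simp: regress_def)
  then have "objs G \<subseteq> set zs \<union> set as'"
    by (rule order_trans[OF objs_mono]) (use args(2) in \<open>simp add: objs_Un objs_img le_supI2\<close>)
  then have ys_as: "set ys \<subseteq> set as'" using N(5) by auto
  have "inst zs ` \<Gamma>' \<subseteq> G \<union> gpre D (b, as')" using app'(2) by (auto simp: regress_def)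
  then have zs_as: "set zs - objs G \<subseteq> set as'"
    using objs_mono[of "inst zs ` \<Gamma>'" "G \<union> gpre D (b, as')"] args(1) unfolding objs_Un objs_img by auto
  have card_as: "card (set as') \<le> \<alpha>"
    using card_length[of as'] as' act_arity[of b] by (auto simp: ground_actions_def)
  have m: "?m \<le> \<alpha>" using card_mono[OF _ ys_as] card_as N(4) by (simp add: distinct_card)
  have "card (set zs) = card (objs G \<inter> set zs) + card (set zs - objs G)"
    by (metis List.finite_set card_Int_Diff inf_commute)
  moreover have "card (objs G \<inter> set zs) \<le> length cs"
    using card_length[of "map ((!) zs) cs"] N(3) by simp
  moreover have "card (set zs - objs G) \<le> \<alpha>" using card_mono[OF _ zs_as] card_as by simp
  ultimately have r: "r \<le> length cs + \<alpha>" using zs by (simp add: distinct_card)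
  obtain es where es: "distinct es" "set es = set as' - set zs - set ys"
    using finite_distinct_list[of "set as' - set zs - set ys"] by auto
  let ?e = "length es"
  have "card (set es) \<le> card (set as')" using es(2) by (intro card_mono) auto
  then have e: "?e \<le> \<alpha>" using card_as es(1) by (simp add: distinct_card)
  have e0: "?e \<le> 1" if "B = 0"
  proof -
    have "set es \<subseteq> {u}" using es(2) that by (auto simp: as'_def split: if_splits)
    then have "card (set es) \<le> 1" using card_mono[of "{u}" "set es"] by simp
    then show ?thesis using es(1) by (simp add: distinct_card)
  qed
  have dist: "distinct (zs @ ys @ es)" using zs N es by auto
  have U': "set (zs @ ys @ es) \<subseteq> U"
    using zs(3) N(5) objs_subset[OF G(1)] es(2) as'(1) by (auto simp: ground_actions_def)
  have card: "r + ?m + ?e \<le> card U"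
    using card_mono[OF U(1) U'] distinct_card[OF dist] zs(2) by simp
  obtain \<sigma> where \<sigma>: "map ((!) (zs @ ys @ es)) \<sigma> = as'" "set \<sigma> \<subseteq> {..<r + ?m + ?e}"
    using factor_through_nth[of as' "zs @ ys @ es"] es(2) zs(2) by (auto simp: add.assoc)
  let ?h = "(!) (zs @ ys @ es)" and ?\<Gamma> = "inst (cs @ [r..<r + ?m]) ` \<Gamma>"
  have \<Gamma>: "\<Gamma> \<subseteq> atoms D {..<length cs + ?m}" using N(7) by (simp add: pattern_def)
  have ga: "(b, \<sigma>) \<in> ground_actions D {..<r + ?m + ?e}"
    using as'(1) \<sigma> length_map[of ?h \<sigma>] by (auto simp: ground_actions_def)
  have "inj_on ?h {..<r + ?m + ?e}" using dist zs(2) by (intro inj_on_nth) auto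
  then have inj: "inj_on (rename ?h) (atoms D {..<r + ?m + ?e})" by (rule inj_on_rename)
  have sub: "?\<Gamma> \<subseteq> atoms D {..<r + ?m + ?e}" using N(2) by (intro indices_in_atoms[OF \<Gamma>]) auto
  have imgs: "rename ?h ` ?\<Gamma> = G"
    using inst_append_indices[OF \<Gamma> N(2) zs(2) refl] N(8) by (simp add: inst_eq_rename)
  have \<Gamma>'sub: "\<Gamma>' \<subseteq> atoms D {..<r}" using \<Gamma>' by (simp add: pattern_def)
  have img': "rename ?h ` \<Gamma>' = inst zs ` \<Gamma>'"
    using inst_append_prefix[of \<Gamma>' D zs] \<Gamma>'sub zs(2) by (simp add: inst_eq_rename)
  have "rename ?h ` regress D ?\<Gamma> (b, \<sigma>) = rename ?h ` \<Gamma>'"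
    using regress_rename[OF wf ga inj sub] unfolding imgs \<sigma>(1) img' app'(2) by simp
  moreover have "\<Gamma>' \<subseteq> atoms D {..<r + ?m + ?e}"
    using \<Gamma>'sub atoms_mono[of "{..<r}" "{..<r + ?m + ?e}" D] by auto
  ultimately have "regress D ?\<Gamma> (b, \<sigma>) = \<Gamma>'"
    using inj_on_image_eq_iff[OF inj regress_in_atoms[OF wf ga sub]] by blast
  moreover have "applicable D ?\<Gamma> (b, \<sigma>)"
    using applicable_rename[OF wf ga inj sub] unfolding imgs \<sigma>(1) using app'(1) by simp
  ultimately have "(cs, ?m, \<Gamma>, ?e, (b, \<sigma>)) \<in> step_types r \<Gamma>'"
    using N(1,2,6,7) m r e e0 ga G(2) by (auto simp: step_types_def)
  then show ?thesis
    using N(4,5,8) U' card by (intro that[of cs ?m \<Gamma> ?e "(b, \<sigma>)" ys]) auto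
qed

end

section \<open>Rounds of the search\<close>

context relnet
begin

text \<open>The family \<F> stands for the functions of \<open>q\<close> fixed and \<open>m\<close>
  summed arguments that may arise during inclusion-exclusion. It is left open because it is used
  twice: with a budget of layers for the sums in a round of the search, and with sums already stored
  as features at the readout. Only lists of positions at least as long as \<open>cs\<close> have to
  be reached, which keeps the cost of dropping positions small.\<close>

lemma exists_avoiding:
  fixes \<F> :: "nat \<Rightarrow> nat \<Rightarrow> ('e \<Rightarrow> 'o list \<Rightarrow> real) set"
  assumes F: "(\<lambda>e ws. of_bool (F e ws)) \<in> \<F> (length cs) m" "length cs + m \<le> B"
      "\<And>e ws. tup (length cs + m) e ws \<Longrightarrow> F e ws \<Longrightarrow> distinct ws"
    and pos: "distinct (cs @ av)" "set (cs @ av) \<subseteq> {..<l}"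
    and base: "\<And>g cs'. length cs \<le> length cs' \<Longrightarrow> length cs' \<le> B \<Longrightarrow> distinct cs' \<Longrightarrow> set cs' \<subseteq> {..<l} \<Longrightarrow>
      g \<in> cmp inp d' (length cs') \<Longrightarrow> (\<lambda>e xs. g e (map ((!) xs) cs')) \<in> plc (tup l) S"
    and N: "(\<lambda>e xs. of_bool (N e xs)) \<in> plc (tup l) S"
      "\<And>e xs. tup l e xs \<Longrightarrow> N e xs \<Longrightarrow> distinct (map ((!) xs) (cs @ av))"
    and sums: "\<And>f q m. f \<in> \<F> q m \<Longrightarrow> q + m \<le> B \<Longrightarrow>
      (\<lambda>e xs. \<Sum>ys\<in>tuples (uni e) m. f e (xs @ ys)) \<in> cmp inp d' q"
    and perms: "\<And>f q m vs. f \<in> \<F> q (Suc m) \<Longrightarrow> distinct vs \<Longrightarrow> length vs = q + Suc m \<Longrightarrow>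
      set vs = {..<q + Suc m} \<Longrightarrow> (\<lambda>e xs. f e (map ((!) xs) vs)) \<in> \<F> (Suc q) m"
  shows "(\<lambda>e xs. of_bool (N e xs \<and> (\<exists>ys\<in>tuples (uni e) m. distinct ys \<and>
    set ys \<inter> set (map ((!) xs) (cs @ av)) = {} \<and> F e (map ((!) xs) cs @ ys)))) \<in> plc (tup l) S"
proof -
  let ?f = "\<lambda>e ws. of_bool (F e ws)"
  have vanish: "?f e ws = 0" if "tup (length cs + m) e ws" "\<not> distinct ws" for e ws
    using F(3) that by auto
  obtain h where h: "h \<in> plc (tup l) S"
    "\<forall>e xs. tup l e xs \<longrightarrow> distinct (map ((!) xs) (cs @ av)) \<longrightarrow> h e xs = count_avoiding ?f cs av m e xs"
    using count_avoiding_exists[where \<F> = \<F> and f = ?f and cs = cs and m = m and q = "length cs",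
        OF F(1,2) pos vanish base order_refl sums perms] by blast
  \<comment> \<open>A count cut off at 1 is the truth value of existence. Where \<open>N\<close>
    fails, \<open>h\<close> may be any number, and the outer minimum with 0 discards it.\<close>
  have "(\<lambda>e xs. min (of_bool (N e xs)) (min 1 (relu (h e xs)))) \<in> plc (tup l) S"
    by (intro plc_min N plc.const plc.relu h(1))
  then show ?thesis
  proof (rule plc.cong)
    fix e xs assume t: "tup l e xs"
    let ?C = "\<lambda>ys. distinct ys \<and> set ys \<inter> set (map ((!) xs) (cs @ av)) = {} \<and> F e (map ((!) xs) cs @ ys)"
    have fin: "finite (tuples (uni e) m)" using t uni_finite by (intro finite_tuples) (simp add: tup_def)
    have count: "count_avoiding ?f cs av m e xs = real (card {ys \<in> tuples (uni e) m. ?C ys})"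
    proof -
      have "count_avoiding ?f cs av m e xs = (\<Sum>ys\<in>tuples (uni e) m. of_bool (?C ys))"
        unfolding count_avoiding_def by (intro sum.cong refl) auto
      also have "\<dots> = real (card {ys \<in> tuples (uni e) m. ?C ys})"
        using fin by (simp add: Int_def)
      finally show ?thesis .
    qed
    show "of_bool (N e xs \<and> (\<exists>ys\<in>tuples (uni e) m. ?C ys)) =
        min (of_bool (N e xs)) (min 1 (relu (h e xs)))"
    proof (cases "N e xs")
      case True
      then have "h e xs = real (card {ys \<in> tuples (uni e) m. ?C ys})"
        using h(2) t N(2) count by simp
      moreover have "card {ys \<in> tuples (uni e) m. ?C ys} = 0 \<longleftrightarrow> \<not> (\<exists>ys\<in>tuples (uni e) m. ?C ys)"
        using fin by auto
      ultimately show ?thesis using True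
        by (cases "card {ys \<in> tuples (uni e) m. ?C ys}") (auto simp: relu_def min_def)
    qed (simp add: relu_def)
  qed
qed

text \<open>One layer counts the objects by summing the constant 1. Tuples of length
  \<open>B\<close> have no aggregation and take the result from a sub-tuple in a second layer; for
  \<open>B = 0\<close> there is nowhere to count.\<close>

lemma cmp_card_ge:
  assumes "0 < B" "r \<le> B"
  shows "(\<lambda>e xs. of_bool (n \<le> card (uni e))) \<in> cmp inp 2 r"
proof -
  have 1: "(\<lambda>e xs. of_bool (n \<le> card (uni e))) \<in> cmp inp 1 r" if "r < B" for r
  proof (rule plc_le_nat)
    show "(\<lambda>e xs. real (card (uni e))) \<in> cmp inp 1 r"
      using cmp_sum[OF plc.const[of 1] that, of inp 0] by simp
  qed (rule plc.const)
  show ?thesis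
  proof (cases "r < B")
    case True
    then show ?thesis using cmp_Suc[OF 1] by (simp add: numeral_2_eq_2)
  next
    case False
    then obtain r' where r': "r = Suc r'" "r' < B" using assms by (cases r) auto
    obtain vs where "vs \<in> set (subtuples r' [0..<Suc r'])"
      using subtuple_exists[of "{..<r'}" "Suc r'" r'] by auto
    from cmp_sub[OF 1[OF r'(2)] this] show ?thesis by (simp add: numeral_2_eq_2 r')
  qed
qed

end

lemma plc_Max_nat:
  assumes "finite I" "\<And>i. i \<in> I \<Longrightarrow> (\<lambda>e x. real (f i e x)) \<in> plc V S"
  shows "(\<lambda>e x. real (Max (insert 0 ((\<lambda>i. f i e x) ` I)))) \<in> plc V S"
  using assms
proof (induction I)
  case empty
  then show ?case using plc.const[of 0] by simp
next
  case (insert i I)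
  then have "(\<lambda>e x. max (real (f i e x)) (real (Max (insert 0 ((\<lambda>i. f i e x) ` I))))) \<in> plc V S"
    by (intro plc_max) auto
  then show ?case
    by (rule plc.cong) (use insert.hyps in \<open>simp add: insert_commute[of 0] of_nat_max\<close>)
qed

section \<open>States of the search, their features and the four kinds of rounds\<close>

datatype 'p feature =
    FDist
  | FAtom "('p, nat) atom"
  | FAge "('p, nat) atom set"
  | FSat "('p, nat) atom set"
  | FBest
  | FCnt "('p, nat) atom set" "('p, nat) atom set" nat

text \<open>\<open>age G\<close> counts the rounds since the search has reached \<open>G\<close>, where \<open>0\<close> means that it has not. The
  atoms of \<open>state\<close> are known to tuples of length at most \<open>radius\<close>. Eventually, \<open>best\<close> is the greatest
  age of a goal set that holds in \<open>state\<close>.\<close>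

record ('p, 'o) search =
  objects :: "'o set"
  state :: "('p, 'o) atom set"
  radius :: nat
  age :: "('p, 'o) atom set \<Rightarrow> nat"
  best :: "'o list \<Rightarrow> nat"
  cnt :: "('p, nat) atom set \<Rightarrow> ('p, nat) atom set \<Rightarrow> nat \<Rightarrow> 'o list \<Rightarrow> real"

text \<open>The condition on the radius stands under the quantifier: so \<open>sat\<close> is a
  conjunction of \<open>FAtom\<close> features, and the empty set holds at tuples of any
  length.\<close>

definition sat :: "('p, 'o) search \<Rightarrow> 'o list \<Rightarrow> ('p, nat) atom set \<Rightarrow> bool" where
  "sat e xs \<Delta> \<longleftrightarrow> (\<forall>A\<in>\<Delta>. length xs \<le> radius e \<and> inst xs A \<in> state e)"

text \<open>\<open>FSat\<close> is not redundant next to \<open>FAge\<close> and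
  \<open>FAtom\<close>: the product of a truth value and an unbounded age cannot be formed by
  weights that do not depend on the number of rounds. Instead the gated age is maintained from the
  beginning, starting from a truth value and increased by one whenever it is positive.\<close>

primrec val :: "'p feature \<Rightarrow> ('p, 'o) search \<Rightarrow> 'o list \<Rightarrow> real" where
  "val FDist = (\<lambda>e xs. of_bool (distinct xs))"
| "val (FAtom A) = (\<lambda>e xs. of_bool (length xs \<le> radius e \<and> inst xs A \<in> state e))"
| "val (FAge \<Gamma>) = (\<lambda>e xs. real (if distinct xs then age e (inst xs ` \<Gamma>) else 0))"
| "val (FSat \<Gamma>) = (\<lambda>e xs. real (if distinct xs \<and> sat e xs \<Gamma> then age e (inst xs ` \<Gamma>) else 0))"
| "val FBest = (\<lambda>e xs. real (best e xs))"
| "val (FCnt \<Gamma> \<Delta> j) = (\<lambda>e xs. cnt e \<Gamma> \<Delta> j xs)"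

context bounded_domain
begin

definition features_of :: "nat \<Rightarrow> 'p feature set" where
  "features_of r = {FDist, FBest} \<union> FAtom ` atoms D {..<r} \<union>
     FAge ` {\<Gamma>. pattern D r \<Gamma>} \<union> FSat ` {\<Gamma>. pattern D r \<Gamma>} \<union>
     {FCnt \<Gamma> \<Delta> j | \<Gamma> \<Delta> j. r + j \<le> B \<and> pattern D (r + j) \<Gamma> \<and> \<Delta> \<subseteq> \<Gamma>}"

lemma finite_patterns: "finite {\<Gamma>. pattern D r \<Gamma>}"
  by (rule finite_subset[of _ "Pow (atoms D {..<r})"]) (auto simp: pattern_def finite_atoms)

lemma finite_features_of: "finite (features_of r)"
proof -
  have "{FCnt \<Gamma> \<Delta> j | \<Gamma> \<Delta> j. r + j \<le> B \<and> pattern D (r + j) \<Gamma> \<and> \<Delta> \<subseteq> \<Gamma>} \<subseteq>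
      (\<lambda>(\<Gamma>, \<Delta>, j). FCnt \<Gamma> \<Delta> j) ` (Pow (atoms D {..<B}) \<times> Pow (atoms D {..<B}) \<times> {..B})"
  proof
    fix \<phi> assume "\<phi> \<in> {FCnt \<Gamma> \<Delta> j | \<Gamma> \<Delta> j. r + j \<le> B \<and> pattern D (r + j) \<Gamma> \<and> \<Delta> \<subseteq> \<Gamma>}"
    then obtain \<Gamma> \<Delta> j where \<phi>: "\<phi> = FCnt \<Gamma> \<Delta> j" "r + j \<le> B" "pattern D (r + j) \<Gamma>" "\<Delta> \<subseteq> \<Gamma>" by blast
    then have "\<Gamma> \<subseteq> atoms D {..<B}" using atoms_mono[of "{..<r + j}" "{..<B}" D] by (auto simp: pattern_def)
    with \<phi> show "\<phi> \<in> (\<lambda>(\<Gamma>, \<Delta>, j). FCnt \<Gamma> \<Delta> j) ` (Pow (atoms D {..<B}) \<times> Pow (atoms D {..<B}) \<times> {..B})"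
      by (intro image_eqI[of _ _ "(\<Gamma>, \<Delta>, j)"]) auto
  qed
  then show ?thesis unfolding features_of_def
    using finite_patterns finite_atoms
    by (auto intro!: finite_atoms finite_imageI intro: finite_subset)
qed

definition features_list :: "nat \<Rightarrow> 'p feature list" where
  "features_list r = (SOME l. set l = features_of r)"

lemma set_features_list: "set (features_list r) = features_of r"
  unfolding features_list_def by (rule someI_ex[OF finite_list[OF finite_features_of]])

definition feats :: "nat \<Rightarrow> (('p, 'o) search \<Rightarrow> 'o list \<Rightarrow> real) list" where
  "feats r = map val (features_list r)"

definition wf_search :: "('p, 'o) search \<Rightarrow> bool" where
  "wf_search e \<longleftrightarrow> finite (objects e) \<and> objects e \<noteq> {} \<and> \<beta> \<le> radius e \<and>
     (\<forall>G. age e G > 0 \<longrightarrow> G \<subseteq> atoms D (objects e) \<and> card (objs G) \<le> B)"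

definition grow :: "('p, 'o) search \<Rightarrow> ('p, 'o) search" where
  "grow e = e\<lparr>radius := Suc (radius e)\<rparr>"

text \<open>Only sets reached in the round before (age 1) are expanded, older ones have been
  expanded already. Sets with more than \<open>B\<close> objects have no tuple to be stored at and
  are dropped; \<open>final_correct\<close> shows that this happens too late to matter.\<close>

definition fresh :: "('p, 'o) search \<Rightarrow> ('p, 'o) atom set \<Rightarrow> bool" where
  "fresh e G \<longleftrightarrow> card (objs G) \<le> B \<and>
     (\<exists>G\<^sub>0. age e G\<^sub>0 = 1 \<and> (\<exists>a\<in>ground_actions D (objects e). applicable D G\<^sub>0 a \<and> regress D G\<^sub>0 a = G))"

definition expand :: "('p, 'o) search \<Rightarrow> ('p, 'o) search" where
  "expand e = e\<lparr>age := \<lambda>G. if age e G > 0 then Suc (age e G) else of_bool (fresh e G)\<rparr>"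

definition local_best :: "('p, 'o) search \<Rightarrow> 'o list \<Rightarrow> nat" where
  "local_best e xs = Max (insert 0 ((\<lambda>\<Gamma>. if distinct xs \<and> sat e xs \<Gamma> then age e (inst xs ` \<Gamma>) else 0) `
     {\<Gamma>. pattern D (length xs) \<Gamma>}))"

text \<open>There is no global register. A value travels from a tuple to the empty one by maxima
  over the last object, and from there to all tuples through \<open>butlast\<close>.\<close>

definition spread :: "('p, 'o) search \<Rightarrow> ('p, 'o) search" where
  "spread e = e\<lparr>best := \<lambda>xs. max (max (best e xs) (local_best e xs))
     (max (if xs = [] then 0 else best e (butlast xs))
       (if length xs < B then Max ((\<lambda>x. best e (xs @ [x])) ` objects e) else 0))\<rparr>"

definition tally :: "('p, 'o) search \<Rightarrow> ('p, 'o) search" where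
  "tally e = e\<lparr>cnt := \<lambda>\<Gamma> \<Delta> j xs. case j of
       0 \<Rightarrow> of_bool (distinct xs \<and> age e (inst xs ` \<Gamma>) = Suc (best e xs) \<and> sat e xs \<Delta>)
     | Suc i \<Rightarrow> \<Sum>x\<in>objects e. cnt e \<Gamma> \<Delta> i (xs @ [x])\<rparr>"

lemma wf_search_grow: "wf_search e \<Longrightarrow> wf_search (grow e)"
  by (auto simp: wf_search_def grow_def)

lemma fresh_subset: "wf_search e \<Longrightarrow> fresh e G \<Longrightarrow> G \<subseteq> atoms D (objects e) \<and> card (objs G) \<le> B"
proof (intro conjI)
  assume e: "wf_search e" and "fresh e G"
  then obtain G\<^sub>0 a where "age e G\<^sub>0 = 1" "a \<in> ground_actions D (objects e)" "regress D G\<^sub>0 a = G"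
    unfolding fresh_def by blast
  moreover from this(1) e have "G\<^sub>0 \<subseteq> atoms D (objects e)" by (simp add: wf_search_def)
  ultimately show "G \<subseteq> atoms D (objects e)" using regress_in_atoms[OF wf] by blast
qed (simp add: fresh_def)

lemma wf_search_expand: "wf_search e \<Longrightarrow> wf_search (expand e)"
proof -
  assume e: "wf_search e"
  have "G \<subseteq> atoms D (objects e) \<and> card (objs G) \<le> B" if "0 < age (expand e) G" for G
    using that e fresh_subset[OF e, of G]
    by (cases "age e G = 0"; cases "fresh e G") (simp_all add: expand_def wf_search_def)
  with e show ?thesis by (simp add: wf_search_def expand_def)
qed

lemma wf_search_spread: "wf_search e \<Longrightarrow> wf_search (spread e)"
  by (auto simp: wf_search_def spread_def)

lemma wf_search_tally: "wf_search e \<Longrightarrow> wf_search (tally e)"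
  by (auto simp: wf_search_def tally_def)

lemma card_objs_pattern:
  assumes "pattern D r \<Gamma>" "distinct xs" "length xs = r"
  shows "card (objs (inst xs ` \<Gamma>)) = r"
proof -
  have "objs (inst xs ` \<Gamma>) = set xs"
    using assms by (auto simp: inst_eq_rename objs_rename pattern_def set_conv_nth)
  then show ?thesis using assms by (simp add: distinct_card)
qed

end

section \<open>Each kind of round is computable by a block of layers\<close>

locale search_net = bounded_domain D \<beta> \<alpha> B + relnet objects valid B
  for D :: "('p, 'a) domain" and \<beta> \<alpha> B :: nat and valid :: "('p, 'o) search \<Rightarrow> bool" +
  assumes valid_wf: "valid e \<Longrightarrow> wf_search e"
begin

lemma val_cmp: "\<phi> \<in> features_of r \<Longrightarrow> val \<phi> \<in> cmp feats d r"
  by (rule cmp_mono[of 0]) (auto simp: feats_def set_features_list intro: plc.base)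

lemma dist_cmp: "(\<lambda>e xs. of_bool (distinct xs)) \<in> cmp feats d r"
  using val_cmp[of FDist r d] by (simp add: features_of_def)

lemma best_cmp: "(\<lambda>e xs. real (best e xs)) \<in> cmp feats d r"
  using val_cmp[of FBest r d] by (simp add: features_of_def)

lemma age_cmp: "pattern D r \<Gamma> \<Longrightarrow> (\<lambda>e xs. real (if distinct xs then age e (inst xs ` \<Gamma>) else 0)) \<in> cmp feats d r"
  using val_cmp[of "FAge \<Gamma>" r d] by (simp only: val.simps) (simp add: features_of_def)

lemma sat_cmp:
  assumes "\<Delta> \<subseteq> atoms D {..<r}"
  shows "(\<lambda>e xs. of_bool (sat e xs \<Delta>)) \<in> cmp feats d r"
  unfolding sat_def
proof (rule plc_ball)
  show "finite \<Delta>" using assms finite_atoms finite_subset by blast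
  fix A assume "A \<in> \<Delta>"
  then have "FAtom A \<in> features_of r" using assms by (auto simp: features_of_def)
  from val_cmp[OF this] show "(\<lambda>e xs. of_bool (length xs \<le> radius e \<and> inst xs A \<in> state e)) \<in> cmp feats d r"
    by simp
qed

lemma age_eq_cmp:
  assumes "pattern D r \<Gamma>" "(\<lambda>e xs. real (n e xs)) \<in> cmp feats d r"
  shows "(\<lambda>e xs. of_bool (distinct xs \<and> age e (inst xs ` \<Gamma>) = Suc (n e xs))) \<in> cmp feats d r"
proof -
  have "(\<lambda>e xs. 1 + real (n e xs)) \<in> cmp feats d r" by (intro plc.add plc.const assms)
  then have "(\<lambda>e xs. of_bool ((if distinct xs then age e (inst xs ` \<Gamma>) else 0) = Suc (n e xs))) \<in> cmp feats d r"
    by (intro plc_eq_nat age_cmp assms) (simp add: add.commute)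
  then show ?thesis by (rule plc.cong) auto
qed

text \<open>An atom over a tuple longer than \<beta> leaves out some position, so the sub-tuple
  without that position knows the atom already: the radius grows by one. \<open>FSat\<close> must
  not change on the way; it does not, because before the expansion starts a goal set with an age has
  at most \<beta> objects, and its tuples are within the radius from the outset.\<close>

lemma grow_cmp:
  assumes small: "\<And>e G. valid e \<Longrightarrow> age e G > 0 \<Longrightarrow> card (objs G) \<le> \<beta>"
    and \<phi>: "\<phi> \<in> features_of r" and r: "r \<le> B"
  shows "(\<lambda>e. val \<phi> (grow e)) \<in> cmp feats 1 r"
proof -
  have same: ?thesis if "\<And>e xs. tup r e xs \<Longrightarrow> val \<phi> (grow e) xs = val \<phi> e xs"
    by (rule plc.cong[OF val_cmp[OF \<phi>]]) (rule that)
  have atom: "(\<lambda>e. val (FAtom A) (grow e)) \<in> cmp feats 1 r" if A: "A \<in> atoms D {..<r}" for A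
  proof (cases "r \<le> \<beta>")
    case True
    have "val (FAtom A) \<in> cmp feats 1 r" using A by (intro val_cmp) (simp add: features_of_def)
    then show ?thesis
    proof (rule plc.cong)
      fix e xs assume "tup r e xs"
      then have "length xs \<le> radius e" using True valid_wf[of e] by (simp add: tup_def wf_search_def)
      then show "val (FAtom A) (grow e) xs = val (FAtom A) e xs" by (simp add: grow_def)
    qed
  next
    case False
    obtain p vs where pv: "A = (p, vs)" by (cases A)
    then have p: "p \<in> set (preds D)" "length vs = pred_arity D p" "set vs \<subseteq> {..<r}"
      using A by (auto simp: atoms_def)
    have "card (set vs) < card {..<r}"
      using card_length[of vs] p arity[of p] False by simp
    then obtain i where i: "i < r" "i \<notin> set vs"
      by (metis List.finite_set card_mono leD lessThan_iff subsetI)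
    obtain r' where r': "r = Suc r'" using i by (cases r) auto
    obtain us where us: "us \<in> set (subtuples r' [0..<Suc r'])" "length us = r'" "set us = {..<Suc r'} - {i}"
      using subtuple_exists[of "{..<Suc r'} - {i}" "Suc r'" r'] i r' by auto
    obtain ps where ps: "map ((!) us) ps = vs" "set ps \<subseteq> {..<r'}"
      using factor_through_nth[of vs us] us i p r' by auto
    have "(p, ps) \<in> atoms D {..<r'}" using p ps length_map[of "(!) us" ps] by (auto simp: atoms_def)
    then have "val (FAtom (p, ps)) \<in> cmp feats 0 r'" by (intro val_cmp) (simp add: features_of_def)
    from cmp_sub[OF this us(1)]
    have "(\<lambda>e xs. val (FAtom (p, ps)) e (map ((!) xs) us)) \<in> cmp feats 1 r" by (simp add: r')
    then show ?thesis
    proof (rule plc.cong)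
      fix e xs assume "tup r e xs"
      then have "length xs = r" by (simp add: tup_def)
      moreover have "map ((!) (map ((!) xs) us)) ps = map ((!) xs) vs"
        using map_nth_map[of ps us "(!) xs"] ps us by simp
      ultimately show "val (FAtom A) (grow e) xs = val (FAtom (p, ps)) e (map ((!) xs) us)"
        using us by (simp add: grow_def pv inst_def r')
    qed
  qed
  have sat: "val (FSat \<Gamma>) (grow e) xs = val (FSat \<Gamma>) e xs" if \<Gamma>: "pattern D r \<Gamma>" and t: "tup r e xs" for \<Gamma> e xs
  proof (cases "distinct xs \<and> age e (inst xs ` \<Gamma>) > 0")
    case True
    then have "r \<le> \<beta>"
      using small[of e "inst xs ` \<Gamma>"] card_objs_pattern[OF \<Gamma>, of xs] t by (simp add: tup_def)
    then have "length xs \<le> radius e" using valid_wf[of e] t by (auto simp: tup_def wf_search_def)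
    then show ?thesis by (auto simp: grow_def sat_def)
  qed (auto simp: grow_def)
  show ?thesis
  proof (cases \<phi>)
    case (FAtom A)
    then show ?thesis using atom \<phi> by (auto simp: features_of_def)
  next
    case (FSat \<Gamma>)
    then have "pattern D r \<Gamma>" using \<phi> by (auto simp: features_of_def)
    then show ?thesis using sat FSat by (intro same) auto
  qed (rule same, simp add: grow_def)+
qed

text \<open>At most \<alpha> layers produce the sums. Dropping positions costs at most \<alpha> + 1
  more, because \<open>r\<close> exceeds \<open>length cs\<close> by at most \<alpha>. The bound
  also leaves room for the two layers of \<open>cmp_card_ge\<close> when \<alpha> is 0.\<close>

lemma step_type_cmp:
  assumes type: "(cs, m, \<Gamma>, k, a) \<in> step_types r \<Gamma>'" and r: "r \<le> B"
  shows "(\<lambda>e xs. of_bool ((distinct xs \<and> (B = 0 \<or> r + m + k \<le> card (objects e))) \<and>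
      (\<exists>ys\<in>tuples (objects e) m. distinct ys \<and> set ys \<inter> set xs = {} \<and>
        age e (inst (map ((!) xs) cs @ ys) ` \<Gamma>) = 1))) \<in> cmp feats (2 * \<alpha> + 2) r"
proof -
  have cs: "distinct cs" "set cs \<subseteq> {..<r}" "length cs + m \<le> B" "m \<le> \<alpha>" "r \<le> length cs + \<alpha>"
    and \<Gamma>: "pattern D (length cs + m) \<Gamma>" using type by (auto simp: step_types_def)
  obtain av where av: "distinct av" "set av = {..<r} - set cs"
    using finite_distinct_list[of "{..<r} - set cs"] by auto
  have all: "set (cs @ av) = {..<r}" using av(2) cs(2) by auto
  let ?F = "\<lambda>e ws. distinct ws \<and> age e (inst ws ` \<Gamma>) = Suc 0"
  have "(\<lambda>e xs. of_bool ((distinct xs \<and> (B = 0 \<or> r + m + k \<le> card (objects e))) \<and>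
      (\<exists>ys\<in>tuples (objects e) m. distinct ys \<and> set ys \<inter> set (map ((!) xs) (cs @ av)) = {} \<and>
        ?F e (map ((!) xs) cs @ ys)))) \<in> cmp feats (2 * \<alpha> + 2) r"
  \<comment> \<open>The budget \<open>d + m \<le> \<alpha>\<close> is invariant: a permutation costs
    one layer but turns one summed argument into a fixed one, and summing the remaining
    \<open>m\<close> costs \<open>m\<close> layers.\<close>
  proof (rule exists_avoiding[where d' = "\<alpha>" and F = ?F and
      \<F> = "\<lambda>q m. {f. \<exists>d. f \<in> cmp feats d (q + m) \<and> d + m \<le> \<alpha>}"])
    have "(\<lambda>e ws. of_bool (?F e ws)) \<in> cmp feats 0 (length cs + m)"
      by (rule age_eq_cmp[OF \<Gamma>]) (use plc.const[of 0] in simp)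
    with cs(4) show "(\<lambda>e ws. of_bool (?F e ws)) \<in> {f. \<exists>d. f \<in> cmp feats d (length cs + m) \<and> d + m \<le> \<alpha>}"
      by (intro CollectI exI[of _ 0] conjI) (simp_all only: add_0)
    show "(\<lambda>e xs. \<Sum>ys\<in>tuples (objects e) m. f e (xs @ ys)) \<in> cmp feats \<alpha> q"
      if "f \<in> {f. \<exists>d. f \<in> cmp feats d (q + m) \<and> d + m \<le> \<alpha>}" "q + m \<le> B" for f q m
    proof -
      obtain d where d: "f \<in> cmp feats d (q + m)" "d + m \<le> \<alpha>" using \<open>f \<in> _\<close> by blast
      show ?thesis by (rule cmp_mono[OF d(2) cmp_sum_tuples[OF d(1) \<open>q + m \<le> B\<close>]])
    qed
    show "(\<lambda>e xs. f e (map ((!) xs) vs)) \<in> {f. \<exists>d. f \<in> cmp feats d (Suc q + m) \<and> d + m \<le> \<alpha>}"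
      if f: "f \<in> {f. \<exists>d. f \<in> cmp feats d (q + Suc m) \<and> d + Suc m \<le> \<alpha>}"
        and vs: "distinct vs" "length vs = q + Suc m" "set vs = {..<q + Suc m}" for f q m vs
    proof -
      obtain d where d: "f \<in> cmp feats d (q + Suc m)" "d + Suc m \<le> \<alpha>" using f by blast
      from cmp_perm[OF d(1) vs(1,2)] vs(3)
      have "(\<lambda>e xs. f e (map ((!) xs) vs)) \<in> cmp feats (Suc d) (Suc q + m)" by simp
      with d(2) show ?thesis by (intro CollectI exI[of _ "Suc d"]) simp
    qed
    show "distinct (cs @ av)" using cs av by auto
    show "set (cs @ av) \<subseteq> {..<r}" using all by simp
    show "(\<lambda>e xs. g e (map ((!) xs) cs')) \<in> cmp feats (2 * \<alpha> + 2) r"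
      if "length cs \<le> length cs'" "distinct cs'" "set cs' \<subseteq> {..<r}" "g \<in> cmp feats (\<alpha>) (length cs')" for g cs'
      by (rule cmp_reindex[OF that(4,2) refl that(3)]) (use that(1) cs(5) in simp)
    show "(\<lambda>e xs. of_bool (distinct xs \<and> (B = 0 \<or> r + m + k \<le> card (objects e)))) \<in> cmp feats (2 * \<alpha> + 2) r"
    proof (cases "B = 0")
      case True
      then show ?thesis using dist_cmp by simp
    next
      case False
      then have "(\<lambda>e xs. of_bool (r + m + k \<le> card (objects e))) \<in> cmp feats (2 * \<alpha> + 2) r"
        using r by (intro cmp_mono[OF _ cmp_card_ge]) auto
      from plc_conj[OF dist_cmp this] False show ?thesis by simp
    qed
    show "distinct (map ((!) xs) (cs @ av))"
      if "tup r e xs" "distinct xs \<and> (B = 0 \<or> r + m + k \<le> card (objects e))" for e xs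
    proof -
      have "distinct (cs @ av)" using cs(1) av by auto
      moreover have "inj_on ((!) xs) (set (cs @ av))"
        unfolding all using that by (intro inj_on_nth) (auto simp: tup_def)
      ultimately show ?thesis unfolding distinct_map by simp
    qed
  qed (use cs in auto)
  then show ?thesis
  proof (rule plc.cong)
    fix e xs assume t: "tup r e xs"
    then have "set (map ((!) xs) (cs @ av)) = set xs"
      unfolding set_map all by (auto simp: tup_def set_conv_nth)
    moreover have "distinct (map ((!) xs) cs @ ys)" if "distinct xs" "distinct ys" "set ys \<inter> set xs = {}" for ys
    proof -
      have "set (map ((!) xs) cs) \<subseteq> set xs" using cs(2) t by (auto simp: tup_def subset_iff)
      moreover have "distinct (map ((!) xs) cs)"
        using that(1) cs(1,2) t by (auto simp: distinct_map tup_def intro!: inj_on_nth)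
      ultimately show ?thesis using that by auto
    qed
    ultimately show "of_bool ((distinct xs \<and> (B = 0 \<or> r + m + k \<le> card (objects e))) \<and>
      (\<exists>ys\<in>tuples (objects e) m. distinct ys \<and> set ys \<inter> set xs = {} \<and>
        age e (inst (map ((!) xs) cs @ ys) ` \<Gamma>) = 1)) =
      (of_bool ((distinct xs \<and> (B = 0 \<or> r + m + k \<le> card (objects e))) \<and>
      (\<exists>ys\<in>tuples (objects e) m. distinct ys \<and> set ys \<inter> set (map ((!) xs) (cs @ av)) = {} \<and>
        ?F e (map ((!) xs) cs @ ys))) :: real)"
      unfolding of_bool_eq_iff One_nat_def by (simp only:) blast
  qed
qed

lemma fresh_cmp:
  assumes \<Gamma>': "pattern D r \<Gamma>'" and r: "r \<le> B"
  shows "(\<lambda>e xs. of_bool (distinct xs \<and> fresh e (inst xs ` \<Gamma>'))) \<in> cmp feats (2 * \<alpha> + 2) r"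
proof -
  let ?P = "\<lambda>(cs, m, \<Gamma>, k, a) e xs. (distinct xs \<and> (B = 0 \<or> r + m + k \<le> card (objects e))) \<and>
      (\<exists>ys\<in>tuples (objects e) m. distinct ys \<and> set ys \<inter> set xs = {} \<and>
        age e (inst (map ((!) xs) cs @ ys) ` \<Gamma>) = 1)"
  have "(\<lambda>e xs. of_bool (\<exists>\<tau>\<in>step_types r \<Gamma>'. ?P \<tau> e xs)) \<in> cmp feats (2 * \<alpha> + 2) r"
  proof (rule plc_bex[OF finite_step_types])
    fix \<tau> assume \<tau>: "\<tau> \<in> step_types r \<Gamma>'"
    obtain cs m \<Gamma> k a where "\<tau> = (cs, m, \<Gamma>, k, a)" by (cases \<tau>)
    with step_type_cmp[of cs m \<Gamma> k a r \<Gamma>'] \<tau> r show "(\<lambda>e xs. of_bool (?P \<tau> e xs)) \<in> cmp feats (2 * \<alpha> + 2) r"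
      by simp
  qed
  then show ?thesis
  proof (rule plc.cong)
    fix e xs assume t: "tup r e xs"
    then have e: "finite (objects e)" "objects e \<noteq> {}" "length xs = r" "set xs \<subseteq> objects e"
      and age: "\<And>G. age e G = 1 \<Longrightarrow> G \<subseteq> atoms D (objects e) \<and> card (objs G) \<le> B"
      using valid_wf[of e] by (auto simp: tup_def wf_search_def)
    have "(\<exists>\<tau>\<in>step_types r \<Gamma>'. ?P \<tau> e xs) \<longleftrightarrow> distinct xs \<and> fresh e (inst xs ` \<Gamma>')"
    proof
      assume "\<exists>\<tau>\<in>step_types r \<Gamma>'. ?P \<tau> e xs"
      then obtain cs m \<Gamma> k a ys where \<tau>: "(cs, m, \<Gamma>, k, a) \<in> step_types r \<Gamma>'"
        "distinct xs" "B = 0 \<or> r + m + k \<le> card (objects e)"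
        "ys \<in> tuples (objects e) m" "distinct ys" "set ys \<inter> set xs = {}"
        "age e (inst (map ((!) xs) cs @ ys) ` \<Gamma>) = 1" by auto
      then show "distinct xs \<and> fresh e (inst xs ` \<Gamma>')"
        using step_type_sound[OF \<tau>(1) \<Gamma>' e(1,2) \<tau>(2) e(3,4) r \<tau>(5) _ _ \<tau>(6,3)] card_objs_pattern[OF \<Gamma>' \<tau>(2) e(3)] r
        unfolding fresh_def tuples_def by auto
    next
      assume fr: "distinct xs \<and> fresh e (inst xs ` \<Gamma>')"
      then obtain G a where G: "age e G = 1" "a \<in> ground_actions D (objects e)" "applicable D G a"
        "regress D G a = inst xs ` \<Gamma>'" unfolding fresh_def by blast
      obtain cs m \<Gamma> k a' ys where \<tau>: "(cs, m, \<Gamma>, k, a') \<in> step_types r \<Gamma>'"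
        "distinct ys" "length ys = m" "set ys \<subseteq> objects e" "set ys \<inter> set xs = {}"
        "inst (map ((!) xs) cs @ ys) ` \<Gamma> = G" "B = 0 \<or> r + m + k \<le> card (objects e)"
        using step_type_complete[OF G(2,3,4) _ _ \<Gamma>' e(1,2) _ e(3,4) r] age[OF G(1)] fr by metis
      have "?P (cs, m, \<Gamma>, k, a') e xs"
        using \<tau> G(1) fr by (auto simp: tuples_def intro!: bexI[of _ ys])
      with \<tau>(1) show "\<exists>\<tau>\<in>step_types r \<Gamma>'. ?P \<tau> e xs" by blast
    qed
    then show "of_bool (distinct xs \<and> fresh e (inst xs ` \<Gamma>')) = (of_bool (\<exists>\<tau>\<in>step_types r \<Gamma>'. ?P \<tau> e xs) :: real)"
      by simp
  qed
qed

lemma expand_cmp: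
  assumes \<phi>: "\<phi> \<in> features_of r" and r: "r \<le> B"
  shows "(\<lambda>e. val \<phi> (expand e)) \<in> cmp feats (2 * \<alpha> + 2) r"
proof -
  have same: ?thesis if "\<And>(e :: ('p, 'o) search) xs. val \<phi> (expand e) xs = val \<phi> e xs"
    by (rule plc.cong[OF val_cmp[OF \<phi>]]) (rule that)
  \<comment> \<open>For a natural number \<open>f\<close> and a truth value \<open>b\<close> this is
    \<open>f + 1\<close> if \<open>f\<close> is positive and \<open>b\<close> if \<open>f\<close> is
    0, which is how ages are updated.\<close>
  have upd: "(\<lambda>e xs. f e xs + min 1 (f e xs) + relu (b e xs - min 1 (f e xs))) \<in> cmp feats (2 * \<alpha> + 2) r"
    if "f \<in> cmp feats (2 * \<alpha> + 2) r" "b \<in> cmp feats (2 * \<alpha> + 2) r" for f b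
    by (intro plc.add plc_min plc.const plc.relu plc_diff that)
  show ?thesis
  proof (cases \<phi>)
    case (FAge \<Gamma>)
    then have \<Gamma>: "pattern D r \<Gamma>" using \<phi> by (auto simp: features_of_def)
    from upd[OF age_cmp[OF \<Gamma>] fresh_cmp[OF \<Gamma> r]] show ?thesis
      by (rule plc.cong) (auto simp: FAge expand_def relu_def)
  next
    case (FSat \<Gamma>)
    then have \<Gamma>: "pattern D r \<Gamma>" using \<phi> by (auto simp: features_of_def)
    have "(\<lambda>e xs. of_bool ((distinct xs \<and> fresh e (inst xs ` \<Gamma>)) \<and> sat e xs \<Gamma>)) \<in> cmp feats (2 * \<alpha> + 2) r"
      using \<Gamma> r by (intro plc_conj[OF fresh_cmp] sat_cmp) (auto simp: pattern_def)
    from upd[OF val_cmp[OF \<phi>] this] show ?thesis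
      by (rule plc.cong) (auto simp: FSat expand_def relu_def sat_def)
  qed (rule same, simp add: expand_def)+
qed

lemma spread_cmp:
  assumes \<phi>: "\<phi> \<in> features_of r" and r: "r \<le> B"
  shows "(\<lambda>e. val \<phi> (spread e)) \<in> cmp feats 1 r"
proof -
  have same: ?thesis if "\<And>(e :: ('p, 'o) search) xs. val \<phi> (spread e) xs = val \<phi> e xs"
    by (rule plc.cong[OF val_cmp[OF \<phi>]]) (rule that)
  have "(\<lambda>e xs. real (best (spread e) xs)) \<in> cmp feats 1 r"
  proof -
    have 1: "(\<lambda>e xs. real (local_best e xs)) \<in> cmp feats 1 r"
    proof -
      have "(\<lambda>e xs. real (Max (insert 0 ((\<lambda>\<Gamma>. if distinct xs \<and> sat e xs \<Gamma> then age e (inst xs ` \<Gamma>) else 0) `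
          {\<Gamma>. pattern D r \<Gamma>})))) \<in> cmp feats 1 r"
      proof (rule plc_Max_nat[OF finite_patterns])
        fix \<Gamma> assume "\<Gamma> \<in> {\<Gamma>. pattern D r \<Gamma>}"
        then have "FSat \<Gamma> \<in> features_of r" by (auto simp: features_of_def)
        from val_cmp[OF this] show "(\<lambda>e xs. real (if distinct xs \<and> sat e xs \<Gamma> then age e (inst xs ` \<Gamma>) else 0)) \<in> cmp feats 1 r"
          by (simp only: val.simps)
      qed
      then show ?thesis by (rule plc.cong) (simp add: local_best_def tup_def)
    qed
    have 2: "(\<lambda>e xs. real (if xs = [] then 0 else best e (butlast xs))) \<in> cmp feats 1 r"
    proof (cases r)
      case 0
      show ?thesis by (rule plc.cong[OF plc.const[of 0]]) (simp add: tup_def 0)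
    next
      case (Suc r')
      have "[0..<r'] \<in> set (subtuples r' [0..<Suc r'])"
        by (simp add: set_subtuples prefix_imp_subseq)
      with best_cmp have "(\<lambda>e xs. real (best e (map ((!) xs) [0..<r']))) \<in> cmp feats (Suc 0) (Suc r')"
        by (rule cmp_sub)
      then show ?thesis unfolding Suc One_nat_def
      proof (rule plc.cong)
        fix e xs assume "tup (Suc r') e xs"
        then have len: "length xs = Suc r'" by (simp add: tup_def)
        then have "map ((!) xs) [0..<r'] = butlast xs"
          by (intro nth_equalityI) (auto simp: nth_butlast)
        then show "real (if xs = [] then 0 else best e (butlast xs)) = real (best e (map ((!) xs) [0..<r']))"
          using len by auto
      qed
    qed
    have 3: "(\<lambda>e xs. real (if length xs < B then Max ((\<lambda>x. best e (xs @ [x])) ` objects e) else 0)) \<in> cmp feats 1 r"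
    proof (cases "r < B")
      case True
      have "(\<lambda>e xs. Max ((\<lambda>x. real (best e (xs @ [x]))) ` objects e)) \<in> cmp feats 1 r"
        using cmp_Max[OF best_cmp True, of 0] by simp
      then show ?thesis
      proof (rule plc.cong)
        fix e xs assume "tup r e xs"
        then have "length xs < B" "finite (objects e)" "objects e \<noteq> {}"
          using True uni_finite uni_nonempty by (auto simp: tup_def)
        moreover have "mono real" by (auto intro: monoI)
        ultimately show "real (if length xs < B then Max ((\<lambda>x. best e (xs @ [x])) ` objects e) else 0) =
            Max ((\<lambda>x. real (best e (xs @ [x]))) ` objects e)"
          using mono_Max_commute[of real "(\<lambda>x. best e (xs @ [x])) ` objects e"] by (simp add: image_image)
      qed
    next
      case False
      show ?thesis by (rule plc.cong[OF plc.const[of 0]]) (use False in \<open>simp add: tup_def\<close>)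
    qed
    show ?thesis
      using plc_max[OF plc_max[OF best_cmp 1] plc_max[OF 2 3]]
      by (rule plc.cong) (simp only: spread_def search.select_convs search.update_convs search.surjective of_nat_max, simp add: of_nat_max)
  qed
  note best = this
  show ?thesis
  proof (cases \<phi>)
    case FBest
    then show ?thesis using best by simp
  qed (rule same, simp add: spread_def sat_def)+
qed

lemma tally_cmp:
  assumes \<phi>: "\<phi> \<in> features_of r" and r: "r \<le> B"
  shows "(\<lambda>e. val \<phi> (tally e)) \<in> cmp feats 1 r"
proof -
  have same: ?thesis if "\<And>(e :: ('p, 'o) search) xs. val \<phi> (tally e) xs = val \<phi> e xs"
    by (rule plc.cong[OF val_cmp[OF \<phi>]]) (rule that)
  show ?thesis
  proof (cases \<phi>)
    case (FCnt \<Gamma> \<Delta> j)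
    then have \<Gamma>: "r + j \<le> B" "pattern D (r + j) \<Gamma>" "\<Delta> \<subseteq> \<Gamma>" using \<phi> by (auto simp: features_of_def)
    show ?thesis
    proof (cases j)
      case 0
      then have "pattern D r \<Gamma>" "\<Delta> \<subseteq> atoms D {..<r}" using \<Gamma> by (auto simp: pattern_def)
      then have "(\<lambda>e xs. of_bool ((distinct xs \<and> age e (inst xs ` \<Gamma>) = Suc (best e xs)) \<and> sat e xs \<Delta>)) \<in> cmp feats 1 r"
        by (intro plc_conj age_eq_cmp best_cmp sat_cmp)
      then show ?thesis by (simp add: FCnt 0 tally_def)
    next
      case (Suc i)
      have "FCnt \<Gamma> \<Delta> i \<in> features_of (Suc r)" using \<Gamma> Suc by (auto simp: features_of_def)
      from cmp_sum[OF val_cmp[OF this, of 0]] \<Gamma>(1) Suc show ?thesis by (simp add: FCnt tally_def)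
    qed
  qed (rule same, simp add: tally_def sat_def)+
qed

end

section \<open>Computing the initial search state from the input\<close>

context relnet
begin

text \<open>A repeated argument is eliminated by summing over the object at the second occurrence, which is
  forced to equal the first one.\<close>

lemma cmp_reindex_any:
  assumes "(\<lambda>e ws. of_bool (P e ws)) \<in> cmp inp d (length vs)" "set vs \<subseteq> {..<r}" "length vs \<le> B"
    and eq: "\<And>q i j. j < q \<Longrightarrow> i < j \<Longrightarrow> (\<lambda>e ws. of_bool (ws ! j = ws ! i)) \<in> cmp inp 0 q"
  shows "(\<lambda>e xs. of_bool (P e (map ((!) xs) vs))) \<in> cmp inp (d + 2 * length vs + r + 1) r"
  using assms(1-3)
proof (induction "length vs" arbitrary: vs P d rule: less_induct)
  case less
  show ?case
  proof (cases "distinct vs")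
    case True
    show ?thesis
      by (rule cmp_reindex[OF less.prems(1) True refl less.prems(2)]) simp
  next
    case False
    then obtain as bs cs y where vs: "vs = as @ [y] @ bs @ [y] @ cs"
      using not_distinct_decomp by blast
    define q where "q = length (as @ [y] @ bs @ cs)"
    define i where "i = length as"
    define j where "j = length (as @ [y] @ bs)"
    have ij: "i < j" "j \<le> q" "length vs = Suc q" by (auto simp: i_def j_def q_def vs)
    \<comment> \<open>\<open>ps\<close> inserts the last object of a tuple, the one to be summed
      over, at position \<open>j\<close>.\<close>
    define ps where "ps = [0..<j] @ q # [j..<q]"
    have ps: "distinct ps" "length ps = Suc q" "set ps \<subseteq> {..<Suc q}"
      using ij by (auto simp: ps_def simp del: upt_Suc)
    have ins: "map ((!) (ws @ [x])) ps = take j ws @ x # drop j ws" if "length ws = q" for ws x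
    proof -
      have "map ((!) (ws @ [x])) [0..<j] = take j ws"
        using that ij by (intro nth_equalityI) (auto simp: nth_append)
      moreover have "map ((!) (ws @ [x])) [j..<q] = drop j ws"
        using that ij by (intro nth_equalityI) (auto simp: nth_append)
      moreover have "(ws @ [x]) ! q = x" using that by (simp add: nth_append)
      ultimately show ?thesis by (simp add: ps_def)
    qed
    define P' where "P' e ws = P e (take j ws @ ws ! i # drop j ws)" for e ws
    have "(\<lambda>e ws. of_bool (P e ws \<and> ws ! j = ws ! i)) \<in> cmp inp d (Suc q)"
      using less.prems(1) ij by (intro plc_conj cmp_mono[OF _ eq]) auto
    \<comment> \<open>Exactly one object satisfies the equation, so the sum has one relevant term.
      Each removed repetition costs two layers, one for the permutation and one for the sum; hence
      the \<open>2 * length vs\<close>.\<close>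
    from cmp_sum[OF cmp_perm[OF this ps]] ij(3) less.prems(3)
    have "(\<lambda>e ws. \<Sum>x\<in>uni e. of_bool (P e (map ((!) (ws @ [x])) ps) \<and>
        map ((!) (ws @ [x])) ps ! j = map ((!) (ws @ [x])) ps ! i)) \<in> cmp inp (Suc (Suc d)) q"
      by simp
    then have "(\<lambda>e ws. of_bool (P' e ws)) \<in> cmp inp (Suc (Suc d)) q"
    proof (rule plc.cong)
      fix e ws assume t: "tup q e ws"
      then have len: "length ws = q" and fin: "finite (uni e)" and i: "ws ! i \<in> uni e"
        using ij uni_finite by (auto simp: tup_def subset_iff)
      have "(\<Sum>x\<in>uni e. of_bool (P e (map ((!) (ws @ [x])) ps) \<and>
          map ((!) (ws @ [x])) ps ! j = map ((!) (ws @ [x])) ps ! i)) =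
        (\<Sum>x\<in>uni e. if x = ws ! i then of_bool (P' e ws) else 0 :: real)"
        using ij len by (intro sum.cong refl) (auto simp: ins P'_def nth_append min_def)
      also have "\<dots> = of_bool (P' e ws)" using fin i by (simp only: sum.delta if_True)
      finally show "of_bool (P' e ws) = (\<Sum>x\<in>uni e. of_bool (P e (map ((!) (ws @ [x])) ps) \<and>
          map ((!) (ws @ [x])) ps ! j = map ((!) (ws @ [x])) ps ! i) :: real)"
        by (rule sym)
    qed
    then have "(\<lambda>e xs. of_bool (P' e (map ((!) xs) (as @ [y] @ bs @ cs)))) \<in>
        cmp inp (Suc (Suc d) + 2 * q + r + 1) r"
      unfolding q_def by (rule less.hyps[rotated]) (use less.prems(2,3) in \<open>auto simp: vs\<close>)
    moreover have "P' e (map ((!) xs) (as @ [y] @ bs @ cs)) = P e (map ((!) xs) vs)" for e xs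
      by (simp add: P'_def i_def j_def vs nth_append)
    ultimately show ?thesis using ij(3) by simp
  qed
qed

end

definition input_list ::
  "('p, 'a) domain \<Rightarrow> nat \<Rightarrow> ('o set \<times> ('p, 'o) atom set \<times> ('p, 'o) atom \<Rightarrow> 'o list \<Rightarrow> real) list" where
  "input_list D r =
     map (\<lambda>p e xs. of_bool ((p, xs) \<in> fst (snd e))) (filter (\<lambda>p. pred_arity D p = r) (preds D)) @
     map (\<lambda>p e xs. of_bool ((p, xs) = snd (snd e))) (filter (\<lambda>p. pred_arity D p = r) (preds D)) @
     [(\<lambda>e xs. of_bool (xs ! i = xs ! j)). i \<leftarrow> [0..<r], j \<leftarrow> [0..<i]]"

lemma concat_if_map: "concat (map (\<lambda>x. if P x then [f x] else []) xs) = map f (filter P xs)"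
  by (induction xs) auto

lemma input_features_eq:
  "input_features D s g xs = map (\<lambda>f. f (U, s, g) xs) (input_list D (length xs))"
  by (simp add: input_features_def input_list_def eq_features_def map_concat comp_def concat_if_map)

context bounded_domain
begin

definition start :: "'o set \<times> ('p, 'o) atom set \<times> ('p, 'o) atom \<Rightarrow> ('p, 'o) search" where
  "start e = \<lparr>objects = fst e, state = fst (snd e), radius = \<beta>,
     age = \<lambda>G. of_bool (G = {snd (snd e)}), best = \<lambda>_. 0, cnt = \<lambda>_ _ _ _. 0\<rparr>"

end

locale input_net = bounded_domain D \<beta> \<alpha> B + relnet fst valid B
  for D :: "('p, 'a) domain" and \<beta> \<alpha> B :: nat
    and valid :: "'o set \<times> ('p, 'o) atom set \<times> ('p, 'o) atom \<Rightarrow> bool"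
begin

lemma input_eq_cmp: "j < r \<Longrightarrow> i < j \<Longrightarrow> (\<lambda>e xs. of_bool (xs ! j = xs ! i)) \<in> cmp (input_list D) 0 r"
  by (rule plc.base) (force simp: input_list_def)

lemma input_atom_cmp:
  assumes A: "(p, vs) \<in> atoms D {..<r}" and r: "r \<le> \<beta>"
  shows "(\<lambda>e xs. of_bool ((p, map ((!) xs) vs) \<in> fst (snd e))) \<in> cmp (input_list D) (4 * \<beta> + 1) r"
    "(\<lambda>e xs. of_bool ((p, map ((!) xs) vs) = snd (snd e))) \<in> cmp (input_list D) (4 * \<beta> + 1) r"
proof -
  have p: "p \<in> set (preds D)" "length vs = pred_arity D p" "set vs \<subseteq> {..<r}"
    using A by (auto simp: atoms_def)
  have vs: "length vs \<le> \<beta>" using p arity by simp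
  have "(\<lambda>e xs. of_bool ((p, xs) \<in> fst (snd e))) \<in> cmp (input_list D) 0 (length vs)"
    "(\<lambda>e xs. of_bool ((p, xs) = snd (snd e))) \<in> cmp (input_list D) 0 (length vs)"
    using p by (auto intro!: plc.base simp: input_list_def)
  note this[THEN cmp_reindex_any, OF p(3) _ input_eq_cmp]
  then have *: "(\<lambda>e xs. of_bool ((p, map ((!) xs) vs) \<in> fst (snd e))) \<in> cmp (input_list D) (0 + 2 * length vs + r + 1) r"
    "(\<lambda>e xs. of_bool ((p, map ((!) xs) vs) = snd (snd e))) \<in> cmp (input_list D) (0 + 2 * length vs + r + 1) r"
    using vs breadth by auto
  have "0 + 2 * length vs + r + 1 \<le> 4 * \<beta> + 1" using vs r by simp
  from this[THEN cmp_mono, OF *(1)] this[THEN cmp_mono, OF *(2)]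
  show "(\<lambda>e xs. of_bool ((p, map ((!) xs) vs) \<in> fst (snd e))) \<in> cmp (input_list D) (4 * \<beta> + 1) r"
    "(\<lambda>e xs. of_bool ((p, map ((!) xs) vs) = snd (snd e))) \<in> cmp (input_list D) (4 * \<beta> + 1) r" .
qed

lemma input_dist_cmp: "(\<lambda>e xs. of_bool (distinct xs)) \<in> cmp (input_list D) d r"
proof -
  have "(\<lambda>e xs. of_bool (\<forall>i\<in>{..<r}. \<forall>j\<in>{..<i}. \<not> xs ! i = xs ! j)) \<in> cmp (input_list D) d r"
    by (intro plc_ball plc_not cmp_mono[OF _ input_eq_cmp]) auto
  then show ?thesis
  proof (rule plc.cong)
    fix e xs assume "tup r e xs"
    then have len: "length xs = r" by (simp add: tup_def)
    have "distinct xs \<longleftrightarrow> (\<forall>i\<in>{..<r}. \<forall>j\<in>{..<i}. \<not> xs ! i = xs ! j)"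
    proof
      assume *: "\<forall>i\<in>{..<r}. \<forall>j\<in>{..<i}. \<not> xs ! i = xs ! j"
      show "distinct xs"
        unfolding distinct_conv_nth len
      proof (intro allI impI)
        fix i j assume "i < r" "j < r" "i \<noteq> j"
        then show "xs ! i \<noteq> xs ! j" using * by (metis lessThan_iff linorder_neqE_nat)
      qed
    qed (auto simp: distinct_conv_nth len)
    then show "of_bool (distinct xs) = (of_bool (\<forall>i\<in>{..<r}. \<forall>j\<in>{..<i}. \<not> xs ! i = xs ! j) :: real)" by simp
  qed
qed

text \<open>At distinct objects instantiation is injective on atoms, so only a one-atom pattern can
  become \<open>{g}\<close>; the others get the constant 0. The single atom mentions all
  \<open>r\<close> positions, whence \<open>r \<le> \<beta>\<close> and the input atoms can be
  evaluated at such tuples.\<close>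

lemma goal_pattern_cmp:
  assumes \<Gamma>: "pattern D r \<Gamma>"
  shows "(\<lambda>e xs. of_bool (distinct xs \<and> inst xs ` \<Gamma> = {snd (snd e)})) \<in> cmp (input_list D) (4 * \<beta> + 1) r" (is ?goal)
    and "(\<lambda>e xs. of_bool ((distinct xs \<and> inst xs ` \<Gamma> = {snd (snd e)}) \<and> sat (start e) xs \<Gamma>))
      \<in> cmp (input_list D) (4 * \<beta> + 1) r" (is ?sat)
proof -
  have "?goal \<and> ?sat"
  proof (cases "\<exists>A. \<Gamma> = {A}")
    case True
    then obtain p vs where A: "\<Gamma> = {(p, vs)}" by auto
    then have p: "(p, vs) \<in> atoms D {..<r}" "set vs = {..<r}"
      using \<Gamma> by (auto simp: pattern_def objs_def)
    have "r \<le> length vs" using card_length[of vs] p(2) by simp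
    then have r: "r \<le> \<beta>" using p(1) arity by (fastforce simp: atoms_def)
    note * = input_atom_cmp[OF p(1) r]
    have g: "(\<lambda>e xs. of_bool (distinct xs \<and> (p, map ((!) xs) vs) = snd (snd e))) \<in> cmp (input_list D) (4 * \<beta> + 1) r"
      by (intro plc_conj input_dist_cmp *)
    moreover from plc_conj[OF g *(1)]
    have ?sat by (rule plc.cong) (use r in \<open>auto simp: A inst_def sat_def start_def tup_def\<close>)
    ultimately show ?thesis by (simp add: A inst_def)
  next
    case False
    have "\<not> (distinct xs \<and> inst xs ` \<Gamma> = {snd (snd e)})" if t: "tup r e xs" for e xs
    proof
      assume xs: "distinct xs \<and> inst xs ` \<Gamma> = {snd (snd e)}"
      then have "inj_on ((!) xs) {..<r}" using t by (intro inj_on_nth) (auto simp: tup_def)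
      then have "inj_on (inst xs) \<Gamma>"
        using inj_on_rename[of "(!) xs" "{..<r}" D] \<Gamma> inj_on_subset by (auto simp: inst_eq_rename pattern_def)
      then have "card \<Gamma> = 1" using xs card_image by fastforce
      with False show False by (auto simp: card_1_singleton_iff)
    qed
    then show ?thesis by (auto intro!: plc.cong[OF plc.const[of 0]])
  qed
  then show ?goal ?sat by auto
qed

lemma start_cmp:
  assumes \<phi>: "\<phi> \<in> features_of r" and r: "r \<le> B"
  shows "(\<lambda>e. val \<phi> (start e)) \<in> cmp (input_list D) (4 * \<beta> + 1) r"
proof (cases \<phi>)
  case FDist
  then show ?thesis by (simp only: val.simps input_dist_cmp)
next
  case FBest
  then show ?thesis using plc.const[of 0] by (simp add: start_def)
next
  case (FCnt \<Gamma> \<Delta> j)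
  then show ?thesis using plc.const[of 0] by (simp add: start_def)
next
  case (FAtom A)
  obtain p vs where A: "A = (p, vs)" by (cases A)
  show ?thesis
  proof (cases "r \<le> \<beta>")
    case True
    have "(p, vs) \<in> atoms D {..<r}" using \<phi> FAtom A by (auto simp: features_of_def)
    from input_atom_cmp(1)[OF this True] show ?thesis
      by (rule plc.cong) (use True in \<open>simp add: FAtom A start_def inst_def tup_def\<close>)
  next
    case False
    show ?thesis
      by (rule plc.cong[OF plc.const[of 0]]) (use False in \<open>simp add: FAtom start_def tup_def\<close>)
  qed
next
  case (FAge \<Gamma>)
  then have \<Gamma>: "pattern D r \<Gamma>" using \<phi> by (auto simp: features_of_def)
  from goal_pattern_cmp(1)[OF this] show ?thesis
    by (rule plc.cong) (simp add: FAge start_def)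
next
  case (FSat \<Gamma>)
  then have \<Gamma>: "pattern D r \<Gamma>" using \<phi> by (auto simp: features_of_def)
  from goal_pattern_cmp(2)[OF this] show ?thesis
    by (rule plc.cong) (auto simp: FSat start_def)
qed

end

text \<open>The outcome of the last rounds: \<open>cnt e \<Gamma> \<Delta> j\<close> sums out the last \<open>j\<close> objects of the pattern \<open>\<Gamma>\<close>.\<close>

definition tallied :: "('p, 'a) domain \<Rightarrow> nat \<Rightarrow> ('p, 'o) search \<Rightarrow> bool" where
  "tallied D B e \<longleftrightarrow> (\<forall>\<Gamma> \<Delta> j xs. length xs + j \<le> B \<longrightarrow> pattern D (length xs + j) \<Gamma> \<longrightarrow> \<Delta> \<subseteq> \<Gamma> \<longrightarrow>
     set xs \<subseteq> objects e \<longrightarrow> cnt e \<Gamma> \<Delta> j xs = (\<Sum>ys\<in>tuples (objects e) j. of_bool (distinct (xs @ ys) \<and>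
       age e (inst (xs @ ys) ` \<Gamma>) = Suc (best e []) \<and> inst (xs @ ys) ` \<Delta> \<subseteq> state e)))"

section \<open>The last regression step, named by the arguments of the action\<close>

context bounded_domain
begin

text \<open>Here the arguments of the action are named by the positions of their first occurrences.\<close>

definition last_types ::
  "'a \<Rightarrow> (nat list \<times> nat list \<times> nat \<times> ('p, nat) atom set) set" where
  "last_types b = {(\<sigma>, cs, m, \<Gamma>). (b, \<sigma>) \<in> ground_actions D {..<act_arity D b} \<and>
     (\<forall>i\<in>set \<sigma>. \<sigma> ! i = i) \<and> distinct cs \<and> set cs \<subseteq> set \<sigma> \<and> length cs + m \<le> B \<and>
     pattern D (length cs + m) \<Gamma> \<and>
     applicable D (inst (cs @ [act_arity D b..<act_arity D b + m]) ` \<Gamma>) (b, \<sigma>)}"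

lemma finite_last_types: "finite (last_types b)"
proof -
  let ?l = "act_arity D b"
  have "last_types b \<subseteq> {\<sigma>. set \<sigma> \<subseteq> {..<?l} \<and> length \<sigma> = ?l} \<times> {cs. set cs \<subseteq> {..<?l} \<and> length cs \<le> B} \<times>
      {..B} \<times> Pow (atoms D {..<B})"
  proof
    fix t assume "t \<in> last_types b"
    moreover obtain \<sigma> cs m \<Gamma> where t: "t = (\<sigma>, cs, m, \<Gamma>)" by (cases t)
    ultimately have *: "set \<sigma> \<subseteq> {..<?l}" "length \<sigma> = ?l" "set cs \<subseteq> set \<sigma>" "length cs + m \<le> B"
      "\<Gamma> \<subseteq> atoms D {..<length cs + m}"
      by (auto simp: last_types_def ground_actions_def pattern_def)
    then have "\<Gamma> \<subseteq> atoms D {..<B}" using atoms_mono[of "{..<length cs + m}" "{..<B}" D] by auto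
    with * show "t \<in> {\<sigma>. set \<sigma> \<subseteq> {..<?l} \<and> length \<sigma> = ?l} \<times> {cs. set cs \<subseteq> {..<?l} \<and> length cs \<le> B} \<times>
      {..B} \<times> Pow (atoms D {..<B})" by (auto simp: t)
  qed
  then show ?thesis
    by (rule finite_subset) (auto intro!: finite_cartesian_product finite_lists_length_le finite_lists_length_eq finite_atoms)
qed

text \<open>The part of the candidate that survives regression. It may mention objects outside the
  action and is therefore tested while those are summed out, as the parameter \<Delta> of
  \<open>cnt\<close>. The inserted preconditions mention arguments of the action only and are left
  to \<open>args_match\<close>.\<close>

definition kept :: "'a \<Rightarrow> nat list \<Rightarrow> nat list \<Rightarrow> nat \<Rightarrow> ('p, nat) atom set \<Rightarrow> ('p, nat) atom set" where
  "kept b \<sigma> cs m \<Gamma> = {A \<in> \<Gamma>. inst (cs @ [act_arity D b..<act_arity D b + m]) A \<notin> gadd D (b, \<sigma>)}"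

definition args_match :: "'a \<Rightarrow> nat list \<Rightarrow> ('p, 'o) search \<Rightarrow> 'o list \<Rightarrow> bool" where
  "args_match b \<sigma> e xs \<longleftrightarrow>
     (\<forall>i\<in>{..<act_arity D b}. \<forall>j\<in>{..<act_arity D b}. (xs ! i = xs ! j) = (\<sigma> ! i = \<sigma> ! j)) \<and>
     (\<forall>A\<in>gpre D (b, \<sigma>) - gadd D (b, \<sigma>). inst xs A \<in> state e)"

definition candidate :: "('p, 'o) search \<Rightarrow> ('p, 'o) atom set \<Rightarrow> bool" where
  "candidate e G \<longleftrightarrow> age e G = Suc (best e [])"

definition same_pattern :: "'o list \<Rightarrow> nat list \<Rightarrow> bool" where
  "same_pattern xs \<sigma> \<longleftrightarrow>
     (\<forall>i\<in>{..<length xs}. \<forall>j\<in>{..<length xs}. (xs ! i = xs ! j) = (\<sigma> ! i = \<sigma> ! j))"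

lemma args_match_same_pattern:
  "length xs = act_arity D b \<Longrightarrow> args_match b \<sigma> e xs \<longleftrightarrow>
     same_pattern xs \<sigma> \<and> (\<forall>A\<in>gpre D (b, \<sigma>) - gadd D (b, \<sigma>). inst xs A \<in> state e)"
  by (simp add: args_match_def same_pattern_def)

lemma last_type_inj:
  assumes \<sigma>: "(b, \<sigma>) \<in> ground_actions D {..<act_arity D b}" "\<forall>i\<in>set \<sigma>. \<sigma> ! i = i"
    and xs: "length xs = act_arity D b" "distinct ys" "set ys \<inter> set xs = {}" "length ys = m"
    and match: "same_pattern xs \<sigma>"
  shows "inj_on ((!) (xs @ ys)) (set \<sigma> \<union> {length xs..<length xs + m})"
    "map ((!) (xs @ ys)) \<sigma> = xs" "map ((!) xs) \<sigma> = xs" "inj_on ((!) xs) (set \<sigma>)"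
proof -
  have len: "length \<sigma> = length xs" "set \<sigma> \<subseteq> {..<length xs}" using \<sigma>(1) xs(1) by (auto simp: ground_actions_def)
  have match: "(xs ! i = xs ! j) = (\<sigma> ! i = \<sigma> ! j)" if "i < length xs" "j < length xs" for i j
    using match that by (simp add: same_pattern_def)
  show map: "map ((!) xs) \<sigma> = xs"
  proof (rule nth_equalityI)
    fix i assume "i < length (map ((!) xs) \<sigma>)"
    then have i: "i < length \<sigma>" by simp
    then have "\<sigma> ! i \<in> set \<sigma>" by simp
    then have "\<sigma> ! i < length xs" "\<sigma> ! (\<sigma> ! i) = \<sigma> ! i" using len \<sigma>(2) by auto
    then show "map ((!) xs) \<sigma> ! i = xs ! i" using match[of "\<sigma> ! i" i] i len by simp
  qed (simp add: len)
  show "map ((!) (xs @ ys)) \<sigma> = xs"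
    by (subst (2) map[symmetric]) (use len in \<open>auto simp: nth_append\<close>)
  show inj: "inj_on ((!) xs) (set \<sigma>)"
    using match \<sigma>(2) len by (intro inj_onI) (metis lessThan_iff subsetD)
  show "inj_on ((!) (xs @ ys)) (set \<sigma> \<union> {length xs..<length xs + m})"
  proof (rule inj_onI)
    fix i j assume i: "i \<in> set \<sigma> \<union> {length xs..<length xs + m}" and j: "j \<in> set \<sigma> \<union> {length xs..<length xs + m}"
      and eq: "(xs @ ys) ! i = (xs @ ys) ! j"
    have lt: "k \<in> set \<sigma>" if "k \<in> set \<sigma> \<union> {length xs..<length xs + m}" "k < length xs" for k
      using that by auto
    have ge: "(xs @ ys) ! k \<in> set ys" if "k \<in> set \<sigma> \<union> {length xs..<length xs + m}" "\<not> k < length xs" for k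
      using that len xs(4) by (auto simp: nth_append subset_iff)
    have lx: "(xs @ ys) ! k \<in> set xs" if "k < length xs" for k using that by (simp add: nth_append)
    consider "i < length xs" "j < length xs" | "\<not> i < length xs" "\<not> j < length xs"
      using ge[OF i] ge[OF j] lx[of i] lx[of j] eq xs(3) by (metis disjoint_iff)
    then show "i = j"
    proof cases
      case 1
      then show ?thesis using eq inj_onD[OF inj, of i j] lt[OF i] lt[OF j] by (simp add: nth_append)
    next
      case 2
      then have "i - length xs < m" "j - length xs < m" using i j len by auto
      then show ?thesis using 2 eq xs(2,4) nth_eq_iff_index_eq[of ys "i - length xs" "j - length xs"]
        by (simp add: nth_append)
    qed
  qed
qed

lemma last_type_regress:
  assumes type: "(\<sigma>, cs, m, \<Gamma>) \<in> last_types b"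
    and xs: "length xs = act_arity D b" "distinct ys" "set ys \<inter> set xs = {}" "length ys = m"
    and match: "same_pattern xs \<sigma>"
  defines "G \<equiv> inst (map ((!) xs) cs @ ys) ` \<Gamma>"
  shows "applicable D G (b, xs)"
    "regress D G (b, xs) = inst (map ((!) xs) cs @ ys) ` kept b \<sigma> cs m \<Gamma> \<union> inst xs ` (gpre D (b, \<sigma>) - gadd D (b, \<sigma>))"
proof -
  let ?l = "act_arity D b"
  let ?X = "set \<sigma> \<union> {?l..<?l + m}" and ?h = "(!) (xs @ ys)" and ?\<Gamma> = "inst (cs @ [?l..<?l + m]) ` \<Gamma>"
  have t: "(b, \<sigma>) \<in> ground_actions D {..<?l}" "\<forall>i\<in>set \<sigma>. \<sigma> ! i = i" "set cs \<subseteq> set \<sigma>"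
    "\<Gamma> \<subseteq> atoms D {..<length cs + m}" "applicable D ?\<Gamma> (b, \<sigma>)"
    using type by (auto simp: last_types_def pattern_def)
  then have \<sigma>: "set \<sigma> \<subseteq> {..<?l}" and ga: "(b, \<sigma>) \<in> ground_actions D ?X" by (auto simp: ground_actions_def)
  note inj = last_type_inj[OF t(1,2) xs match]
  have inj': "inj_on (rename ?h) (atoms D ?X)" using inj(1) xs(1) by (intro inj_on_rename) simp
  have sub: "?\<Gamma> \<subseteq> atoms D ?X" using t(3) by (intro indices_in_atoms[OF t(4)]) auto
  have img: "rename ?h ` inst (cs @ [?l..<?l + m]) ` S = inst (map ((!) xs) cs @ ys) ` S" if "S \<subseteq> \<Gamma>" for S
    using inst_append_indices[of S D cs m ?l xs ys "[]"] that t(3,4) \<sigma> xs by (simp add: inst_eq_rename)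
  have G: "rename ?h ` ?\<Gamma> = G" unfolding G_def by (rule img) simp
  show "applicable D G (b, xs)"
    using applicable_rename[OF wf ga inj' sub] t(5) unfolding G inj(2) by simp
  have "regress D G (b, xs) = rename ?h ` regress D ?\<Gamma> (b, \<sigma>)"
    using regress_rename[OF wf ga inj' sub] unfolding G inj(2) .
  also have "regress D ?\<Gamma> (b, \<sigma>) = inst (cs @ [?l..<?l + m]) ` kept b \<sigma> cs m \<Gamma> \<union> (gpre D (b, \<sigma>) - gadd D (b, \<sigma>))"
    by (auto simp: regress_def kept_def)
  also have "rename ?h ` \<dots> = inst (map ((!) xs) cs @ ys) ` kept b \<sigma> cs m \<Gamma> \<union> inst xs ` (gpre D (b, \<sigma>) - gadd D (b, \<sigma>))"
  proof -
    have "gpre D (b, \<sigma>) - gadd D (b, \<sigma>) \<subseteq> atoms D {..<length xs}"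
      using gatoms_in_atoms(1)[OF wf t(1)] xs(1) by auto
    from inst_append_prefix[OF this, of ys] show ?thesis
      using img[of "kept b \<sigma> cs m \<Gamma>"] by (simp add: image_Un inst_eq_rename kept_def)
  qed
  finally show "regress D G (b, xs) = inst (map ((!) xs) cs @ ys) ` kept b \<sigma> cs m \<Gamma> \<union> inst xs ` (gpre D (b, \<sigma>) - gadd D (b, \<sigma>))" .
qed

lemma last_type_exists:
  assumes b: "(b, xs) \<in> ground_actions D U" and app: "applicable D G (b, xs)"
    and G: "G \<subseteq> atoms D U" "finite (objs G)" "card (objs G) \<le> B"
  obtains \<sigma> cs m \<Gamma> ys where "(\<sigma>, cs, m, \<Gamma>) \<in> last_types b"
    "distinct ys" "length ys = m" "set ys \<subseteq> U" "set ys \<inter> set xs = {}" "inst (map ((!) xs) cs @ ys) ` \<Gamma> = G"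
    "same_pattern xs \<sigma>"
proof -
  let ?l = "act_arity D b"
  have len: "length xs = ?l" using b by (auto simp: ground_actions_def)
  define fo where "fo i = (LEAST j. xs ! j = xs ! i)" for i
  have fo: "xs ! fo i = xs ! i" "fo i \<le> i" for i
    unfolding fo_def by (rule LeastI[of _ i], simp) (rule Least_le, simp)
  have fo_eq: "(xs ! i = xs ! j) = (fo i = fo j)" for i j
    using fo(1) by (metis fo_def)
  define \<sigma> where "\<sigma> = map fo [0..<?l]"
  have nth: "\<sigma> ! i = fo i" if "i < ?l" for i using that by (simp add: \<sigma>_def)
  have set: "set \<sigma> \<subseteq> {..<?l}" using fo(2) by (auto simp: \<sigma>_def intro: le_less_trans[OF fo(2)])
  have idem: "\<forall>i\<in>set \<sigma>. \<sigma> ! i = i"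
  proof
    fix i assume "i \<in> set \<sigma>"
    then obtain j where "j < ?l" "i = fo j" by (auto simp: \<sigma>_def)
    then show "\<sigma> ! i = i" using nth[of i] fo[of j] fo_eq[of i j] by simp
  qed
  have ga: "(b, \<sigma>) \<in> ground_actions D {..<?l}" using b set by (auto simp: ground_actions_def \<sigma>_def)
  have match: "same_pattern xs \<sigma>"
    using fo_eq nth len by (simp add: same_pattern_def)
  note inj0 = last_type_inj(3,4)[OF ga idem len, of "[]" 0, simplified, OF match]
  have img: "(!) xs ` set \<sigma> = set xs" using inj0(1) by (metis list.set_map)
  obtain cs ys \<Gamma> where N: "distinct cs" "set cs \<subseteq> set \<sigma>" "set (map ((!) xs) cs) = objs G \<inter> set xs"
    "distinct ys" "set ys = objs G - set xs" "length cs + length ys = card (objs G)"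
    "pattern D (length cs + length ys) \<Gamma>" "inst (map ((!) xs) cs @ ys) ` \<Gamma> = G"
    by (rule naming_exists[OF G(1,2) inj0(2), unfolded img]) (use set len in auto)
  let ?X = "set \<sigma> \<union> {?l..<?l + length ys}" and ?h = "(!) (xs @ ys)"
    and ?\<Gamma> = "inst (cs @ [?l..<?l + length ys]) ` \<Gamma>"
  have disj: "set ys \<inter> set xs = {}" using N(5) by auto
  note inj = last_type_inj[OF ga idem len N(4) disj refl match]
  have ga': "(b, \<sigma>) \<in> ground_actions D ?X" using ga by (auto simp: ground_actions_def)
  have inj': "inj_on (rename ?h) (atoms D ?X)" using inj(1) len by (intro inj_on_rename) simp
  have \<Gamma>: "\<Gamma> \<subseteq> atoms D {..<length cs + length ys}" using N(7) by (simp add: pattern_def)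
  have sub: "?\<Gamma> \<subseteq> atoms D ?X" using N(2) by (intro indices_in_atoms[OF \<Gamma>]) auto
  have "rename ?h ` ?\<Gamma> = G"
    using inst_append_indices[OF \<Gamma> _ len refl, of "[]"] N(2,8) set by (simp add: inst_eq_rename)
  then have "applicable D ?\<Gamma> (b, \<sigma>)"
    using applicable_rename[OF wf ga' inj' sub] app inj(2) by simp
  then have "(\<sigma>, cs, length ys, \<Gamma>) \<in> last_types b"
    using ga idem N(1,2,6,7) G(3) by (auto simp: last_types_def)
  moreover have "set ys \<subseteq> U" using N(5) objs_subset[OF G(1)] by auto
  ultimately show ?thesis using N(4,8) disj match by (intro that[of \<sigma> cs "length ys" \<Gamma> ys]) auto
qed

end

section \<open>Reading off the scores of ground actions\<close>

context search_net
begin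

text \<open>An action may have more arguments than the breadth, but an atom has at most \<beta>.
  With repetitions removed, its positions form a tuple within the breadth, and also within the
  radius, where \<open>FAtom\<close> tells its truth.\<close>

lemma atom_readout:
  assumes A: "A \<in> atoms D {..<l}" and l: "l + 1 \<le> d"
  shows "(\<lambda>e xs. of_bool (inst xs A \<in> state e)) \<in> plc (tup l) (readout_access (cmp feats d) l)"
proof -
  obtain p vs where pv: "A = (p, vs)" by (cases A)
  then have p: "p \<in> set (preds D)" "length vs = pred_arity D p" "set vs \<subseteq> {..<l}"
    using A by (auto simp: atoms_def)
  let ?ws = "remdups vs"
  have ws: "length ?ws \<le> \<beta>" using p arity length_remdups_leq[of vs] by (metis order_trans)
  obtain ps where ps: "map ((!) ?ws) ps = vs" "set ps \<subseteq> {..<length ?ws}"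
    using factor_through_nth[of vs ?ws] by auto
  have "(p, ps) \<in> atoms D {..<length ?ws}" using p ps length_map[of "(!) ?ws" ps] by (auto simp: atoms_def)
  then have "FAtom (p, ps) \<in> features_of (length ?ws)" by (auto simp: features_of_def)
  from readout_access_reindex[OF val_cmp[OF this, of 0]]
  have "(\<lambda>e xs. val (FAtom (p, ps)) e (map ((!) xs) ?ws)) \<in> plc (tup l) (readout_access (cmp feats d) l)"
    using p ws breadth l by simp
  then show ?thesis
  proof (rule plc.cong)
    fix e xs assume "tup l e xs"
    then have "length ?ws \<le> radius e" using valid_wf[of e] ws by (simp add: tup_def wf_search_def)
    then show "of_bool (inst xs A \<in> state e) = val (FAtom (p, ps)) e (map ((!) xs) ?ws)"
      using map_nth_map[OF ps(2), of "(!) xs"] ps(1) by (simp add: pv inst_def)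
  qed
qed

lemma eq_readout:
  assumes "i < l" "j < l"
  shows "(\<lambda>e xs. of_bool (xs ! i = xs ! j)) \<in> plc (tup l) (readout_access C l)"
proof -
  have *: "(\<lambda>e xs. of_bool (xs ! i = xs ! j)) \<in> plc (tup l) (readout_access C l)" if "i < l" "j < i" for i j
    using that by (intro plc.base) (auto simp: readout_access_def)
  consider "i = j" | "j < i" | "i < j" by linarith
  then show ?thesis
  proof cases
    case 1
    then show ?thesis using plc.const[of 1] by simp
  next
    case 2
    then show ?thesis using * assms by simp
  next
    case 3
    from *[OF assms(2) this] show ?thesis by (simp add: eq_commute)
  qed
qed

lemma plc_iff_const:
  assumes "(\<lambda>e x. of_bool (P e x)) \<in> plc V S"
  shows "(\<lambda>e x. of_bool (P e x = Q)) \<in> plc V S"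
  using assms plc_not[OF assms] by (cases Q) auto

text \<open>The instance of \<F> in \<open>exists_avoiding\<close> for the readout, where no layer
  is left to sum in: its sums are the stored \<open>FCnt\<close> features
  (\<open>tallies_sum\<close>), and a permutation of arguments merely permutes the pattern
  (\<open>tallies_perm\<close>).\<close>

definition tallies :: "nat \<Rightarrow> nat \<Rightarrow> (('p, 'o) search \<Rightarrow> 'o list \<Rightarrow> real) set" where
  "tallies q m = {f. \<exists>\<Gamma> \<Delta>. pattern D (q + m) \<Gamma> \<and> \<Delta> \<subseteq> \<Gamma> \<and> (\<forall>e ws. tup (q + m) e ws \<longrightarrow>
     f e ws = of_bool (distinct ws \<and> candidate e (inst ws ` \<Gamma>) \<and> inst ws ` \<Delta> \<subseteq> state e))}"

lemma tallies_sum: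
  assumes tallied: "\<And>e. valid e \<Longrightarrow> tallied D B e" and f: "f \<in> tallies q m" "q + m \<le> B"
  shows "(\<lambda>e xs. \<Sum>ys\<in>tuples (objects e) m. f e (xs @ ys)) \<in> cmp feats d q"
proof -
  obtain \<Gamma> \<Delta> where \<Gamma>: "pattern D (q + m) \<Gamma>" "\<Delta> \<subseteq> \<Gamma>" "\<And>e ws. tup (q + m) e ws \<Longrightarrow>
     f e ws = of_bool (distinct ws \<and> candidate e (inst ws ` \<Gamma>) \<and> inst ws ` \<Delta> \<subseteq> state e)"
    using f(1) unfolding tallies_def by blast
  have "FCnt \<Gamma> \<Delta> m \<in> features_of q" using \<Gamma> f(2) by (auto simp: features_of_def)
  from val_cmp[OF this] show ?thesis
  proof (rule plc.cong)
    fix e xs assume t: "tup q e xs"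
    then have "cnt e \<Gamma> \<Delta> m xs = (\<Sum>ys\<in>tuples (objects e) m. of_bool (distinct (xs @ ys) \<and>
       age e (inst (xs @ ys) ` \<Gamma>) = Suc (best e []) \<and> inst (xs @ ys) ` \<Delta> \<subseteq> state e))"
      using tallied[of e] \<Gamma>(1,2) f(2) unfolding tallied_def tup_def by simp
    also have "\<dots> = (\<Sum>ys\<in>tuples (objects e) m. f e (xs @ ys))"
    proof (intro sum.cong refl)
      fix ys assume "ys \<in> tuples (objects e) m"
      then have "tup (q + m) e (xs @ ys)" using t by (auto simp: tup_def tuples_def)
      from \<Gamma>(3)[OF this] show "of_bool (distinct (xs @ ys) \<and>
         age e (inst (xs @ ys) ` \<Gamma>) = Suc (best e []) \<and> inst (xs @ ys) ` \<Delta> \<subseteq> state e) = f e (xs @ ys)"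
        by (simp add: candidate_def)
    qed
    finally show "(\<Sum>ys\<in>tuples (objects e) m. f e (xs @ ys)) = val (FCnt \<Gamma> \<Delta> m) e xs" by simp
  qed
qed

lemma tallies_perm:
  assumes f: "f \<in> tallies q (Suc m)"
    and vs: "distinct vs" "length vs = q + Suc m" "set vs = {..<q + Suc m}"
  shows "(\<lambda>e xs. f e (map ((!) xs) vs)) \<in> tallies (Suc q) m"
proof -
  obtain \<Gamma> \<Delta> where \<Gamma>: "pattern D (q + Suc m) \<Gamma>" "\<Delta> \<subseteq> \<Gamma>" "\<And>e ws. tup (q + Suc m) e ws \<Longrightarrow>
     f e ws = of_bool (distinct ws \<and> candidate e (inst ws ` \<Gamma>) \<and> inst ws ` \<Delta> \<subseteq> state e)"
    using f unfolding tallies_def by blast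
  have nth: "(!) vs ` {..<q + Suc m} = {..<q + Suc m}"
    using vs by (auto simp: set_conv_nth image_iff)
  have "inst vs ` \<Gamma> \<subseteq> atoms D {..<q + Suc m}"
    using \<Gamma>(1) nth rename_in_atoms[of _ D "{..<q + Suc m}" "(!) vs"] by (auto simp: pattern_def inst_eq_rename)
  moreover have "objs (inst vs ` \<Gamma>) = {..<q + Suc m}"
    using \<Gamma>(1) nth by (simp add: inst_eq_rename objs_rename pattern_def)
  ultimately have pat: "pattern D (Suc q + m) (inst vs ` \<Gamma>)" by (simp add: pattern_def)
  have "f e (map ((!) ws) vs) = of_bool (distinct ws \<and> candidate e (inst ws ` inst vs ` \<Gamma>) \<and> inst ws ` inst vs ` \<Delta> \<subseteq> state e)"
    if t: "tup (Suc q + m) e ws" for e ws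
  proof -
    have len: "length ws = length vs" using t vs(2) by (simp add: tup_def)
    have set: "set (map ((!) ws) vs) = set ws"
      unfolding set_map vs(3) using len vs(2) by (auto simp: set_conv_nth)
    have "tup (q + Suc m) e (map ((!) ws) vs)"
      unfolding tup_def set using t vs(2) by (simp add: tup_def)
    moreover have "distinct (map ((!) ws) vs) = distinct ws"
      using set len by (metis card_distinct distinct_card length_map)
    moreover have "inst (map ((!) ws) vs) ` S = inst ws ` inst vs ` S" if "S \<subseteq> \<Gamma>" for S
    proof -
      have "inst (map ((!) ws) vs) A = inst ws (inst vs A)" if "A \<in> S" for A
      proof -
        have "A \<in> atoms D {..<length vs}"
          using that \<open>S \<subseteq> \<Gamma>\<close> \<Gamma>(1) unfolding vs(2) pattern_def by blast
        then have "set (snd A) \<subseteq> {..<length vs}" by (rule atoms_objs)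
        then show ?thesis unfolding inst_eq_rename rename_rename
          by (intro rename_cong) (auto simp: subset_iff)
      qed
      then show ?thesis by (simp add: image_image)
    qed
    ultimately show ?thesis using \<Gamma>(2,3) by simp
  qed
  note perm = this
  show ?thesis
    unfolding tallies_def
    by (intro CollectI exI[of _ "inst vs ` \<Gamma>"] exI[of _ "inst vs ` \<Delta>"] conjI allI impI pat
        image_mono \<Gamma>(2) perm)
qed

text \<open>The existence of a suitable candidate is a finite disjunction over
  \<open>last_types\<close>. The candidate together with all arguments may exceed the breadth, so
  arguments that do not occur in it are only avoided. Since all sums are available as features, the
  \<alpha> + 1 layers are spent on dropping positions.\<close>

lemma score_cmp:
  assumes tallied: "\<And>e. valid e \<Longrightarrow> tallied D B e" and b: "b \<in> set (acts D)"
  shows "(\<lambda>e xs. of_bool (\<exists>G. candidate e G \<and> applicable D G (b, xs) \<and> regress D G (b, xs) \<subseteq> state e))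
    \<in> plc (tup (act_arity D b)) (readout_access (cmp feats (\<alpha> + 1)) (act_arity D b))"
proof -
  let ?l = "act_arity D b"
  have l: "?l \<le> \<alpha>" using act_arity[OF b] .
  let ?S = "readout_access (cmp feats (\<alpha> + 1)) ?l"
  let ?F = "\<lambda>\<sigma> cs m \<Gamma> e ws. distinct ws \<and> candidate e (inst ws ` \<Gamma>) \<and> inst ws ` kept b \<sigma> cs m \<Gamma> \<subseteq> state e"
  let ?P = "\<lambda>(\<sigma>, cs, m, \<Gamma>) e xs. args_match b \<sigma> e xs \<and> (\<exists>ys\<in>tuples (objects e) m. distinct ys \<and>
    set ys \<inter> set xs = {} \<and> ?F \<sigma> cs m \<Gamma> e (map ((!) xs) cs @ ys))"
  have "(\<lambda>e xs. of_bool (\<exists>\<tau>\<in>last_types b. ?P \<tau> e xs)) \<in> plc (tup ?l) ?S"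
  proof (rule plc_bex[OF finite_last_types])
    fix \<tau> assume "\<tau> \<in> last_types b"
    moreover obtain \<sigma> cs m \<Gamma> where \<tau>: "\<tau> = (\<sigma>, cs, m, \<Gamma>)" by (cases \<tau>)
    ultimately have t: "(b, \<sigma>) \<in> ground_actions D {..<?l}" "\<forall>i\<in>set \<sigma>. \<sigma> ! i = i" "distinct cs" "set cs \<subseteq> set \<sigma>"
      "length cs + m \<le> B" "pattern D (length cs + m) \<Gamma>"
      by (auto simp: last_types_def)
    then have \<sigma>: "set \<sigma> \<subseteq> {..<?l}" "length \<sigma> = ?l" by (auto simp: ground_actions_def)
    obtain av where av: "distinct av" "set av = set \<sigma> - set cs"
      using finite_distinct_list[of "set \<sigma> - set cs"] by auto
    have all: "set (cs @ av) = set \<sigma>" using av(2) t(4) by auto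
    have inj: "map ((!) xs) \<sigma> = xs" "inj_on ((!) xs) (set \<sigma>)"
      if "length xs = ?l" "args_match b \<sigma> e xs" for e :: "('p, 'o) search" and xs
      using last_type_inj(3,4)[OF t(1,2) that(1), of "[]" 0] that by (auto simp: args_match_same_pattern)
    have "(\<lambda>e xs. of_bool (args_match b \<sigma> e xs \<and> (\<exists>ys\<in>tuples (objects e) m. distinct ys \<and>
      set ys \<inter> set (map ((!) xs) (cs @ av)) = {} \<and> ?F \<sigma> cs m \<Gamma> e (map ((!) xs) cs @ ys)))) \<in> plc (tup ?l) ?S"
    proof (rule exists_avoiding[where \<F> = tallies and d' = 0 and inp = feats and F = "?F \<sigma> cs m \<Gamma>"])
      show "(\<lambda>e ws. of_bool (?F \<sigma> cs m \<Gamma> e ws)) \<in> tallies (length cs) m"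
        unfolding tallies_def using t(6)
        by (intro CollectI exI[of _ \<Gamma>] exI[of _ "kept b \<sigma> cs m \<Gamma>"]) (auto simp: kept_def)
      show "distinct (cs @ av)" using t(3) av by auto
      show "set (cs @ av) \<subseteq> {..<?l}" using all \<sigma> by simp
      show "(\<lambda>e xs. g e (map ((!) xs) cs')) \<in> plc (tup ?l) ?S"
        if "length cs' \<le> B" "distinct cs'" "set cs' \<subseteq> {..<?l}" "g \<in> cmp feats 0 (length cs')" for g cs'
        by (rule readout_access_reindex[OF that(4,2,3,1)]) (use l in simp)
      show "(\<lambda>e xs. of_bool (args_match b \<sigma> e xs)) \<in> plc (tup ?l) ?S"
        unfolding args_match_def
      proof (intro plc_conj plc_ball plc_iff_const eq_readout)
        show "finite (gpre D (b, \<sigma>) - gadd D (b, \<sigma>))"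
          using gatoms_in_atoms(1)[OF wf t(1)] finite_atoms[of "{..<?l}" D] finite_subset by blast
        show "(\<lambda>e xs. of_bool (inst xs A \<in> state e)) \<in> plc (tup ?l) ?S"
          if "A \<in> gpre D (b, \<sigma>) - gadd D (b, \<sigma>)" for A
          using that gatoms_in_atoms(1)[OF wf t(1)] l by (intro atom_readout) auto
      qed auto
      show "distinct (map ((!) xs) (cs @ av))" if "tup ?l e xs" "args_match b \<sigma> e xs" for e xs
      proof -
        have "inj_on ((!) xs) (set (cs @ av))" unfolding all using inj(2) that by (simp add: tup_def)
        moreover have "distinct (cs @ av)" using t(3) av by auto
        ultimately show ?thesis unfolding distinct_map by simp
      qed
    next
      show "(\<lambda>e xs. \<Sum>ys\<in>tuples (objects e) m. f e (xs @ ys)) \<in> cmp feats 0 q"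
        if "f \<in> tallies q m" "q + m \<le> B" for f q m
        by (rule tallies_sum[OF tallied that])
      show "(\<lambda>e xs. f e (map ((!) xs) vs)) \<in> tallies (Suc q) m"
        if "f \<in> tallies q (Suc m)" "distinct vs" "length vs = q + Suc m" "set vs = {..<q + Suc m}" for f q m vs
        by (rule tallies_perm[OF that])
    qed (use t(5) in auto)
    then show "(\<lambda>e xs. of_bool (?P \<tau> e xs)) \<in> plc (tup ?l) ?S"
    proof (rule plc.cong)
      fix e xs assume "tup ?l e xs"
      then have "set (map ((!) xs) (cs @ av)) = set xs" if "args_match b \<sigma> e xs"
        unfolding set_map all using inj(1)[of xs e] that by (metis list.set_map tup_def)
      then show "of_bool (?P \<tau> e xs) = (of_bool (args_match b \<sigma> e xs \<and> (\<exists>ys\<in>tuples (objects e) m. distinct ys \<and>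
          set ys \<inter> set (map ((!) xs) (cs @ av)) = {} \<and> ?F \<sigma> cs m \<Gamma> e (map ((!) xs) cs @ ys))) :: real)"
        unfolding \<tau> of_bool_eq_iff prod.case by auto
    qed
  qed
  then show ?thesis
  proof (rule plc.cong)
    fix e xs assume t: "tup ?l e xs"
    then have e: "finite (objects e)" and len: "length xs = ?l" and ga: "(b, xs) \<in> ground_actions D (objects e)"
      and age: "\<And>G. candidate e G \<Longrightarrow> G \<subseteq> atoms D (objects e) \<and> card (objs G) \<le> B"
      using valid_wf[of e] b by (auto simp: tup_def wf_search_def ground_actions_def candidate_def)
    have "(\<exists>\<tau>\<in>last_types b. ?P \<tau> e xs) \<longleftrightarrow> (\<exists>G. candidate e G \<and> applicable D G (b, xs) \<and> regress D G (b, xs) \<subseteq> state e)"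
    proof
      assume "\<exists>\<tau>\<in>last_types b. ?P \<tau> e xs"
      then obtain \<sigma> cs m \<Gamma> ys where \<tau>: "(\<sigma>, cs, m, \<Gamma>) \<in> last_types b" "args_match b \<sigma> e xs"
        "ys \<in> tuples (objects e) m" "distinct ys" "set ys \<inter> set xs = {}"
        "?F \<sigma> cs m \<Gamma> e (map ((!) xs) cs @ ys)" by auto
      have match: "same_pattern xs \<sigma>" using \<tau>(2) len by (simp add: args_match_same_pattern)
      have ys: "length ys = m" using \<tau>(3) by (simp add: tuples_def)
      note G = last_type_regress[OF \<tau>(1) len \<tau>(4,5) ys match]
      have "regress D (inst (map ((!) xs) cs @ ys) ` \<Gamma>) (b, xs) \<subseteq> state e"
        unfolding G(2) using \<tau>(2,6) by (auto simp: args_match_def)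
      with G(1) \<tau>(6) show "\<exists>G. candidate e G \<and> applicable D G (b, xs) \<and> regress D G (b, xs) \<subseteq> state e" by blast
    next
      assume "\<exists>G. candidate e G \<and> applicable D G (b, xs) \<and> regress D G (b, xs) \<subseteq> state e"
      then obtain G where G: "candidate e G" "applicable D G (b, xs)" "regress D G (b, xs) \<subseteq> state e" by blast
      have fin: "finite (objs G)" by (rule finite_subset[OF objs_subset[OF conjunct1[OF age[OF G(1)]]] e])
      obtain \<sigma> cs m \<Gamma> ys where \<tau>: "(\<sigma>, cs, m, \<Gamma>) \<in> last_types b"
        "distinct ys" "length ys = m" "set ys \<subseteq> objects e" "set ys \<inter> set xs = {}" "inst (map ((!) xs) cs @ ys) ` \<Gamma> = G"
        "same_pattern xs \<sigma>"
        by (rule last_type_exists[OF ga G(2) _ fin]) (use age[OF G(1)] in auto)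
      have sub: "inst (map ((!) xs) cs @ ys) ` kept b \<sigma> cs m \<Gamma> \<union> inst xs ` (gpre D (b, \<sigma>) - gadd D (b, \<sigma>)) \<subseteq> state e"
        using last_type_regress(2)[OF \<tau>(1) len \<tau>(2,5,3,7)] G(3) \<tau>(6) by simp
      have "args_match b \<sigma> e xs" using \<tau>(7) sub len by (auto simp: args_match_same_pattern)
      moreover have "distinct (map ((!) xs) cs @ ys)"
      proof -
        have *: "(b, \<sigma>) \<in> ground_actions D {..<?l}" "\<forall>i\<in>set \<sigma>. \<sigma> ! i = i" "distinct cs" "set cs \<subseteq> set \<sigma>"
          using \<tau>(1) by (auto simp: last_types_def)
        have "inj_on ((!) xs) (set \<sigma>)" by (rule last_type_inj(4)[OF *(1,2) len \<tau>(2,5,3,7)])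
        then have "distinct (map ((!) xs) cs)" using *(3,4) inj_on_subset by (auto simp: distinct_map)
        moreover have "set cs \<subseteq> {..<length xs}" using *(1,4) len by (auto simp: ground_actions_def)
        then have "set (map ((!) xs) cs) \<subseteq> set xs" by (auto simp: subset_iff)
        ultimately show ?thesis using \<tau>(2,5) by auto
      qed
      ultimately have "?P (\<sigma>, cs, m, \<Gamma>) e xs"
        using \<tau>(2-6) sub G(1) by (auto simp: tuples_def intro!: bexI[of _ ys])
      with \<tau>(1) show "\<exists>\<tau>\<in>last_types b. ?P \<tau> e xs" by blast
    qed
    then show "of_bool (\<exists>G. candidate e G \<and> applicable D G (b, xs) \<and> regress D G (b, xs) \<subseteq> state e) =
        (of_bool (\<exists>\<tau>\<in>last_types b. ?P \<tau> e xs) :: real)" by simp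
  qed
qed

end

section \<open>Backward search and regression paths\<close>

text \<open>Action lists here run from the goal towards the state; a plan is the reverse of such a
  list.\<close>

primrec regressions :: "('p, 'a) domain \<Rightarrow> ('p, 'o) atom set \<Rightarrow> ('a, 'o) gaction list \<Rightarrow> ('p, 'o) atom set" where
  "regressions D G [] = G"
| "regressions D G (b # bs) = regressions D (regress D G b) bs"

primrec regressible :: "('p, 'a) domain \<Rightarrow> 'o set \<Rightarrow> ('p, 'o) atom set \<Rightarrow> ('a, 'o) gaction list \<Rightarrow> bool" where
  "regressible D U G [] \<longleftrightarrow> True"
| "regressible D U G (b # bs) \<longleftrightarrow>
     b \<in> ground_actions D U \<and> applicable D G b \<and> regressible D U (regress D G b) bs"

definition solves :: "('p, 'a) domain \<Rightarrow> 'o set \<Rightarrow> ('p, 'o) atom set \<Rightarrow> ('p, 'o) atom set \<Rightarrow> ('a, 'o) gaction list \<Rightarrow> bool" where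
  "solves D U s G bs \<longleftrightarrow> regressible D U G bs \<and> regressions D G bs \<subseteq> s"

lemma regressions_append: "regressions D G (bs @ cs) = regressions D (regressions D G bs) cs"
  by (induction bs arbitrary: G) auto

lemma regressible_append:
  "regressible D U G (bs @ cs) \<longleftrightarrow> regressible D U G bs \<and> regressible D U (regressions D G bs) cs"
  by (induction bs arbitrary: G) auto

lemma solves_Nil: "solves D U s G [] \<longleftrightarrow> G \<subseteq> s"
  by (simp add: solves_def)

lemma solves_Cons:
  "solves D U s G (b # bs) \<longleftrightarrow> b \<in> ground_actions D U \<and> applicable D G b \<and> solves D U s (regress D G b) bs"
  by (auto simp: solves_def)

lemma bwd_acts_iff:
  "a \<in> bwd_acts D U stk G \<longleftrightarrow> a \<in> ground_actions D U \<and> applicable D G a \<and> regress D G a \<notin> insert G stk"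
  by (auto simp: bwd_acts_def applicable_def)

text \<open>Regress the goal through the plan from its end, skipping actions that add nothing
  needed; therefore only an inequality of lengths. An action that is not skipped deletes no atom of
  the goal set, because deletions are applied last and the goal set holds afterwards.\<close>

lemma execute_solves:
  assumes "set \<pi> \<subseteq> ground_actions D U" "execute D s \<pi> = Some s'" "G \<subseteq> s'"
  shows "\<exists>bs. length bs \<le> length \<pi> \<and> solves D U s G bs"
  using assms
proof (induction \<pi> arbitrary: s)
  case Nil
  then show ?case by (intro exI[of _ "[]"]) (simp add: solves_Nil)
next
  case (Cons a \<pi>)
  then have s: "gpre D a \<subseteq> s" "execute D (s \<union> gadd D a - gdel D a) \<pi> = Some s'"
    by (auto simp: transition_def split: if_splits)
  then obtain bs where bs: "length bs \<le> length \<pi>" "regressible D U G bs" "regressions D G bs \<subseteq> s \<union> gadd D a - gdel D a"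
    using Cons.IH[OF _ s(2) Cons.prems(3)] Cons.prems(1) unfolding solves_def by auto
  let ?H = "regressions D G bs"
  show ?case
  proof (cases "?H \<inter> gadd D a = {}")
    case True
    then show ?thesis using bs by (intro exI[of _ bs]) (auto simp: solves_def)
  next
    case False
    then have "applicable D ?H a" "regress D ?H a \<subseteq> s"
      using bs(3) s(1) by (auto simp: applicable_def regress_def)
    then show ?thesis using bs Cons.prems(1)
      by (intro exI[of _ "bs @ [a]"]) (auto simp: solves_def regressible_append regressions_append)
  qed
qed

lemma bwd_result_solves:
  assumes "bwd_result D U s stk G r" "r = Some \<pi>"
  shows "\<exists>bs. length bs = length \<pi> \<and> solves D U s G bs"
  using assms
proof (induction arbitrary: \<pi> rule: bwd_result.induct)
  case (sat G stk)
  then show ?case by (intro exI[of _ "[]"]) (simp add: solves_Nil)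
next
  case (plan G stk res recorded \<pi>')
  then have "\<pi> \<in> recorded" by (auto simp: is_arg_min_def)
  then obtain \<rho> a where a: "\<pi> = \<rho> @ [a]" "a \<in> bwd_acts D U stk G" "res a = Some \<rho>"
    using plan.hyps(3) by blast
  then obtain bs where "length bs = length \<rho>" "solves D U s (regress D G a) bs" using plan.IH by blast
  then show ?case using a by (intro exI[of _ "a # bs"]) (auto simp: solves_Cons bwd_acts_iff)
qed simp

text \<open>Every recursive call enlarges the stack by a new set of atoms, and there are finitely
  many of these. The rule \<open>plan\<close> needs this for all the calls besides the one that
  matters.\<close>

lemma bwd_result_exists:
  assumes "wf_domain D" "finite U" "G \<subseteq> atoms D U" "G \<notin> stk"
  shows "\<exists>r. bwd_result D U s stk G r"
  using assms(3,4)
proof (induction "card (Pow (atoms D U) - stk)" arbitrary: G stk rule: less_induct)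
  case less
  show ?case
  proof (cases "G \<subseteq> s")
    case True
    then show ?thesis using bwd_result.sat by blast
  next
    case False
    have "\<exists>r. bwd_result D U s (insert G stk) (regress D G a) r" if a: "a \<in> bwd_acts D U stk G" for a
    proof (rule less.hyps)
      have "finite (Pow (atoms D U))" using finite_atoms[OF assms(2)] by simp
      then show "card (Pow (atoms D U) - insert G stk) < card (Pow (atoms D U) - stk)"
        using less.prems by (intro psubset_card_mono) auto
      show "regress D G a \<subseteq> atoms D U"
        using a less.prems(1) by (intro regress_in_atoms[OF assms(1)]) (auto simp: bwd_acts_iff)
      show "regress D G a \<notin> insert G stk" using a by (simp add: bwd_acts_iff)
    qed
    then obtain res where res: "\<And>a. a \<in> bwd_acts D U stk G \<Longrightarrow> bwd_result D U s (insert G stk) (regress D G a) (res a)"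
      by metis
    define recorded where "recorded = {\<pi> @ [a] | \<pi> a. a \<in> bwd_acts D U stk G \<and> res a = Some \<pi>}"
    show ?thesis
    proof (cases "recorded = {}")
      case True
      then have "res a = None" if "a \<in> bwd_acts D U stk G" for a
        using that by (cases "res a"; cases a) (auto simp: recorded_def)
      then show ?thesis using bwd_result.fail[OF False] res by metis
    next
      case ne: False
      then obtain \<pi>0 where "\<pi>0 \<in> recorded" by blast
      then obtain \<pi> where "is_arg_min length (\<lambda>\<pi>. \<pi> \<in> recorded) \<pi>"
        using ex_has_least_nat[of "\<lambda>\<pi>. \<pi> \<in> recorded" \<pi>0 length] unfolding is_arg_min_linorder by blast
      from bwd_result.plan[OF False res recorded_def this] show ?thesis by blast
    qed
  qed
qed

text \<open>All sets on the stack are farther from the state than the length of \<open>bs\<close>,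
  so the next set of a shortest list cannot be among them. This passes on to the recursive call, as
  \<open>G\<close> itself is farther away than its regression. Whatever the other calls return, no
  recorded plan is shorter.\<close>

lemma bwd_result_shortest:
  assumes "wf_domain D" "finite U" "G \<subseteq> atoms D U" "solves D U s G bs"
    and "\<And>cs. solves D U s G cs \<Longrightarrow> length bs \<le> length cs"
    and "\<And>X cs. X \<in> stk \<Longrightarrow> solves D U s X cs \<Longrightarrow> length bs < length cs"
  shows "bwd_result D U s stk G (Some (rev bs))"
  using assms(3-)
proof (induction bs arbitrary: G stk)
  case Nil
  then show ?case using bwd_result.sat by (simp add: solves_Nil)
next
  case (Cons b bs)
  let ?G = "regress D G b"
  have b: "b \<in> ground_actions D U" "applicable D G b" "solves D U s ?G bs"
    using Cons.prems(2) by (simp_all add: solves_Cons)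
  have G: "\<not> G \<subseteq> s" using Cons.prems(3)[of "[]"] by (auto simp: solves_Nil)
  have stk: "length bs < length cs" if "X \<in> insert G stk" "solves D U s X cs" for X cs
    using that Cons.prems(3)[of cs] Cons.prems(4)[of X cs] by auto
  have IH: "bwd_result D U s (insert G stk) ?G (Some (rev bs))"
  proof (rule Cons.IH)
    show "?G \<subseteq> atoms D U" by (rule regress_in_atoms[OF assms(1) b(1) Cons.prems(1)])
    show "solves D U s ?G bs" by (rule b(3))
    show "length bs \<le> length cs" if "solves D U s ?G cs" for cs
      using Cons.prems(3)[of "b # cs"] b that by (simp add: solves_Cons)
  qed (rule stk)
  have act: "b \<in> bwd_acts D U stk G"
    using b stk[of ?G bs] by (auto simp: bwd_acts_iff)
  \<comment> \<open>Where BWD has a choice, the call for \<open>b\<close> is resolved in favour of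
    the given list; any outcome is accepted for the other actions.\<close>
  define res where "res a = (if a = b then Some (rev bs) else
    (SOME r. bwd_result D U s (insert G stk) (regress D G a) r))" for a
  have res: "bwd_result D U s (insert G stk) (regress D G a) (res a)" if a: "a \<in> bwd_acts D U stk G" for a
  proof (cases "a = b")
    case True
    then show ?thesis using IH by (simp add: res_def)
  next
    case False
    have "\<exists>r. bwd_result D U s (insert G stk) (regress D G a) r"
      using a regress_in_atoms[OF assms(1) _ Cons.prems(1)]
      by (intro bwd_result_exists[OF assms(1,2)]) (auto simp: bwd_acts_iff)
    then show ?thesis using False by (simp add: res_def someI_ex)
  qed
  define recorded where "recorded = {\<pi> @ [a] | \<pi> a. a \<in> bwd_acts D U stk G \<and> res a = Some \<pi>}"
  have "is_arg_min length (\<lambda>\<pi>. \<pi> \<in> recorded) (rev (b # bs))"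
    unfolding is_arg_min_linorder
  proof (intro conjI allI impI)
    show "rev (b # bs) \<in> recorded" using act by (cases b) (auto simp: recorded_def res_def)
    fix \<pi> assume "\<pi> \<in> recorded"
    then obtain \<rho> a where a: "\<pi> = \<rho> @ [a]" "a \<in> bwd_acts D U stk G" "res a = Some \<rho>"
      by (auto simp: recorded_def)
    obtain cs where "length cs = length \<rho>" "solves D U s (regress D G a) cs"
      using bwd_result_solves[OF res[OF a(2)] a(3)] by blast
    then show "length (rev (b # bs)) \<le> length \<pi>"
      using Cons.prems(3)[of "a # cs"] a by (auto simp: solves_Cons bwd_acts_iff)
  qed
  from bwd_result.plan[OF G res recorded_def this] show ?case by simp
qed

section \<open>Breadth-first levels and the calls of BWD\<close>

primrec reached :: "('p, 'a) domain \<Rightarrow> 'o set \<Rightarrow> ('p, 'o) atom \<Rightarrow> nat \<Rightarrow> ('p, 'o) atom set set" where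
  "reached D U g 0 = {{g}}"
| "reached D U g (Suc n) = {G. \<exists>H\<in>reached D U g n. \<exists>a\<in>ground_actions D U. applicable D H a \<and> regress D H a = G}"

lemma reached_iff: "G \<in> reached D U g n \<longleftrightarrow>
  (\<exists>bs. length bs = n \<and> regressible D U {g} bs \<and> regressions D {g} bs = G)"
proof (induction n arbitrary: G)
  case (Suc n)
  show ?case
  proof
    assume "G \<in> reached D U g (Suc n)"
    then obtain bs a where "length bs = n" "regressible D U {g} bs"
      "a \<in> ground_actions D U" "applicable D (regressions D {g} bs) a" "regress D (regressions D {g} bs) a = G"
      using Suc by auto
    then show "\<exists>bs. length bs = Suc n \<and> regressible D U {g} bs \<and> regressions D {g} bs = G"
      by (intro exI[of _ "bs @ [a]"]) (auto simp: regressible_append regressions_append)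
  next
    assume "\<exists>bs. length bs = Suc n \<and> regressible D U {g} bs \<and> regressions D {g} bs = G"
    then obtain cs where cs: "length cs = Suc n" "regressible D U {g} cs" "regressions D {g} cs = G" by blast
    then obtain bs a where "cs = bs @ [a]" by (metis length_Suc_conv_rev)
    then show "G \<in> reached D U g (Suc n)"
      using cs Suc by (auto simp: regressible_append regressions_append)
  qed
qed auto

lemma reached_atoms:
  assumes "wf_domain D" "g \<in> atoms D U"
  shows "G \<in> reached D U g n \<Longrightarrow> G \<subseteq> atoms D U"
proof (induction n arbitrary: G)
  case (Suc n)
  then obtain H a where "H \<in> reached D U g n" "a \<in> ground_actions D U" "regress D H a = G" by auto
  then show ?case using Suc.IH[of H] regress_in_atoms[OF assms(1)] by metis
qed (use assms in auto)

lemma finite_bwd_call_cards: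
  assumes "wf_domain D" "finite U" "g \<in> atoms D U"
  shows "finite {card G | stk G. bwd_call D U s g stk G}"
proof -
  have "G \<subseteq> atoms D U" if "bwd_call D U s g stk G" for stk G
    using that
  proof induction
    case (rec stk G a)
    then show ?case using regress_in_atoms[OF assms(1), of a U G] by (simp add: bwd_acts_iff)
  qed (use assms(3) in auto)
  then have "{card G | stk G. bwd_call D U s g stk G} \<subseteq> card ` Pow (atoms D U)" by blast
  then show ?thesis by (rule finite_subset) (simp add: finite_atoms[OF assms(2)])
qed

text \<open>Along a shortest walk no goal set is repeated, so the stack does not prune it.\<close>

lemma reached_bwd_call:
  assumes "G \<in> reached D U g n" "\<And>j. j < n \<Longrightarrow> G \<notin> reached D U g j"
    and "\<And>j H. j < n \<Longrightarrow> H \<in> reached D U g j \<Longrightarrow> \<not> H \<subseteq> s"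
  shows "\<exists>stk. bwd_call D U s g stk G \<and> (\<forall>X\<in>stk. \<exists>j<n. X \<in> reached D U g j)"
  using assms
proof (induction n arbitrary: G)
  case 0
  have "bwd_call D U s g {} {g}" by (rule bwd_call.init)
  with 0 show ?case by (intro exI[of _ "{}"]) simp
next
  case (Suc n)
  then obtain H a where H: "H \<in> reached D U g n" "a \<in> ground_actions D U" "applicable D H a" "regress D H a = G"
    by auto
  have "H \<notin> reached D U g j" if "j < n" for j
    using Suc.prems(2)[of "Suc j"] H that by auto
  with Suc H obtain stk where stk: "bwd_call D U s g stk H" "\<forall>X\<in>stk. \<exists>j<n. X \<in> reached D U g j"
    by (metis less_Suc_eq)
  have "G \<notin> insert H stk"
    using Suc.prems(2)[of n] Suc.prems(2) H(1) stk(2) by (metis insert_iff less_SucI lessI)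
  then have "bwd_call D U s g (insert H stk) G"
    using bwd_call.rec[OF stk(1) Suc.prems(3)[of n H], of a] H by (auto simp: bwd_acts_iff)
  moreover have "\<forall>X\<in>insert H stk. \<exists>j<Suc n. X \<in> reached D U g j"
    using stk(2) H(1) less_SucI by blast
  ultimately show ?case by blast
qed

text \<open>In the first round that reaches \<open>G\<close>, a walk to it repeats no set and, by
  the last assumption, passes no set at which BWD would stop. So BWD calls itself on
  \<open>G\<close>, and the maximum in \<open>k_BWD\<close> covers it.\<close>

lemma reached_card:
  assumes "wf_domain D" "finite U" "g \<in> atoms D U" "G \<in> reached D U g n"
    and "\<And>j H. j < n \<Longrightarrow> H \<in> reached D U g j \<Longrightarrow> \<not> H \<subseteq> s"
  shows "card G \<le> k_BWD D U s g"
proof -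
  define i where "i = (LEAST i. G \<in> reached D U g i)"
  have i: "G \<in> reached D U g i" "i \<le> n"
    using assms(4) LeastI Least_le unfolding i_def by fast+
  have "G \<notin> reached D U g j" if "j < i" for j using that not_less_Least unfolding i_def by blast
  then obtain stk where "bwd_call D U s g stk G"
    using reached_bwd_call[OF i(1), of s] assms(5) i(2) by (meson less_le_trans)
  then show ?thesis unfolding k_BWD_def
    by (intro Max_ge finite_bwd_call_cards[OF assms(1-3)]) auto
qed

lemma card_objs_le:
  assumes "\<And>p. p \<in> set (preds D) \<Longrightarrow> pred_arity D p \<le> \<beta>" "G \<subseteq> atoms D U" "finite G"
  shows "card (objs G) \<le> \<beta> * card G"
proof -
  have "card (objs G) \<le> (\<Sum>A\<in>G. card (set (snd A)))"
    unfolding objs_def using assms(3) by (rule card_UN_le)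
  also have "\<dots> \<le> (\<Sum>A\<in>G. \<beta>)"
  proof (rule sum_mono)
    fix A assume "A \<in> G"
    then have "length (snd A) \<le> \<beta>" using assms(1,2) by (fastforce simp: atoms_def)
    then show "card (set (snd A)) \<le> \<beta>" using card_length le_trans by blast
  qed
  finally show ?thesis by (simp add: mult.commute)
qed

section \<open>The outcome of the rounds\<close>

lemma Least_first:
  fixes j :: nat
  assumes "P j" "\<And>i. i < j \<Longrightarrow> \<not> P i"
  shows "(LEAST i. P i) = j"
  using assms by (metis LeastI linorder_neqE_nat not_less_Least)

lemma LeastI_le: "\<exists>i\<le>n. P i \<Longrightarrow> P (LEAST i. P i)" for n :: nat
  by (rule LeastI_ex) auto

lemma sum_tuples_Cons:
  "(\<Sum>ys\<in>tuples U (Suc m). f ys) = (\<Sum>x\<in>U. \<Sum>ys\<in>tuples U m. f (x # ys))"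
proof -
  have "(\<Sum>x\<in>U. \<Sum>ys\<in>tuples U m. f (x # ys)) = (\<Sum>(x, ys)\<in>U \<times> tuples U m. f (x # ys))"
    by (rule sum.cartesian_product)
  also have "\<dots> = (\<Sum>ys\<in>tuples U (Suc m). f ys)"
    by (rule sum.reindex_bij_witness[of _ "\<lambda>ys. (hd ys, tl ys)" "\<lambda>(x, ys). x # ys"])
       (auto simp: tuples_def length_Suc_conv)
  finally show ?thesis by simp
qed

context bounded_domain
begin

primrec level :: "'o set \<Rightarrow> ('p, 'o) atom \<Rightarrow> nat \<Rightarrow> ('p, 'o) atom set set" where
  "level U g 0 = {{g}}"
| "level U g (Suc n) = {G. card (objs G) \<le> B \<and>
     (\<exists>H\<in>level U g n. \<exists>a\<in>ground_actions D U. applicable D H a \<and> regress D H a = G)}"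

lemma level_subset_reached: "level U g n \<subseteq> reached D U g n"
  by (induction n) auto

text \<open>The atoms a step inserts are preconditions, whose objects are arguments of the action,
  so there are at most \<alpha> new objects per step. This is the origin of
  \<open>R = \<beta> + \<alpha> * T\<close> in \<open>final\<close>.\<close>

lemma level_objs:
  assumes "g \<in> atoms D U"
  shows "G \<in> level U g n \<Longrightarrow> finite (objs G) \<and> card (objs G) \<le> \<beta> + \<alpha> * n"
proof (induction n arbitrary: G)
  case 0
  have "length (snd g) \<le> \<beta>" using assms arity by (auto simp: atoms_def)
  then have "card (objs {g}) \<le> \<beta>" using card_length[of "snd g"] by (simp add: objs_def)
  then show ?case using 0 by (simp add: objs_def)
next
  case (Suc n)
  then obtain H a where H: "H \<in> level U g n" "a \<in> ground_actions D U" "regress D H a = G" by auto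
  have "regress D H a \<subseteq> H \<union> gpre D a" by (auto simp: regress_def)
  from objs_mono[OF this] have sub: "objs G \<subseteq> objs H \<union> set (snd a)"
    using gatoms_in_atoms(4)[OF wf H(2)] H(3) by (auto simp: objs_Un)
  have IH: "finite (objs H)" "card (objs H) \<le> \<beta> + \<alpha> * n" using Suc.IH[OF H(1)] by auto
  obtain b as where a: "a = (b, as)" by (cases a)
  then have "length as \<le> \<alpha>" using H(2) act_arity[of b] by (simp add: ground_actions_def)
  then have "card (set (snd a)) \<le> \<alpha>" using card_length[of as] a by simp
  moreover have "card (objs G) \<le> card (objs H) + card (set (snd a))"
    using card_mono[OF _ sub] card_Un_le[of "objs H" "set (snd a)"] IH(1) by simp
  ultimately show ?case using IH finite_subset[OF sub] by simp
qed

lemma expand_iterate: "objects ((expand ^^ n) e) = objects e" "state ((expand ^^ n) e) = state e" "radius ((expand ^^ n) e) = radius e" "best ((expand ^^ n) e) = best e" "cnt ((expand ^^ n) e) = cnt e"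
  by (induction n; simp add: expand_def)+

lemma age_expand_step: "age (expand e) G = (if age e G > 0 then Suc (age e G) else of_bool (fresh e G))"
  by (simp add: expand_def)

text \<open>Expanding sets of age 1 only loses nothing: if a predecessor of \<open>G\<close> had
  been reached before round \<open>n\<close>, then \<open>G\<close> would have an age
  already.\<close>

lemma age_expand:
  assumes "age e = (\<lambda>G. of_bool (G = {g}))"
  shows "age ((expand ^^ n) e) G =
    (if \<exists>i\<le>n. G \<in> level (objects e) g i then Suc n - (LEAST i. G \<in> level (objects e) g i) else 0)"
proof (induction n arbitrary: G)
  case 0
  show ?case
  proof (cases "G = {g}")
    case True
    then have "(LEAST i. G \<in> level (objects e) g i) = 0" by (intro Least_eq_0) simp
    then show ?thesis using True assms by simp
  qed (use assms in simp)
next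
  case (Suc n)
  let ?e = "(expand ^^ n) e" and ?L = "level (objects e) g"
  have objs: "objects ?e = objects e" by (simp add: expand_iterate)
  have age_Suc: "age ((expand ^^ Suc n) e) G = (if age ?e G > 0 then Suc (age ?e G) else of_bool (fresh ?e G))"
    by (simp add: age_expand_step)
  have one: "age ?e H = 1 \<longleftrightarrow> H \<in> ?L n \<and> (\<forall>i<n. H \<notin> ?L i)" for H
  proof
    assume *: "age ?e H = 1"
    then have ex: "\<exists>i\<le>n. H \<in> ?L i" and eq: "Suc n - (LEAST i. H \<in> ?L i) = 1"
      using Suc[of H] by (auto split: if_splits)
    then have "(LEAST i. H \<in> ?L i) = n" by linarith
    moreover have "H \<in> ?L (LEAST i. H \<in> ?L i)" by (rule LeastI_le[OF ex])
    ultimately show "H \<in> ?L n \<and> (\<forall>i<n. H \<notin> ?L i)" using not_less_Least[of _ "\<lambda>i. H \<in> ?L i"] by auto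
  next
    assume "H \<in> ?L n \<and> (\<forall>i<n. H \<notin> ?L i)"
    then have "(LEAST i. H \<in> ?L i) = n" by (intro Least_first) auto
    then show "age ?e H = 1" using Suc[of H] \<open>H \<in> ?L n \<and> _\<close> by auto
  qed
  show ?case
  proof (cases "\<exists>i\<le>n. G \<in> ?L i")
    case True
    then have "(LEAST i. G \<in> ?L i) \<le> n" using Least_le le_trans by meson
    then have "age ((expand ^^ Suc n) e) G = Suc (Suc n) - (LEAST i. G \<in> ?L i)"
      using True Suc[of G] unfolding age_Suc by simp
    moreover have "\<exists>i\<le>Suc n. G \<in> ?L i" using True le_Suc_eq by blast
    ultimately show ?thesis by simp
  next
    case False
    have 0: "age ?e G = 0" using Suc[of G] unfolding if_not_P[OF False] .
    have fresh: "fresh ?e G \<longleftrightarrow> G \<in> ?L (Suc n)"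
    proof
      assume "G \<in> ?L (Suc n)"
      then obtain H a where H: "card (objs G) \<le> B" "H \<in> ?L n" "a \<in> ground_actions D (objects e)"
        "applicable D H a" "regress D H a = G" by auto
      have "H \<notin> ?L i" if "i < n" for i
      proof
        assume "H \<in> ?L i"
        then have "G \<in> ?L (Suc i)" using H by auto
        with False that show False by (meson Suc_leI)
      qed
      then have "age ?e H = 1" using one H(2) by blast
      then show "fresh ?e G" unfolding fresh_def objs using H by blast
    next
      assume "fresh ?e G"
      then obtain H a where H: "card (objs G) \<le> B" "age ?e H = 1" "a \<in> ground_actions D (objects e)"
        "applicable D H a" "regress D H a = G" unfolding fresh_def objs by blast
      then have "H \<in> ?L n" using one by blast
      with H show "G \<in> ?L (Suc n)" by auto
    qed
    show ?thesis
    proof (cases "G \<in> ?L (Suc n)")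
      case True
      then have "(LEAST i. G \<in> ?L i) = Suc n"
        using False True by (intro Least_first) (auto simp: less_Suc_eq_le simp del: level.simps)
      moreover have "\<exists>i\<le>Suc n. G \<in> ?L i" using True by blast
      ultimately show ?thesis unfolding age_Suc using 0 fresh True by simp
    next
      case no: False
      then have none: "\<not> (\<exists>i\<le>Suc n. G \<in> ?L i)" using False by (metis le_Suc_eq)
      have "\<not> fresh ?e G" using fresh no by blast
      then show ?thesis unfolding age_Suc if_not_P[OF none] using 0 by simp
    qed
  qed
qed

lemma grow_iterate: "objects ((grow ^^ n) e) = objects e" "state ((grow ^^ n) e) = state e" "age ((grow ^^ n) e) = age e" "best ((grow ^^ n) e) = best e" "cnt ((grow ^^ n) e) = cnt e" "radius ((grow ^^ n) e) = radius e + n"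
  by (induction n; simp add: grow_def)+

lemma spread_fields: "objects (spread e) = objects e" "state (spread e) = state e" "radius (spread e) = radius e" "age (spread e) = age e" "cnt (spread e) = cnt e"
  by (simp_all add: spread_def)

lemma spread_iterate: "objects ((spread ^^ n) e) = objects e" "state ((spread ^^ n) e) = state e" "radius ((spread ^^ n) e) = radius e" "age ((spread ^^ n) e) = age e" "cnt ((spread ^^ n) e) = cnt e"
  by (induction n; simp only: funpow.simps id_apply o_apply spread_fields)+

lemma tally_iterate: "objects ((tally ^^ n) e) = objects e" "state ((tally ^^ n) e) = state e" "radius ((tally ^^ n) e) = radius e" "age ((tally ^^ n) e) = age e" "best ((tally ^^ n) e) = best e"
  by (induction n; simp add: tally_def)+

lemma best_spread_step:
  "best (spread e) xs = max (max (best e xs) (local_best e xs))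
     (max (if xs = [] then 0 else best e (butlast xs))
       (if length xs < B then Max ((\<lambda>x. best e (xs @ [x])) ` objects e) else 0))"
  by (simp add: spread_def)

lemma best_spread_le:
  assumes e: "wf_search e" "best e = (\<lambda>_. 0)" and A: "\<And>G. G \<subseteq> state e \<Longrightarrow> age e G \<le> A"
  shows "best ((spread ^^ n) e) xs \<le> A"
proof (induction n arbitrary: xs)
  case 0
  then show ?case using e(2) by simp
next
  case (Suc n)
  let ?e = "(spread ^^ n) e"
  have same: "objects ?e = objects e" "state ?e = state e" "age ?e = age e" "radius ?e = radius e"
    by (simp_all only: spread_iterate)
  have "inst xs ` \<Gamma> \<subseteq> state e" if "sat ?e xs \<Gamma>" for \<Gamma> using that same by (auto simp: sat_def)
  then have "local_best ?e xs \<le> A"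
    unfolding local_best_def same using A finite_patterns by (subst Max_le_iff) auto
  moreover have "Max ((\<lambda>x. best ?e (xs @ [x])) ` objects ?e) \<le> A"
    using e(1) Suc unfolding same wf_search_def by (subst Max_le_iff) auto
  moreover have "best ((spread ^^ Suc n) e) xs = max (max (best ?e xs) (local_best ?e xs))
     (max (if xs = [] then 0 else best ?e (butlast xs))
       (if length xs < B then Max ((\<lambda>x. best ?e (xs @ [x])) ` objects ?e) else 0))"
    by (simp only: funpow.simps o_apply best_spread_step)
  ultimately show ?case using Suc[of xs] Suc[of "butlast xs"] by (simp only:) simp
qed

text \<open>One round evaluates \<open>G\<close> at a tuple enumerating its objects, at most
  \<open>R\<close> rounds carry the value down to the empty tuple, and the remaining ones, at least
  \<open>R\<close>, carry it up to all tuples of length at most \<open>R\<close>. Values never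
  decrease, and none exceeds \<open>A\<close> by \<open>best_spread_le\<close>.\<close>

lemma best_spread:
  assumes e: "wf_search e" "best e = (\<lambda>_. 0)" and A: "\<And>G. G \<subseteq> state e \<Longrightarrow> age e G \<le> A"
    and G: "G \<subseteq> state e" "age e G = A" "0 < A" "card (objs G) \<le> R" "R \<le> radius e"
    and xs: "length xs \<le> R"
  shows "best ((spread ^^ (1 + 2 * R)) e) xs = A"
proof -
  have step: "best ((spread ^^ Suc n) e) xs \<ge> best ((spread ^^ n) e) xs"
    "xs \<noteq> [] \<Longrightarrow> best ((spread ^^ Suc n) e) xs \<ge> best ((spread ^^ n) e) (butlast xs)"
    "local_best ((spread ^^ n) e) xs \<le> best ((spread ^^ Suc n) e) xs" for n xs
    by (simp_all only: funpow.simps o_apply best_spread_step) simp_all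
  have same: "objects ((spread ^^ n) e) = objects e" "state ((spread ^^ n) e) = state e"
    "age ((spread ^^ n) e) = age e" "radius ((spread ^^ n) e) = radius e" for n
    by (simp_all only: spread_iterate)
  have ext: "best ((spread ^^ Suc n) e) xs \<ge> best ((spread ^^ n) e) (xs @ [x])"
    if "x \<in> objects e" "length xs < B" for n xs x
  proof -
    have "best ((spread ^^ n) e) (xs @ [x]) \<le> Max ((\<lambda>x. best ((spread ^^ n) e) (xs @ [x])) ` objects e)"
      using that e(1) by (intro Max_ge) (auto simp: wf_search_def)
    then show ?thesis using that(2) same(1)[of n] by (simp only: funpow.simps o_apply best_spread_step) simp
  qed
  have GB: "G \<subseteq> atoms D (objects e)" "card (objs G) \<le> B"
    using e(1) G(2,3) by (auto simp: wf_search_def)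
  have "finite (objs G)" using objs_subset[OF GB(1)] e(1) finite_subset by (auto simp: wf_search_def)
  then obtain ys where ys: "distinct ys" "set ys = objs G" using finite_distinct_list by blast
  let ?r = "length ys"
  have r: "?r \<le> R" "?r \<le> B" using distinct_card[OF ys(1)] ys(2) G(4) GB(2) by simp_all
  obtain \<Gamma> where \<Gamma>: "inst ys ` \<Gamma> = G" "pattern D ?r \<Gamma>"
    using pattern_exists[OF GB(1) ys(2)] ys(1) by blast
  have "A \<le> best ((spread ^^ (1 + j)) e) (take (?r - j) ys)" if "j \<le> ?r" for j
    using that
  proof (induction j)
    case 0
    have "sat e ys \<Gamma>" using \<Gamma>(1) G(1,5) r(1) by (auto simp: sat_def)
    then have "A \<le> local_best e ys"
      unfolding local_best_def using \<Gamma> ys(1) G(2) finite_patterns[of ?r] by (intro Max_ge) force+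
    then show ?case using step(3)[of 0 ys] by simp
  next
    case (Suc j)
    let ?q = "?r - Suc j"
    have "take (?r - j) ys = take ?q ys @ [ys ! ?q]"
      using Suc.prems by (metis Suc_diff_Suc Suc_le_lessD diff_less length_greater_0_conv list.size(3) not_less0 take_Suc_conv_app_nth zero_less_Suc)
    moreover have "ys ! ?q \<in> objects e"
      using ys(2) objs_subset[OF GB(1)] Suc.prems nth_mem[of ?q ys] by auto
    moreover have "length (take ?q ys) < B" using Suc.prems r(2) by simp
    ultimately have "A \<le> best ((spread ^^ Suc (1 + j)) e) (take ?q ys)"
      using Suc.IH Suc.prems ext[of "ys ! ?q" "take ?q ys" "1 + j"] by simp
    then show ?case by simp
  qed
  from this[of ?r] have top: "A \<le> best ((spread ^^ (1 + ?r)) e) []" by simp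
  \<comment> \<open>The way back: each further round reaches tuples longer by one, which copy the
    value from their \<open>butlast\<close>.\<close>
  have down: "A \<le> best ((spread ^^ (1 + ?r + j)) e) xs" if "length xs \<le> j" for j xs
    using that
  proof (induction j arbitrary: xs)
    case 0
    then show ?case using top by simp
  next
    case (Suc j)
    show ?case
    proof (cases "xs = []")
      case True
      then show ?thesis using Suc.IH[of xs] step(1)[of "1 + ?r + j" xs] by simp
    next
      case False
      then have "A \<le> best ((spread ^^ (1 + ?r + j)) e) (butlast xs)" using Suc by simp
      then show ?thesis using step(2)[OF False, of "1 + ?r + j"] by simp
    qed
  qed
  have "1 + ?r + (2 * R - ?r) = 1 + 2 * R" using r(1) by simp
  then have "A \<le> best ((spread ^^ (1 + 2 * R)) e) xs"
    using down[of xs "2 * R - ?r"] xs r(1) by simp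
  with best_spread_le[OF e A, of "1 + 2 * R" xs] show ?thesis by simp
qed

lemma cnt_tally_step:
  "cnt (tally e) \<Gamma> \<Delta> 0 xs = of_bool (distinct xs \<and> age e (inst xs ` \<Gamma>) = Suc (best e xs) \<and> sat e xs \<Delta>)"
  "cnt (tally e) \<Gamma> \<Delta> (Suc i) xs = (\<Sum>x\<in>objects e. cnt e \<Gamma> \<Delta> i (xs @ [x]))"
  by (simp_all add: tally_def)

text \<open>A round recomputes all counts from those of the round before, so the sum over
  \<open>j\<close> objects is right after \<open>j + 1\<close> rounds and rests on the initial 0
  until then. Tuples longer than \<open>R\<close>, where \<open>best\<close> is not controlled,
  carry no goal set with an age and count nothing in any case.\<close>

lemma cnt_tally:
  assumes best: "\<And>xs. length xs \<le> R \<Longrightarrow> best e xs = best e []"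
    and small: "\<And>G. age e G > 0 \<Longrightarrow> card (objs G) \<le> R" and R: "R \<le> radius e"
    and cnt: "cnt e = (\<lambda>_ _ _ _. 0)"
    and \<Gamma>: "pattern D (length xs + j) \<Gamma>"
  shows "cnt ((tally ^^ n) e) \<Gamma> \<Delta> j xs = (if j < n then \<Sum>ys\<in>tuples (objects e) j.
    of_bool (distinct (xs @ ys) \<and> candidate e (inst (xs @ ys) ` \<Gamma>) \<and> inst (xs @ ys) ` \<Delta> \<subseteq> state e) else 0)"
  using \<Gamma>
proof (induction n arbitrary: j xs)
  case 0
  then show ?case using cnt by simp
next
  case (Suc n)
  let ?e = "(tally ^^ n) e"
  have same: "objects ?e = objects e" "state ?e = state e" "age ?e = age e" "radius ?e = radius e" "best ?e = best e"
    by (simp_all only: tally_iterate)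
  have sat: "sat ?e = sat e" by (auto simp: sat_def same fun_eq_iff)
  show ?case
  proof (cases j)
    case 0
    have "(distinct xs \<and> age e (inst xs ` \<Gamma>) = Suc (best e xs) \<and> sat e xs \<Delta>) \<longleftrightarrow>
        (distinct xs \<and> candidate e (inst xs ` \<Gamma>) \<and> inst xs ` \<Delta> \<subseteq> state e)"
    proof (cases "distinct xs \<and> age e (inst xs ` \<Gamma>) > 0")
      case True
      then have "length xs \<le> R"
        using small[of "inst xs ` \<Gamma>"] card_objs_pattern[of "length xs" \<Gamma> xs] Suc.prems 0 by simp
      then show ?thesis using best[of xs] R by (auto simp: candidate_def sat_def)
    qed (auto simp: candidate_def)
    moreover have "tuples (objects e) 0 = {[]}" by (auto simp: tuples_def)
    ultimately show ?thesis using 0 by (simp add: cnt_tally_step same sat)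
  next
    case (Suc i)
    have "cnt ((tally ^^ Suc n) e) \<Gamma> \<Delta> j xs = (\<Sum>x\<in>objects e. cnt ?e \<Gamma> \<Delta> i (xs @ [x]))"
      by (simp add: cnt_tally_step Suc same)
    also have "\<dots> = (\<Sum>x\<in>objects e. if i < n then \<Sum>ys\<in>tuples (objects e) i.
        of_bool (distinct (xs @ x # ys) \<and> candidate e (inst (xs @ x # ys) ` \<Gamma>) \<and> inst (xs @ x # ys) ` \<Delta> \<subseteq> state e) else 0)"
      using Suc.IH[of "xs @ [_]" i] Suc.prems Suc by (intro sum.cong refl) simp
    also have "\<dots> = (if j < Suc n then \<Sum>ys\<in>tuples (objects e) j.
        of_bool (distinct (xs @ ys) \<and> candidate e (inst (xs @ ys) ` \<Gamma>) \<and> inst (xs @ ys) ` \<Delta> \<subseteq> state e) else 0)"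
      unfolding Suc sum_tuples_Cons by simp
    finally show ?thesis .
  qed
qed

lemma tallied_tally:
  assumes best: "\<And>xs. length xs \<le> R \<Longrightarrow> best e xs = best e []"
    and small: "\<And>G. age e G > 0 \<Longrightarrow> card (objs G) \<le> R" and R: "R \<le> radius e"
    and cnt: "cnt e = (\<lambda>_ _ _ _. 0)"
  shows "tallied D B ((tally ^^ Suc R) e)"
  unfolding tallied_def
proof (intro allI impI)
  fix \<Gamma> \<Delta> j and xs :: "'b list"
  let ?e = "(tally ^^ Suc R) e"
  assume \<Gamma>: "pattern D (length xs + j) \<Gamma>"
  have same: "objects ?e = objects e" "state ?e = state e" "age ?e = age e" "best ?e = best e"
    by (simp_all only: tally_iterate)
  let ?P = "\<lambda>ys. distinct (xs @ ys) \<and> candidate e (inst (xs @ ys) ` \<Gamma>) \<and> inst (xs @ ys) ` \<Delta> \<subseteq> state e"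
  have "cnt ?e \<Gamma> \<Delta> j xs = (\<Sum>ys\<in>tuples (objects e) j. of_bool (?P ys))"
  proof (cases "j < Suc R")
    case True
    then show ?thesis using cnt_tally[OF best small R cnt \<Gamma>, of "Suc R" \<Delta>] by simp
  next
    case False
    \<comment> \<open>Such a pattern has more than \<open>R\<close> objects, hence no candidate is
      an instance of it at distinct objects, and the initial 0 is already the correct count.\<close>
    have "\<not> ?P ys" if "ys \<in> tuples (objects e) j" for ys
    proof
      assume P: "?P ys"
      have "length (xs @ ys) = length xs + j" using that by (simp add: tuples_def)
      with P have "card (objs (inst (xs @ ys) ` \<Gamma>)) = length xs + j"
        using card_objs_pattern[OF \<Gamma>, of "xs @ ys"] by simp
      moreover have "card (objs (inst (xs @ ys) ` \<Gamma>)) \<le> R"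
        using P by (intro small) (simp add: candidate_def)
      ultimately show False using False by simp
    qed
    then have "(\<Sum>ys\<in>tuples (objects e) j. of_bool (?P ys)) = (\<Sum>ys\<in>tuples (objects e) j. 0 :: real)"
      by (intro sum.cong) auto
    then show ?thesis using cnt_tally[OF best small R cnt \<Gamma>, of "Suc R" \<Delta>] False by simp
  qed
  then show "cnt ?e \<Gamma> \<Delta> j xs = (\<Sum>ys\<in>tuples (objects ?e) j. of_bool (distinct (xs @ ys) \<and>
      age ?e (inst (xs @ ys) ` \<Gamma>) = Suc (best ?e []) \<and> inst (xs @ ys) ` \<Delta> \<subseteq> state ?e))"
    unfolding same candidate_def .
qed

text \<open>\<open>R\<close> bounds the number of objects of all goal sets reached in
  \<open>T\<close> rounds. The radius starts at \<beta>, so \<open>\<alpha> * T\<close> rounds of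
  \<open>grow\<close> raise it to \<open>R\<close>; the last two numbers of rounds are those of
  \<open>best_spread\<close> and \<open>tallied_tally\<close>.\<close>

definition final :: "nat \<Rightarrow> 'o set \<times> ('p, 'o) atom set \<times> ('p, 'o) atom \<Rightarrow> ('p, 'o) search" where
  "final T e = (let R = \<beta> + \<alpha> * T in
     (tally ^^ Suc R) ((spread ^^ (1 + 2 * R)) ((expand ^^ T) ((grow ^^ (\<alpha> * T)) (start e)))))"

text \<open>\<open>T\<close> only bounds the length \<open>d\<close> of a shortest regression and
  the search runs on after round \<open>d\<close>. This is harmless: sets first reached later are
  younger, so the largest age among the sets holding in the state still marks round
  \<open>d\<close>, and an action taking a set of round \<open>d - 1\<close> into the state
  completes a shortest regression, which BWD may return.\<close>

lemma final_correct:
  assumes U: "finite U" "U \<noteq> {}" and g: "g \<in> atoms D U" "g \<notin> s"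
    and k: "\<beta> * k_BWD D U s g \<le> B" and bs: "solves D U s {g} bs" "length bs \<le> T"
  defines "e \<equiv> final T (U, s, g)"
  shows "tallied D B e" "objects e = U" "state e = s"
    and "\<exists>G. candidate e G \<and> (\<exists>a\<in>ground_actions D U. applicable D G a \<and> regress D G a \<subseteq> s)"
    and "candidate e G \<Longrightarrow> a \<in> ground_actions D U \<Longrightarrow> applicable D G a \<Longrightarrow> regress D G a \<subseteq> s \<Longrightarrow>
      \<exists>\<pi>. bwd_result D U s {} {g} (Some (a # \<pi>))"
proof -
  let ?R = "\<beta> + \<alpha> * T"
  define d where "d = (LEAST d. \<exists>bs. solves D U s {g} bs \<and> length bs = d)"
  obtain bs0 where bs0: "solves D U s {g} bs0" "length bs0 = d"
    using LeastI[of "\<lambda>d. \<exists>bs. solves D U s {g} bs \<and> length bs = d" "length bs"] bs(1) unfolding d_def by blast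
  have d_le: "d \<le> length cs" if "solves D U s {g} cs" for cs
    unfolding d_def by (rule Least_le) (use that in blast)
  have "d \<noteq> 0" using bs0 g(2) by (auto simp: solves_Nil)
  then obtain d' where d': "d = Suc d'" by (cases d) auto
  have dT: "d \<le> T" using d_le[OF bs(1)] bs(2) by simp
  have unsat: "\<not> H \<subseteq> s" if "H \<in> reached D U g j" "j < d" for H j
    using that d_le unfolding reached_iff solves_def by fastforce
  \<comment> \<open>Up to round \<open>d\<close> no earlier set holds in the state, so each reached
    set is the argument of a call of BWD. The breadth therefore suffices for it, and no set is
    dropped by then.\<close>
  have card_reached: "card (objs H) \<le> B" if H: "H \<in> reached D U g j" "j \<le> d" for H j
  proof -
    have HU: "H \<subseteq> atoms D U" by (rule reached_atoms[OF wf g(1) H(1)])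
    then have "finite H" using finite_atoms[OF U(1)] finite_subset by blast
    then have "card (objs H) \<le> \<beta> * card H" using card_objs_le[OF arity HU] by blast
    moreover have "card H \<le> k_BWD D U s g"
      using reached_card[OF wf U(1) g(1) H(1)] unsat H(2) by (meson less_le_trans)
    then have "\<beta> * card H \<le> \<beta> * k_BWD D U s g" by simp
    ultimately show ?thesis using k by linarith
  qed
  have level: "level U g j = reached D U g j" if "j \<le> d" for j
    using that
  proof (induction j)
    case (Suc j)
    then have "level U g j = reached D U g j" by simp
    moreover have "card (objs G) \<le> B" if "G \<in> reached D U g (Suc j)" for G
      by (rule card_reached[OF that Suc.prems])
    ultimately show ?case by auto
  qed simp
  define e1 where "e1 = (grow ^^ (\<alpha> * T)) (start (U, s, g))"
  define e2 where "e2 = (expand ^^ T) e1"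
  define e3 where "e3 = (spread ^^ (1 + 2 * ?R)) e2"
  have e: "e = (tally ^^ Suc ?R) e3" unfolding e_def final_def e1_def e2_def e3_def Let_def ..
  have e1: "objects e1 = U" "state e1 = s" "radius e1 = ?R" "age e1 = (\<lambda>G. of_bool (G = {g}))"
    "best e1 = (\<lambda>_. 0)" "cnt e1 = (\<lambda>_ _ _ _. 0)"
    by (simp_all add: e1_def grow_iterate start_def)
  have e2: "objects e2 = U" "state e2 = s" "radius e2 = ?R" "best e2 = (\<lambda>_. 0)" "cnt e2 = (\<lambda>_ _ _ _. 0)"
    unfolding e2_def by (simp_all add: expand_iterate e1)
  have e3: "objects e3 = U" "state e3 = s" "radius e3 = ?R" "age e3 = age e2" "cnt e3 = (\<lambda>_ _ _ _. 0)"
    unfolding e3_def by (simp_all only: spread_iterate e2)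
  have e4: "objects e = U" "state e = s" "age e = age e2" "best e = best e3"
    unfolding e by (simp_all only: tally_iterate e3)
  have age: "age e2 G = (if \<exists>i\<le>T. G \<in> level U g i then Suc T - (LEAST i. G \<in> level U g i) else 0)" for G
    using age_expand[OF e1(4), of T G] unfolding e2_def e1(1) .
  have "card (objs {g}) \<le> B" using level_objs[OF g(1), of "{g}" 0] breadth by simp
  then have "wf_search e1" using U g(1) by (auto simp: wf_search_def e1)
  then have wf2: "wf_search e2"
    unfolding e2_def by (induction T) (auto intro: wf_search_expand)
  \<comment> \<open>The age after \<open>T\<close> rounds of a set first reached in round
    \<open>d\<close>.\<close>
  define A where "A = Suc T - d"
  have A: "0 < A" using dT by (simp add: A_def)
  have least: "(LEAST i. H \<in> level U g i) = j" if "H \<in> level U g j" "\<And>i. i < j \<Longrightarrow> H \<notin> level U g i" for H j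
    using that by (rule Least_first)
  have A_le: "age e2 G \<le> A" if "G \<subseteq> s" for G
  proof (cases "\<exists>i\<le>T. G \<in> level U g i")
    case True
    then have "G \<in> level U g (LEAST i. G \<in> level U g i)" by (rule LeastI_le)
    then have "\<not> (LEAST i. G \<in> level U g i) < d" using unsat that level_subset_reached by blast
    then show ?thesis using age[of G] unfolding if_P[OF True] by (simp add: A_def)
  next
    case False
    then show ?thesis using age[of G] unfolding if_not_P[OF False] by simp
  qed
  let ?Gd = "regressions D {g} bs0"
  have Gd: "?Gd \<in> level U g d" "?Gd \<subseteq> s"
    using bs0 level[of d] by (auto simp: reached_iff solves_def)
  have "(LEAST i. ?Gd \<in> level U g i) = d"
    using Gd unsat level_subset_reached by (intro least) blast+
  then have ageGd: "age e2 ?Gd = A" using age[of ?Gd] Gd(1) dT by (auto simp: A_def)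
  have small: "card (objs G) \<le> ?R" if "age e2 G > 0" for G
  proof -
    obtain i where i: "i \<le> T" "G \<in> level U g i" using \<open>age e2 G > 0\<close> age[of G] by (auto split: if_splits)
    then have "card (objs G) \<le> \<beta> + \<alpha> * i" using level_objs[OF g(1)] by blast
    also have "\<dots> \<le> ?R" using i(1) by simp
    finally show ?thesis .
  qed
  have best: "best e3 xs = A" if "length xs \<le> ?R" for xs
    unfolding e3_def
    by (rule best_spread[OF wf2 e2(4) _ _ ageGd A _ _ that]) (use A_le e2 Gd small[of ?Gd] ageGd A in auto)
  show "tallied D B e"
    unfolding e by (rule tallied_tally) (use best e3 small in auto)
  show "objects e = U" "state e = s" by (simp_all add: e4)
  \<comment> \<open>\<open>best\<close> has become \<open>A\<close> everywhere relevant, so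
    candidates are older by one: they were first reached in round \<open>d' = d - 1\<close>.\<close>
  have cand: "candidate e G \<longleftrightarrow> G \<in> level U g d' \<and> (\<forall>i<d'. G \<notin> level U g i)" for G
  proof -
    have "candidate e G \<longleftrightarrow> age e2 G = Suc A" using best[of "[]"] by (simp add: candidate_def e4)
    also have "\<dots> \<longleftrightarrow> G \<in> level U g d' \<and> (\<forall>i<d'. G \<notin> level U g i)"
    proof
      assume *: "age e2 G = Suc A"
      then have ex: "\<exists>i\<le>T. G \<in> level U g i" and eq: "Suc T - (LEAST i. G \<in> level U g i) = Suc A"
        using age[of G] by (auto split: if_splits)
      have "(LEAST i. G \<in> level U g i) = d'" using eq dT by (simp add: A_def d')
      moreover have "G \<in> level U g (LEAST i. G \<in> level U g i)" by (rule LeastI_le[OF ex])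
      ultimately show "G \<in> level U g d' \<and> (\<forall>i<d'. G \<notin> level U g i)"
        using not_less_Least[of _ "\<lambda>i. G \<in> level U g i"] by auto
    next
      assume *: "G \<in> level U g d' \<and> (\<forall>i<d'. G \<notin> level U g i)"
      then have "(LEAST i. G \<in> level U g i) = d'" by (intro least) auto
      moreover have "\<exists>i\<le>T. G \<in> level U g i" using * dT d' by (intro exI[of _ d']) simp
      ultimately show "age e2 G = Suc A" using age[of G] dT d' by (simp add: A_def)
    qed
    finally show ?thesis .
  qed
  obtain H b where H: "H \<in> level U g d'" "b \<in> ground_actions D U" "applicable D H b" "regress D H b = ?Gd"
    using Gd(1) by (auto simp: d')
  have "H \<notin> level U g i" if "i < d'" for i
  proof
    assume "H \<in> level U g i"
    then have "?Gd \<in> reached D U g (Suc i)" using H level_subset_reached[of U g i] by auto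
    with unsat[of ?Gd "Suc i"] Gd(2) that show False by (simp add: d')
  qed
  then show "\<exists>G. candidate e G \<and> (\<exists>a\<in>ground_actions D U. applicable D G a \<and> regress D G a \<subseteq> s)"
    using cand H Gd(2) by (metis)
  assume G: "candidate e G" "a \<in> ground_actions D U" "applicable D G a" "regress D G a \<subseteq> s"
  have "G \<in> reached D U g d'" using cand G(1) level_subset_reached by blast
  then obtain cs where cs: "length cs = d'" "regressible D U {g} cs" "regressions D {g} cs = G"
    unfolding reached_iff by blast
  then have "solves D U s {g} (cs @ [a])"
    using G by (simp add: solves_def regressible_append regressions_append)
  then have "bwd_result D U s {} {g} (Some (rev (cs @ [a])))"
    using d_le cs(1) g(1) by (intro bwd_result_shortest[OF wf U(1)]) (auto simp: d')
  then show "\<exists>\<pi>. bwd_result D U s {} {g} (Some (a # \<pi>))" by auto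
qed

end

section \<open>Assembling the network\<close>

context bounded_domain
begin

text \<open>One summand for each stage of the network, namely the number of its rounds times the
  length of its block. The breadth does not occur, so the depth can be chosen before
  \<open>k\<close>.\<close>

definition depth_bound :: "nat \<Rightarrow> nat" where
  "depth_bound T = (4 * \<beta> + 2) + 2 * (\<alpha> * T) + (2 * \<alpha> + 3) * T + 2 * (1 + 2 * (\<beta> + \<alpha> * T)) +
     2 * Suc (\<beta> + \<alpha> * T) + (\<alpha> + 2)"

lemma funpow_invariant:
  assumes "\<And>e. P e \<Longrightarrow> P (R e)" "P e"
  shows "P ((R ^^ n) e)"
  using assms by (induction n) auto

definition correct_scores :: "nat \<Rightarrow> 'a relnn \<Rightarrow> 'o set \<Rightarrow> ('p, 'o) atom set \<Rightarrow> ('p, 'o) atom \<Rightarrow> bool" where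
  "correct_scores T N U s g \<longleftrightarrow> (\<forall>(b, xs) \<in> ground_actions D U.
     score D N U s g (b, xs) = of_bool (\<exists>G. candidate (final T (U, s, g)) G \<and>
        applicable D G (b, xs) \<and> regress D G (b, xs) \<subseteq> state (final T (U, s, g))))"

text \<open>The six blocks are fixed first and \<open>w\<close> is the largest of their widths;
  \<open>T\<close> merely determines how often the middle four are repeated.\<close>

lemma network_exists:
  "\<exists>w. \<forall>T. \<exists>N \<in> RelNN (depth_bound T) B w. \<forall>(U :: 'o set) s g. finite U \<longrightarrow> U \<noteq> {} \<longrightarrow>
     g \<in> atoms D U \<longrightarrow> tallied D B (final T (U, s, g)) \<longrightarrow> correct_scores T N U s g"
proof -
  \<comment> \<open>Each stage works on its own class of environments: \<open>grow\<close> needs the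
    goal sets with an age to be small, the readout needs finished counts. As
    \<open>represents\<close> does not refer to validity, the stages can nevertheless be
    chained.\<close>
  let ?valid0 = "\<lambda>e :: 'o set \<times> ('p, 'o) atom set \<times> ('p, 'o) atom.
    finite (fst e) \<and> fst e \<noteq> {} \<and> snd (snd e) \<in> atoms D (fst e)"
  let ?validA = "\<lambda>e :: ('p, 'o) search. wf_search e \<and> (\<forall>G. age e G > 0 \<longrightarrow> card (objs G) \<le> \<beta>)"
  let ?validB = "wf_search :: ('p, 'o) search \<Rightarrow> bool"
  let ?validF = "\<lambda>e :: ('p, 'o) search. wf_search e \<and> tallied D B e"
  interpret I: input_net D \<beta> \<alpha> B ?valid0 by unfold_locales auto
  interpret A: search_net D \<beta> \<alpha> B ?validA by unfold_locales (auto simp: wf_search_def)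
  interpret S: search_net D \<beta> \<alpha> B ?validB by unfold_locales (auto simp: wf_search_def)
  interpret F: search_net D \<beta> \<alpha> B ?validF by unfold_locales (auto simp: wf_search_def)
  let ?layers = "\<lambda>(U :: 'o set) Ls h. fold (layer_apply B U) Ls h"
  have "set (map (\<lambda>\<phi> e. val \<phi> (start e)) (features_list r)) \<subseteq> I.cmp (input_list D) (4 * \<beta> + 1) r" if "r \<le> B" for r
    using I.start_cmp[OF _ that] by (auto simp: set_features_list)
  from I.block_exists[OF this] obtain L0 w0 where L0: "length L0 = Suc (4 * \<beta> + 1)" "mlps B w0 L0"
    "\<And>e h. ?valid0 e \<Longrightarrow> I.represents (input_list D) e h \<Longrightarrow>
       I.represents (\<lambda>r. map (\<lambda>\<phi> e. val \<phi> (start e)) (features_list r)) e (?layers (fst e) L0 h)" by blast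
  have "(\<lambda>e. f (grow e)) \<in> A.cmp feats 1 r" if "r \<le> B" "f \<in> set (feats r)" for r f
    using that A.grow_cmp by (auto simp: feats_def set_features_list)
  moreover have "?validA (grow e)" if "?validA e" for e
    using that wf_search_grow[of e] by (simp add: grow_def)
  moreover have "objects (grow e) = objects e" for e :: "('p, 'o) search" by (simp add: grow_def)
  ultimately obtain LA wA where LA: "length LA = Suc 1" "mlps B wA LA"
    "\<And>e h n. ?validA e \<Longrightarrow> A.represents feats e h \<Longrightarrow>
       A.represents feats ((grow ^^ n) e) (?layers (objects e) (concat (replicate n LA)) h)"
    using A.round_exists[of feats grow 1] by blast
  have "(\<lambda>e. f (expand e)) \<in> S.cmp feats (2 * \<alpha> + 2) r" if "r \<le> B" "f \<in> set (feats r)" for r f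
    using that S.expand_cmp by (auto simp: feats_def set_features_list)
  moreover have "objects (expand e) = objects e" for e :: "('p, 'o) search" by (simp add: expand_def)
  ultimately obtain LB wB where LB: "length LB = Suc (2 * \<alpha> + 2)" "mlps B wB LB"
    "\<And>e h n. ?validB e \<Longrightarrow> A.represents feats e h \<Longrightarrow>
       A.represents feats ((expand ^^ n) e) (?layers (objects e) (concat (replicate n LB)) h)"
    using S.round_exists[of feats expand "(2 * \<alpha> + 2)"] wf_search_expand by blast
  have "(\<lambda>e. f (spread e)) \<in> S.cmp feats 1 r" if "r \<le> B" "f \<in> set (feats r)" for r f
    using that S.spread_cmp by (auto simp: feats_def set_features_list)
  moreover have "objects (spread e) = objects e" for e :: "('p, 'o) search" by (simp add: spread_def)
  ultimately obtain LC wC where LC: "length LC = Suc 1" "mlps B wC LC"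
    "\<And>e h n. ?validB e \<Longrightarrow> A.represents feats e h \<Longrightarrow>
       A.represents feats ((spread ^^ n) e) (?layers (objects e) (concat (replicate n LC)) h)"
    using S.round_exists[of feats spread "1"] wf_search_spread by blast
  have "(\<lambda>e. f (tally e)) \<in> S.cmp feats 1 r" if "r \<le> B" "f \<in> set (feats r)" for r f
    using that S.tally_cmp by (auto simp: feats_def set_features_list)
  moreover have "objects (tally e) = objects e" for e :: "('p, 'o) search" by (simp add: tally_def)
  ultimately obtain LD wD where LD: "length LD = Suc 1" "mlps B wD LD"
    "\<And>e h n. ?validB e \<Longrightarrow> A.represents feats e h \<Longrightarrow>
       A.represents feats ((tally ^^ n) e) (?layers (objects e) (concat (replicate n LD)) h)"
    using S.round_exists[of feats tally "1"] wf_search_tally by blast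
  define sc where "sc b e xs = (of_bool (\<exists>G. candidate e G \<and> applicable D G (b, xs) \<and> regress D G (b, xs) \<subseteq> state e) :: real)"
    for b and e :: "('p, 'o) search" and xs
  have "sc b \<in> plc (F.tup (act_arity D b)) (F.readout_access (F.cmp feats (\<alpha> + 1)) (act_arity D b))"
    if "b \<in> set (acts D)" for b
    using F.score_cmp[OF _ that] unfolding sc_def by auto
  from F.policy_block_exists[where as = "acts D" and sc = sc and ar = "act_arity D" and inp = feats, OF this] obtain LF wF M where LF: "length LF = Suc (\<alpha> + 1)" "mlps B wF LF"
    "\<And>b. is_mlp (M b) 1"
    "\<And>b e h xs. b \<in> set (acts D) \<Longrightarrow> F.tup (act_arity D b) e xs \<Longrightarrow> A.represents feats e h \<Longrightarrow>
      hd (mlp_apply (M b) (eq_features xs @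
        concat (map (?layers (objects e) LF h) (subtuples (min (act_arity D b) B) xs)))) = sc b e xs" by blast
  define w where "w = Max {w0, wA, wB, wC, wD, wF}"
  have w: "w0 \<le> w" "wA \<le> w" "wB \<le> w" "wC \<le> w" "wD \<le> w" "wF \<le> w" by (simp_all add: w_def)
  have "\<exists>N \<in> RelNN (depth_bound T) B w. \<forall>(U :: 'o set) s g. finite U \<longrightarrow> U \<noteq> {} \<longrightarrow>
     g \<in> atoms D U \<longrightarrow> tallied D B (final T (U, s, g)) \<longrightarrow>
     (\<forall>(b, xs) \<in> ground_actions D U. score D N U s g (b, xs) = sc b (final T (U, s, g)) xs)" for T
  proof -
    let ?R = "\<beta> + \<alpha> * T"
    define Ls where "Ls = L0 @ concat (replicate (\<alpha> * T) LA) @ concat (replicate T LB) @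
      concat (replicate (1 + 2 * ?R) LC) @ concat (replicate (Suc ?R) LD) @ LF"
    let ?N = "\<lparr>breadth = B, layers = Ls, readout = M\<rparr>"
    have len: "length (concat (replicate n xs)) = n * length xs" for n and xs :: "'z list"
      by (induction n) auto
    have "length Ls = depth_bound T"
      unfolding Ls_def depth_bound_def length_append len L0(1) LA(1) LB(1) LC(1) LD(1) LF(1)
      by (simp add: algebra_simps)
    moreover have "mlps B w Ls"
      unfolding Ls_def mlps_append using w
      by (intro conjI mlps_replicate mlps_mono[OF L0(2)] mlps_mono[OF LA(2)] mlps_mono[OF LB(2)]
          mlps_mono[OF LC(2)] mlps_mono[OF LD(2)] mlps_mono[OF LF(2)])
    ultimately have N: "?N \<in> RelNN (depth_bound T) B w"
      using LF(3) by (auto simp: RelNN_def mlps_def)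
    have "score D ?N U s g (b, xs) = sc b (final T (U, s, g)) xs"
      if U: "finite U" "U \<noteq> {}" "g \<in> atoms D U" and tallied: "tallied D B (final T (U, s, g))"
        and b: "(b, xs) \<in> ground_actions D U" for U :: "'o set" and s g b xs
    proof -
      let ?e0 = "start (U, s, g)"
      let ?e1 = "(grow ^^ (\<alpha> * T)) ?e0"
      let ?e2 = "(expand ^^ T) ?e1"
      let ?e3 = "(spread ^^ (1 + 2 * ?R)) ?e2"
      let ?e4 = "(tally ^^ Suc ?R) ?e3"
      have final: "final T (U, s, g) = ?e4" by (simp only: final_def Let_def)
      have card: "card (objs {g}) \<le> \<beta>" using level_objs[OF U(3), of "{g}" 0] by simp
      have v0: "?validA ?e0" using U card breadth by (auto simp: wf_search_def start_def)
      have v1: "?validB ?e1" by (rule funpow_invariant[of wf_search, OF wf_search_grow]) (use v0 in simp_all)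
      have v2: "?validB ?e2" by (rule funpow_invariant[of wf_search, OF wf_search_expand]) (use v1 in simp_all)
      have v3: "?validB ?e3" by (rule funpow_invariant[of wf_search, OF wf_search_spread]) (use v2 in simp_all)
      have v4: "?validB ?e4" by (rule funpow_invariant[of wf_search, OF wf_search_tally]) (use v3 in simp_all)
      have o0: "objects ?e0 = U" by (simp add: start_def)
      have o: "objects ?e1 = U" "objects ?e2 = U" "objects ?e3 = U" "objects ?e4 = U"
        by (simp_all only: grow_iterate expand_iterate spread_iterate tally_iterate o0)
      have "I.represents (input_list D) (U, s, g) (input_features D s g)"
        by (simp add: I.represents_def input_features_eq[of D s g _ U])
      from L0(3)[OF _ this] U
      have "I.represents (\<lambda>r. map (\<lambda>\<phi> e. val \<phi> (start e)) (features_list r)) (U, s, g) (?layers U L0 (input_features D s g))"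
        by simp
      then have "A.represents feats ?e0 (?layers U L0 (input_features D s g))"
        by (simp add: I.represents_def A.represents_def feats_def o0)
      from LA(3)[OF v0 this, of "\<alpha> * T", unfolded o0]
      have "A.represents feats ?e1 (?layers U (L0 @ concat (replicate (\<alpha> * T) LA)) (input_features D s g))"
        by simp
      from LB(3)[OF v1 this, of T, unfolded o(1)]
      have "A.represents feats ?e2 (?layers U (L0 @ concat (replicate (\<alpha> * T) LA) @ concat (replicate T LB)) (input_features D s g))"
        by (simp only: fold_append o_apply)
      from LC(3)[OF v2 this, of "1 + 2 * ?R", unfolded o(2)]
      have "A.represents feats ?e3 (?layers U (L0 @ concat (replicate (\<alpha> * T) LA) @ concat (replicate T LB) @
          concat (replicate (1 + 2 * ?R) LC)) (input_features D s g))"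
        by (simp only: fold_append o_apply)
      from LD(3)[OF v3 this, of "Suc ?R", unfolded o(3)]
      have rep: "A.represents feats ?e4 (?layers U (L0 @ concat (replicate (\<alpha> * T) LA) @ concat (replicate T LB) @
          concat (replicate (1 + 2 * ?R) LC) @ concat (replicate (Suc ?R) LD)) (input_features D s g))"
        by (simp only: fold_append o_apply)
      have bx: "b \<in> set (acts D)" "length xs = act_arity D b" "set xs \<subseteq> U"
        using b by (auto simp: ground_actions_def)
      have "F.tup (act_arity D b) ?e4 xs"
        using v4 tallied bx o(4) unfolding F.tup_def final by simp
      from LF(4)[OF bx(1) this rep, unfolded o(4)]
      have "hd (mlp_apply (M b) (eq_features xs @
          concat (map (?layers U Ls (input_features D s g)) (subtuples (min (act_arity D b) B) xs)))) = sc b ?e4 xs"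
        by (simp only: Ls_def fold_append o_apply)
      then show ?thesis unfolding final by (simp add: score_def features_def bx(2))
    qed
    note scores = this
    show ?thesis
    proof (intro bexI[OF _ N] allI impI ballI)
      fix U :: "'o set" and s g and a :: "('a, 'o) gaction"
      assume *: "finite U" "U \<noteq> {}" "g \<in> atoms D U" "tallied D B (final T (U, s, g))" "a \<in> ground_actions D U"
      obtain b xs where a: "a = (b, xs)" by (cases a)
      show "case a of (b, xs) \<Rightarrow> score D ?N U s g (b, xs) = sc b (final T (U, s, g)) xs"
        unfolding a prod.case by (rule scores[OF *[unfolded a]])
    qed
  qed
  then show ?thesis unfolding sc_def correct_scores_def by (intro exI[of _ w] allI)
qed

text \<open>The scores are truth values and some action has score 1, so the actions of maximal score
  are exactly the hits, ties included.\<close>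

lemma represents_if_scores:
  assumes P: "planning_problem D U s g" and \<pi>: "optimal_plan D U s g \<pi>" "length \<pi> \<le> T"
    and k: "\<beta> * k_BWD D U s g \<le> B"
    and N: "tallied D B (final T (U, s, g)) \<Longrightarrow> correct_scores T N U s g"
  shows "represents_bwd D N U s g"
  unfolding represents_bwd_def
proof
  assume g: "g \<notin> s"
  have U: "finite U" "U \<noteq> {}" "g \<in> atoms D U" using P by (auto simp: planning_problem_def)
  have "is_plan D U s g \<pi>" using \<pi>(1) by (simp add: optimal_plan_def is_arg_min_def)
  then obtain s' where "set \<pi> \<subseteq> ground_actions D U" "execute D s \<pi> = Some s'" "{g} \<subseteq> s'"
    by (auto simp: is_plan_def)
  from execute_solves[OF this] \<pi>(2) obtain bs where bs: "solves D U s {g} bs" "length bs \<le> T"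
    using le_trans by blast
  note final = final_correct[OF U(1,2,3) g k bs]
  let ?hit = "\<lambda>a. \<exists>G. candidate (final T (U, s, g)) G \<and> applicable D G a \<and> regress D G a \<subseteq> s"
  have score: "score D N U s g a = of_bool (?hit a)" if "a \<in> ground_actions D U" for a
    using N[OF final(1)] that by (cases a) (auto simp: correct_scores_def final(3))
  obtain a0 where a0: "a0 \<in> ground_actions D U" "?hit a0" using final(4) by blast
  have policy: "a \<in> policy D N U s g \<longleftrightarrow> a \<in> ground_actions D U \<and> ?hit a" for a
  proof
    assume "a \<in> policy D N U s g"
    then have a: "a \<in> ground_actions D U" "\<not> score D N U s g a < score D N U s g a0"
      using a0(1) by (cases a0; auto simp: policy_def is_arg_max_def)+
    then have "?hit a" using score[OF a(1)] score[OF a0(1)] a0(2) by (cases "?hit a") auto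
    with a(1) show "a \<in> ground_actions D U \<and> ?hit a" by blast
  next
    assume "a \<in> ground_actions D U \<and> ?hit a"
    then show "a \<in> policy D N U s g" using score by (auto simp: policy_def is_arg_max_def)
  qed
  show "policy D N U s g \<noteq> {} \<and> (\<forall>a\<in>policy D N U s g. \<exists>\<pi>. bwd_result D U s {} {g} (Some (a # \<pi>)))"
    using policy a0 final(5) by blast
qed

lemma represents_exists:
  "\<exists>w. \<forall>T. \<exists>N \<in> RelNN (depth_bound T) B w. \<forall>(U :: 'o set) s g \<pi>. planning_problem D U s g \<longrightarrow>
     optimal_plan D U s g \<pi> \<longrightarrow> length \<pi> \<le> T \<longrightarrow> \<beta> * k_BWD D U s g \<le> B \<longrightarrow> represents_bwd D N U s g"
proof -
  obtain w where w: "\<And>T. \<exists>N \<in> RelNN (depth_bound T) B w. \<forall>(U :: 'o set) s g. finite U \<longrightarrow> U \<noteq> {} \<longrightarrow>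
     g \<in> atoms D U \<longrightarrow> tallied D B (final T (U, s, g)) \<longrightarrow> correct_scores T N U s g"
    using network_exists by blast
  show ?thesis
  proof (intro exI[of _ w] allI)
    fix T
    obtain N where N: "N \<in> RelNN (depth_bound T) B w" and
      scores: "\<forall>(U :: 'o set) s g. finite U \<longrightarrow> U \<noteq> {} \<longrightarrow>
         g \<in> atoms D U \<longrightarrow> tallied D B (final T (U, s, g)) \<longrightarrow> correct_scores T N U s g"
      using w[of T] by blast
    show "\<exists>N \<in> RelNN (depth_bound T) B w. \<forall>(U :: 'o set) s g \<pi>. planning_problem D U s g \<longrightarrow>
     optimal_plan D U s g \<pi> \<longrightarrow> length \<pi> \<le> T \<longrightarrow> \<beta> * k_BWD D U s g \<le> B \<longrightarrow> represents_bwd D N U s g"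
    proof (intro bexI[OF _ N] allI impI)
      fix U :: "'o set" and s g \<pi>
      assume P: "planning_problem D U s g" "optimal_plan D U s g \<pi>" "length \<pi> \<le> T" "\<beta> * k_BWD D U s g \<le> B"
      from P(1) have "finite U" "U \<noteq> {}" "g \<in> atoms D U" by (simp_all add: planning_problem_def)
      with scores have "tallied D B (final T (U, s, g)) \<Longrightarrow> correct_scores T N U s g" by blast
      from represents_if_scores[OF P this] show "represents_bwd D N U s g" .
    qed
  qed
qed

text \<open>\<open>depth_bound\<close> is affine in \<open>T\<close> with nonnegative coefficients,
  so from \<open>T = 1\<close> on its value at 1 serves as the factor.\<close>

lemma depth_bound_linear: "(\<lambda>T. real (depth_bound T)) \<in> O(\<lambda>T. real T)"
proof (rule bigoI[of _ "real (depth_bound 1)"])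
  have "depth_bound T \<le> depth_bound 1 * T" if T1: "1 \<le> T" for T
  proof -
    obtain t where T: "T = Suc t" using T1 by (cases T) auto
    show ?thesis unfolding T depth_bound_def by (simp add: algebra_simps)
  qed
  then have "real (depth_bound T) \<le> real (depth_bound 1) * real T" if "1 \<le> T" for T
    using that by (metis of_nat_le_iff of_nat_mult)
  then show "\<forall>\<^sub>F T in at_top. norm (real (depth_bound T)) \<le> real (depth_bound 1) * norm (real T)"
    by (intro eventually_at_top_linorderI[of 1]) simp
qed

end

lemma k_BWD_pos:
  assumes "wf_domain D" "planning_problem D U s g"
  shows "1 \<le> k_BWD D U s g"
proof -
  have "finite U" "g \<in> atoms D U" using assms(2) by (auto simp: planning_problem_def)
  then have "card {g} \<le> k_BWD D U s g"
    unfolding k_BWD_def using bwd_call.init by (intro Max_ge finite_bwd_call_cards[OF assms(1)]) blast+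
  then show ?thesis by simp
qed

theorem theorem4p1:
  fixes D :: "('p, 'a) domain"
  assumes "wf_domain D"
  shows "\<exists>depth width :: nat \<Rightarrow> nat.
    (\<lambda>T. real (depth T)) \<in> O(\<lambda>T. real T) \<and>
    (\<forall>T k. \<exists>N \<in> RelNN (depth T) (max_arity D * k) (width (max_arity D * k)).
       \<forall>(U :: 'o set) s\<^sub>0 g \<pi>.
         planning_problem D U s\<^sub>0 g \<longrightarrow>
         optimal_plan D U s\<^sub>0 g \<pi> \<longrightarrow> length \<pi> \<le> T \<longrightarrow>
         k_BWD D U s\<^sub>0 g \<le> k \<longrightarrow>
         represents_bwd D N U s\<^sub>0 g)"
proof -
  define \<alpha> where "\<alpha> = Max (insert 0 (act_arity D ` set (acts D)))"
  have bounded: "bounded_domain D (max_arity D) \<alpha> B" if "max_arity D \<le> B" for B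
    using assms that by unfold_locales (auto simp: max_arity_def \<alpha>_def intro!: Max_ge)
  \<comment> \<open>Any admissible breadth would do here: \<open>depth_bound\<close> depends on the
    arities only and is the same function for all breadths.\<close>
  interpret bounded_domain D "max_arity D" \<alpha> "max_arity D" by (rule bounded) simp
  have "\<exists>w. \<forall>T k. B = max_arity D * k \<longrightarrow> (\<exists>N \<in> RelNN (depth_bound T) B w.
       \<forall>(U :: 'o set) s\<^sub>0 g \<pi>. planning_problem D U s\<^sub>0 g \<longrightarrow> optimal_plan D U s\<^sub>0 g \<pi> \<longrightarrow>
         length \<pi> \<le> T \<longrightarrow> k_BWD D U s\<^sub>0 g \<le> k \<longrightarrow> represents_bwd D N U s\<^sub>0 g)" for B
  proof (cases "max_arity D \<le> B")
    case True
    interpret N: bounded_domain D "max_arity D" \<alpha> B by (rule bounded[OF True])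
    obtain w where w: "\<And>T. \<exists>N \<in> RelNN (depth_bound T) B w. \<forall>(U :: 'o set) s g \<pi>. planning_problem D U s g \<longrightarrow>
     optimal_plan D U s g \<pi> \<longrightarrow> length \<pi> \<le> T \<longrightarrow> max_arity D * k_BWD D U s g \<le> B \<longrightarrow> represents_bwd D N U s g"
      using N.represents_exists by blast
    show ?thesis
    proof (intro exI[of _ w] allI impI)
      fix T k assume B: "B = max_arity D * k"
      have k: "max_arity D * i \<le> B" if "i \<le> k" for i using that B by simp
      show "\<exists>N \<in> RelNN (depth_bound T) B w.
       \<forall>(U :: 'o set) s\<^sub>0 g \<pi>. planning_problem D U s\<^sub>0 g \<longrightarrow> optimal_plan D U s\<^sub>0 g \<pi> \<longrightarrow>
         length \<pi> \<le> T \<longrightarrow> k_BWD D U s\<^sub>0 g \<le> k \<longrightarrow> represents_bwd D N U s\<^sub>0 g"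
        using w[of T] k by meson
    qed
  next
    case False
    show ?thesis
    proof (intro exI[of _ 0] allI impI)
      \<comment> \<open>The breadth is below the arity only if \<open>k = 0\<close>. Since the goal
        set \<open>{g}\<close> already has one atom, no problem satisfies the bound then, and an
        arbitrary network of the required shape is enough.\<close>
      fix T k assume "B = max_arity D * k"
      with False have "k = 0" by (cases k) auto
      let ?N = "\<lparr>breadth = B, layers = replicate (depth_bound T) (\<lambda>_. [[]]), readout = \<lambda>_. [[([], 0)]]\<rparr>"
      have "?N \<in> RelNN (depth_bound T) B 0" by (auto simp: RelNN_def is_mlp_def)
      moreover have "\<not> k_BWD D U s g \<le> k" if "planning_problem D U s g" for U :: "'o set" and s g
        using k_BWD_pos[OF assms that] \<open>k = 0\<close> by simp
      ultimately show "\<exists>N \<in> RelNN (depth_bound T) B 0.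
       \<forall>(U :: 'o set) s\<^sub>0 g \<pi>. planning_problem D U s\<^sub>0 g \<longrightarrow> optimal_plan D U s\<^sub>0 g \<pi> \<longrightarrow>
         length \<pi> \<le> T \<longrightarrow> k_BWD D U s\<^sub>0 g \<le> k \<longrightarrow> represents_bwd D N U s\<^sub>0 g" by blast
    qed
  qed
  then obtain width where "\<And>B T k. B = max_arity D * k \<Longrightarrow> \<exists>N \<in> RelNN (depth_bound T) B (width B).
       \<forall>(U :: 'o set) s\<^sub>0 g \<pi>. planning_problem D U s\<^sub>0 g \<longrightarrow> optimal_plan D U s\<^sub>0 g \<pi> \<longrightarrow>
         length \<pi> \<le> T \<longrightarrow> k_BWD D U s\<^sub>0 g \<le> k \<longrightarrow> represents_bwd D N U s\<^sub>0 g"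
    by metis
  with depth_bound_linear show ?thesis by (intro exI[of _ depth_bound] exI[of _ width]) simp
qed

end
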